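(* Let $\Bbbk$ be a field of characteristic $p>0$. Then the pair of operads $(\mathsf{Ass},\mathsf{Lie})$ over $\Bbbk$ is a PBW-pair in the sense of Mikhalev and Shestakov, so that for every Lie algebra $L$ over $\Bbbk$ one has $S(L)=U(\mathrm{Ab}\,L)\cong\operatorname{gr}U(L)$ via the canonical surjection $\pi\colon U(\mathrm{Ab}\,L)\twoheadrightarrow\operatorname{gr}U(L)$; but there is no way to choose vector space isomorphisms $S(L)\cong U(L)$, for all Lie algebras $L$ over $\Bbbk$, so that they are natural in $L$ (i.e. natural with respect to Lie algebra morphisms).
   Context: For a Lie algebra $L$ over $\Bbbk$, $U(L)$ is its universal enveloping associative algebra (with respect to the functor sending an associative algebra to the Lie algebra with the same underlying space and bracket $[a,b]=ab-ba$). $\mathrm{Ab}\,L$ is the abelian Lie algebra (zero bracket) on the underlying vector space of $L$, and $S(L)=U(\mathrm{Ab}\,L)$ is the symmetric algebra of the vector space $L$. The canonical filtration on $U(L)$ is the one whose $k$-th term is spanned by products of at most $k$ elements of the image of $L$; $\operatorname{gr}U(L)$ is the associated graded algebra, and $\pi\colon U(\mathrm{Ab}\,L)\to\operatorname{gr}U(L)$ is the canonical surjective algebra morphism induced by the map from $L$ to the first graded component of $\operatorname{gr}U(L)$. The pair $(\mathsf{Ass},\mathsf{Lie})$ is a PBW-pair in the sense of Mikhalev and Shestakov if $\pi$ is an isomorphism for every Lie algebra $L$. *)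

theory Defs
  imports "HOL-Algebra.Algebra" "HOL-Algebra.Algebraic_Closure_Type" "HOL-Library.Poly_Mapping"
begin

section \<open>Lie algebras\<close>

text \<open>
  The ground field is a type \<open>'k\<close> of class \<open>field\<close>; \<open>ring_of_type_algebra\<close> is the same field as
  a record, as required by the locale \<open>module\<close>. As usual in HOL-Algebra, the components
  \<open>mult\<close> and \<open>one\<close> of a record used only as a module are ignored.
\<close>

record ('k, 'a) lie_ring = "('k, 'a) module" +
  lie :: "'a \<Rightarrow> 'a \<Rightarrow> 'a"

text \<open>The bracket is alternating, which in characteristic 2 is stronger than antisymmetric.\<close>

locale lie_algebra = Module.module "ring_of_type_algebra :: 'k::field ring" L
  for L :: "('k::field, 'a) lie_ring" (structure) +
  assumes lie_closed: "\<lbrakk>x \<in> carrier L; y \<in> carrier L\<rbrakk> \<Longrightarrow> lie L x y \<in> carrier L"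
    and lie_add_left: "\<lbrakk>x \<in> carrier L; y \<in> carrier L; z \<in> carrier L\<rbrakk> \<Longrightarrow>
      lie L (x \<oplus> y) z = lie L x z \<oplus> lie L y z"
    and lie_add_right: "\<lbrakk>x \<in> carrier L; y \<in> carrier L; z \<in> carrier L\<rbrakk> \<Longrightarrow>
      lie L x (y \<oplus> z) = lie L x y \<oplus> lie L x z"
    and lie_smult_left: "\<lbrakk>x \<in> carrier L; y \<in> carrier L\<rbrakk> \<Longrightarrow> lie L (c \<odot> x) y = c \<odot> lie L x y"
    and lie_smult_right: "\<lbrakk>x \<in> carrier L; y \<in> carrier L\<rbrakk> \<Longrightarrow> lie L x (c \<odot> y) = c \<odot> lie L x y"
    and lie_self: "x \<in> carrier L \<Longrightarrow> lie L x x = \<zero>"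
    and jacobi: "\<lbrakk>x \<in> carrier L; y \<in> carrier L; z \<in> carrier L\<rbrakk> \<Longrightarrow>
      lie L x (lie L y z) \<oplus> lie L y (lie L z x) \<oplus> lie L z (lie L x y) = \<zero>"

definition lie_hom :: "('k, 'a) lie_ring \<Rightarrow> ('k, 'b) lie_ring \<Rightarrow> ('a \<Rightarrow> 'b) set" where
  "lie_hom L M = {f \<in> carrier L \<rightarrow> carrier M.
     (\<forall>x\<in>carrier L. \<forall>y\<in>carrier L. f (x \<oplus>\<^bsub>L\<^esub> y) = f x \<oplus>\<^bsub>M\<^esub> f y) \<and>
     (\<forall>c. \<forall>x\<in>carrier L. f (c \<odot>\<^bsub>L\<^esub> x) = c \<odot>\<^bsub>M\<^esub> f x) \<and>
     (\<forall>x\<in>carrier L. \<forall>y\<in>carrier L. f (lie L x y) = lie M (f x) (f y))}"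

definition Ab :: "('k, 'a) lie_ring \<Rightarrow> ('k, 'a) lie_ring" where
  "Ab L = L\<lparr>lie := \<lambda>_ _. \<zero>\<^bsub>L\<^esub>\<rparr>"


section \<open>Unital associative algebras\<close>

text \<open>
  An associative algebra is a \<open>module\<close> record; the library locale \<open>algebra\<close> is not used since it
  requires commutativity.
\<close>

definition alg_hom :: "('k, 'a) module \<Rightarrow> ('k, 'b) module \<Rightarrow> ('a \<Rightarrow> 'b) set" where
  "alg_hom A B = {h \<in> ring_hom A B. \<forall>c. \<forall>x\<in>carrier A. h (c \<odot>\<^bsub>A\<^esub> x) = c \<odot>\<^bsub>B\<^esub> h x}"

definition alg_iso :: "('k, 'a) module \<Rightarrow> ('k, 'b) module \<Rightarrow> ('a \<Rightarrow> 'b) set" where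
  "alg_iso A B = {h \<in> alg_hom A B. bij_betw h (carrier A) (carrier B)}"

definition linear_iso :: "('k, 'a) module \<Rightarrow> ('k, 'b) module \<Rightarrow> ('a \<Rightarrow> 'b) set" where
  "linear_iso A B = {h. bij_betw h (carrier A) (carrier B) \<and>
     (\<forall>x\<in>carrier A. \<forall>y\<in>carrier A. h (x \<oplus>\<^bsub>A\<^esub> y) = h x \<oplus>\<^bsub>B\<^esub> h y) \<and>
     (\<forall>c. \<forall>x\<in>carrier A. h (c \<odot>\<^bsub>A\<^esub> x) = c \<odot>\<^bsub>B\<^esub> h x)}"

definition lin_span :: "('k::field, 'a) module \<Rightarrow> 'a set \<Rightarrow> 'a set" where
  "lin_span A S = \<Inter> {H. submodule H (ring_of_type_algebra :: 'k ring) A \<and> S \<subseteq> H}"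

definition quot_alg :: "('k, 'a) module \<Rightarrow> 'a set \<Rightarrow> ('k, 'a set) module" where
  "quot_alg A I = ring.extend (A Quot I)
     (module.fields (\<lambda>c C. \<Union>x\<in>C. I +>\<^bsub>A\<^esub> (c \<odot>\<^bsub>A\<^esub> x)))"

text \<open>
  Words form a monoid under concatenation, so that \<open>'a list \<Rightarrow>\<^sub>0 'k\<close> with the convolution product
  of \<open>Poly_Mapping\<close> is the free associative algebra on \<open>'a\<close>.
\<close>

instantiation list :: (type) monoid_add
begin

definition zero_list :: "'a list" where "0 = []"

definition plus_list :: "'a list \<Rightarrow> 'a list \<Rightarrow> 'a list" where "xs + ys = xs @ ys"

instance by standard (simp_all add: zero_list_def plus_list_def)

end

definition free_alg :: "'a set \<Rightarrow> ('k::field, 'a list \<Rightarrow>\<^sub>0 'k) module" where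
  "free_alg S = \<lparr>carrier = {f. \<forall>w\<in>Poly_Mapping.keys f. set w \<subseteq> S}, monoid.mult = (*), one = 1,
     ring.zero = 0, ring.add = (+),
     module.smult = (\<lambda>c f. Poly_Mapping.single [] c * f)\<rparr>"

definition free_gen :: "'a \<Rightarrow> ('a list \<Rightarrow>\<^sub>0 'k::field)" where
  "free_gen x = Poly_Mapping.single [x] 1"

definition word_prod :: "('k, 'b) module \<Rightarrow> ('a \<Rightarrow> 'b) \<Rightarrow> 'a list \<Rightarrow> 'b" where
  "word_prod A \<theta> w = foldr (\<lambda>x y. \<theta> x \<otimes>\<^bsub>A\<^esub> y) w \<one>\<^bsub>A\<^esub>"

definition free_lift ::
  "('k::field, 'b) module \<Rightarrow> ('a \<Rightarrow> 'b) \<Rightarrow> ('a list \<Rightarrow>\<^sub>0 'k) \<Rightarrow> 'b" where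
  "free_lift A \<theta> f = (\<Oplus>\<^bsub>A\<^esub>w\<in>Poly_Mapping.keys f. Poly_Mapping.lookup f w \<odot>\<^bsub>A\<^esub> word_prod A \<theta> w)"


section \<open>Universal enveloping algebras\<close>

definition env_rels :: "('k::field, 'a) lie_ring \<Rightarrow> ('a list \<Rightarrow>\<^sub>0 'k) set" where
  "env_rels L =
     {free_gen (x \<oplus>\<^bsub>L\<^esub> y) - (free_gen x + free_gen y) | x y. x \<in> carrier L \<and> y \<in> carrier L} \<union>
     {free_gen (c \<odot>\<^bsub>L\<^esub> x) - Poly_Mapping.single [] c * free_gen x | c x. x \<in> carrier L} \<union>
     {free_gen x * free_gen y - free_gen y * free_gen x - free_gen (lie L x y) | x y.
        x \<in> carrier L \<and> y \<in> carrier L}"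

definition env_ideal :: "('k::field, 'a) lie_ring \<Rightarrow> ('a list \<Rightarrow>\<^sub>0 'k) set" where
  "env_ideal L = Idl\<^bsub>free_alg (carrier L)\<^esub> (env_rels L)"

definition Env :: "('k::field, 'a) lie_ring \<Rightarrow> ('k, ('a list \<Rightarrow>\<^sub>0 'k) set) module" where
  "Env L = quot_alg (free_alg (carrier L)) (env_ideal L)"

definition env_gen :: "('k::field, 'a) lie_ring \<Rightarrow> 'a \<Rightarrow> ('a list \<Rightarrow>\<^sub>0 'k) set" where
  "env_gen L x = env_ideal L +>\<^bsub>free_alg (carrier L)\<^esub> free_gen x"

text \<open>
  The algebra morphism out of an enveloping algebra determined by the values \<open>\<theta>\<close> on generators:
  a coset is sent to the common value of the evaluation at \<open>\<theta>\<close> of its elements.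
\<close>

definition env_lift ::
  "('k::field, 'b) module \<Rightarrow> ('a \<Rightarrow> 'b) \<Rightarrow> ('a list \<Rightarrow>\<^sub>0 'k) set \<Rightarrow> 'b" where
  "env_lift A \<theta> C = the_elem (free_lift A \<theta> ` C)"

definition Env_map ::
  "('k::field, 'b) lie_ring \<Rightarrow> ('a \<Rightarrow> 'b) \<Rightarrow> ('a list \<Rightarrow>\<^sub>0 'k) set \<Rightarrow> ('b list \<Rightarrow>\<^sub>0 'k) set" where
  "Env_map M f = env_lift (Env M) (\<lambda>x. env_gen M (f x))"

definition Sym :: "('k::field, 'a) lie_ring \<Rightarrow> ('k, ('a list \<Rightarrow>\<^sub>0 'k) set) module" where
  "Sym L = Env (Ab L)"

definition Sym_map ::
  "('k::field, 'b) lie_ring \<Rightarrow> ('a \<Rightarrow> 'b) \<Rightarrow> ('a list \<Rightarrow>\<^sub>0 'k) set \<Rightarrow> ('b list \<Rightarrow>\<^sub>0 'k) set" where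
  "Sym_map M f = Env_map (Ab M) f"


section \<open>The canonical filtration and the associated graded algebra\<close>

definition env_filt :: "('k::field, 'a) lie_ring \<Rightarrow> nat \<Rightarrow> ('a list \<Rightarrow>\<^sub>0 'k) set set" where
  "env_filt L n = lin_span (Env L)
     {word_prod (Env L) (env_gen L) w | w. set w \<subseteq> carrier L \<and> length w \<le> n}"

text \<open>The filtration shifted by one, \<open>F (n - 1)\<close>, with \<open>F (-1) = 0\<close>.\<close>

definition env_filt_below :: "('k::field, 'a) lie_ring \<Rightarrow> nat \<Rightarrow> ('a list \<Rightarrow>\<^sub>0 'k) set set" where
  "env_filt_below L n = (case n of 0 \<Rightarrow> {\<zero>\<^bsub>Env L\<^esub>} | Suc m \<Rightarrow> env_filt L m)"

text \<open>
  The quotient \<open>F n / F (n - 1)\<close>. \<open>A_Mod\<close> yields the additive quotient group as a \<open>monoid\<close> record,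
  so its addition, zero and finite sums are \<open>\<otimes>\<close>, \<open>\<one>\<close> and \<open>\<Otimes>\<close>.
\<close>

definition gr_comp ::
  "('k::field, 'a) lie_ring \<Rightarrow> nat \<Rightarrow> ('a list \<Rightarrow>\<^sub>0 'k) set set monoid" where
  "gr_comp L n = (Env L)\<lparr>carrier := env_filt L n\<rparr> A_Mod env_filt_below L n"

text \<open>
  The direct sum of the quotients, as finitely supported sequences. The degree \<open>n\<close> part of a
  product is the sum over \<open>i \<le> n\<close> of the classes modulo \<open>F (n - 1)\<close> of products of
  representatives in degrees \<open>i\<close> and \<open>n - i\<close>.
\<close>

definition Gr ::
  "('k::field, 'a) lie_ring \<Rightarrow> ('k, nat \<Rightarrow> ('a list \<Rightarrow>\<^sub>0 'k) set set) module" where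
  "Gr L = \<lparr>
     carrier = {g. (\<forall>n. g n \<in> carrier (gr_comp L n)) \<and> finite {n. g n \<noteq> \<one>\<^bsub>gr_comp L n\<^esub>}},
     monoid.mult = (\<lambda>g h n. \<Otimes>\<^bsub>gr_comp L n\<^esub>i\<in>{..n}.
       rcoset_mult (Env L) (env_filt_below L n) (g i) (h (n - i))),
     one = (\<lambda>n. if n = 0 then env_filt_below L 0 +>\<^bsub>Env L\<^esub> \<one>\<^bsub>Env L\<^esub> else \<one>\<^bsub>gr_comp L n\<^esub>),
     ring.zero = (\<lambda>n. \<one>\<^bsub>gr_comp L n\<^esub>),
     ring.add = (\<lambda>g h n. g n \<otimes>\<^bsub>gr_comp L n\<^esub> h n),
     module.smult = (\<lambda>c g n. \<Union>x\<in>g n. env_filt_below L n +>\<^bsub>Env L\<^esub> (c \<odot>\<^bsub>Env L\<^esub> x))\<rparr>"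

definition gr_gen ::
  "('k::field, 'a) lie_ring \<Rightarrow> 'a \<Rightarrow> nat \<Rightarrow> ('a list \<Rightarrow>\<^sub>0 'k) set set" where
  "gr_gen L x = (\<lambda>n. if n = 1 then env_filt_below L 1 +>\<^bsub>Env L\<^esub> env_gen L x
                             else \<one>\<^bsub>gr_comp L n\<^esub>)"

definition pbw_map ::
  "('k::field, 'a) lie_ring \<Rightarrow> ('a list \<Rightarrow>\<^sub>0 'k) set \<Rightarrow> nat \<Rightarrow> ('a list \<Rightarrow>\<^sub>0 'k) set set" where
  "pbw_map L = env_lift (Gr L) (gr_gen L)"

text \<open>
  \<open>(Ass, Lie)\<close> over \<open>'k\<close> is a PBW-pair. HOL cannot quantify over types inside a formula, so the
  Lie algebras are those with carrier in \<open>'a\<close>; a theorem with \<open>'a\<close> free covers all of them.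
\<close>

definition Ass_Lie_PBW_pair :: "'k::field itself \<Rightarrow> 'a itself \<Rightarrow> bool" where
  "Ass_Lie_PBW_pair _ _ \<longleftrightarrow>
     (\<forall>L :: ('k, 'a) lie_ring. lie_algebra L \<longrightarrow> pbw_map L \<in> alg_iso (Env (Ab L)) (Gr L))"

text \<open>
  Again the Lie algebras are those with carrier in \<open>'a\<close>. A family over all Lie algebras restricts
  to one of this kind, so the nonexistence of the latter is the stronger claim. It fails for types
  \<open>'a\<close> that are too small, such as \<open>unit\<close>; if \<open>'a\<close> is infinite and \<open>'k\<close> injects into it, then
  every Lie algebra of countable dimension has an isomorphic copy with carrier in \<open>'a\<close>.
\<close>

definition natural_linear_isos ::
  "(('k::field, 'a) lie_ring \<Rightarrow> ('a list \<Rightarrow>\<^sub>0 'k) set \<Rightarrow> ('a list \<Rightarrow>\<^sub>0 'k) set) \<Rightarrow> bool" where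
  "natural_linear_isos \<eta> \<longleftrightarrow>
     (\<forall>L. lie_algebra L \<longrightarrow> \<eta> L \<in> linear_iso (Sym L) (Env L)) \<and>
     (\<forall>L M f. lie_algebra L \<and> lie_algebra M \<and> f \<in> lie_hom L M \<longrightarrow>
        (\<forall>s\<in>carrier (Sym L). \<eta> M (Sym_map M f s) = Env_map M f (\<eta> L s)))"

end

theory Submission
  imports Defs
begin

text \<open>
  Let \<open>F\<close> be the free algebra on the elements of \<open>L\<close>. On the class of \<open>f \<in> F\<close> the canonical map
  \<open>\<pi>\<close> is the sequence of the classes of the homogeneous components of \<open>f\<close> (\<open>gr_symbol\<close>,
  \<open>pbw_map_class\<close>). That it is a surjective morphism is formal; injectivity is the
  Poincare-Birkhoff-Witt theorem: a homogeneous \<open>f\<close> of degree \<open>n\<close> which modulo the ideal of \<open>U(L)\<close>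
  agrees with an element of degree below \<open>n\<close> lies in the ideal of \<open>U(Ab L)\<close>.

  Over a field the evaluation map from the vector space \<open>W\<close> with basis \<open>L\<close> onto \<open>L\<close> has a linear
  section, called \<open>coord\<close>. Through it the bracket of \<open>L\<close> lifts to a Lie bracket on \<open>W\<close>, namely
  \<open>[a, b] = coord (lie L a b)\<close> on basis elements, and \<open>coord\<close> becomes an embedding of Lie algebras.
  So it is enough to treat \<open>W\<close>, which has a distinguished basis, and no basis of \<open>L\<close> is chosen. After
  a linear ordering of the basis, \<open>W\<close> acts on the polynomials in the basis elements in such a way
  that a basis element acts as multiplication by itself up to terms of lower degree; this is the
  classical construction by recursion on the degree (\<open>monomial_act\<close>), and the Jacobi identity makes
  it an action (\<open>act_commutator\<close>). The ideal of \<open>U(L)\<close> annihilates the polynomials, and an \<open>f\<close> as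
  above sends \<open>1\<close>, up to lower degree, to its symbol, the polynomial obtained by replacing the letters
  by their coordinates and letting them commute. Hence the symbol of \<open>f\<close> vanishes (\<open>symbol_leading_zero\<close>), which means that \<open>f\<close> lies in the
  ideal of \<open>U(Ab L)\<close> (\<open>env_ideal_Ab_iff\<close>).

  For the negative part, let \<open>\<eta>\<close> be natural and let \<open>K\<close> be the one-dimensional Lie algebra spanned
  by \<open>t\<close>. Then \<open>\<eta>\<close> sends \<open>t^n \<in> S(K)\<close> to a polynomial \<open>P\<^sub>n(t)\<close>, and naturality for the morphism
  \<open>K \<rightarrow> M\<close>, \<open>t \<mapsto> l\<close> shows that \<open>\<eta>\<close> sends \<open>l^n\<close> to \<open>P\<^sub>n(l)\<close> for every element \<open>l\<close> of every Lie
  algebra \<open>M\<close>. In characteristic \<open>p\<close> both \<open>l\<close> and \<open>l^p\<close> are additive functions of \<open>l\<close> with values in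
  \<open>S(M)\<close>, so \<open>P\<^sub>1\<close> and \<open>P\<^sub>p\<close> are additive on \<open>U(M)\<close>. If \<open>M\<close> is the free algebra on two letters with the
  commutator bracket, this leaves only the linear terms of \<open>P\<^sub>1\<close> and \<open>P\<^sub>p\<close>
  (\<open>additive_poly_linear\<close>). So \<open>\<eta>\<close> maps the linearly independent elements \<open>t\<close> and \<open>t^p\<close> to multiples
  of \<open>t\<close> and is not injective. The size condition on the carriers serves to realise this \<open>M\<close>
  inside the given type (\<open>ex_inj_free_algebra\<close>).
\<close>

section \<open>Linear maps between free vector spaces\<close>

definition pm_scale :: "'k::field \<Rightarrow> ('x \<Rightarrow>\<^sub>0 'k) \<Rightarrow> ('x \<Rightarrow>\<^sub>0 'k)" where
  "pm_scale c f = Poly_Mapping.map ((*) c) f"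

lemma lookup_pm_scale [simp]: "Poly_Mapping.lookup (pm_scale c f) k = c * Poly_Mapping.lookup f k"
  by (simp add: pm_scale_def Poly_Mapping.map.rep_eq when_def)

global_interpretation pm: vector_space pm_scale
  by unfold_locales (auto intro!: poly_mapping_eqI simp: lookup_add algebra_simps)

lemma pm_scale_single [simp]:
  "pm_scale c (Poly_Mapping.single k d) = Poly_Mapping.single k (c * d)"
  by (rule poly_mapping_eqI) (simp add: lookup_single when_def)

lemma single_zero_mult: "Poly_Mapping.single 0 c * f = pm_scale c f"
  by (simp add: pm_scale_def mult_map_scale_conv_mult)

lemma poly_mapping_sum_singles:
  "f = (\<Sum>k\<in>Poly_Mapping.keys f. Poly_Mapping.single k (Poly_Mapping.lookup f k))"
  by (rule poly_mapping_eqI)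
    (auto simp: lookup_sum lookup_single when_def in_keys_iff cong: if_cong)

lemma pm_scale_mult_left: "pm_scale c f * g = pm_scale c (f * g)"
  by (simp add: mult.assoc flip: single_zero_mult)

lemma pm_scale_mult_right: "f * pm_scale c g = pm_scale c (f * g)"
proof -
  have "f * Poly_Mapping.single 0 c = Poly_Mapping.single 0 c * f"
    by (subst (1 2) poly_mapping_sum_singles[of f])
      (simp add: sum_distrib_left sum_distrib_right mult_single mult.commute)
  then show ?thesis by (simp flip: single_zero_mult mult.assoc)
qed

lemma keys_pm_scale: "Poly_Mapping.keys (pm_scale c f) \<subseteq> Poly_Mapping.keys f"
  by (auto simp: in_keys_iff)

definition lin_ext :: "('x \<Rightarrow> ('y \<Rightarrow>\<^sub>0 'k)) \<Rightarrow> ('x \<Rightarrow>\<^sub>0 'k::field) \<Rightarrow> ('y \<Rightarrow>\<^sub>0 'k)" where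
  "lin_ext g f = (\<Sum>k\<in>Poly_Mapping.keys f. pm_scale (Poly_Mapping.lookup f k) (g k))"

definition pm_linear :: "(('x \<Rightarrow>\<^sub>0 'k::field) \<Rightarrow> ('y \<Rightarrow>\<^sub>0 'k)) \<Rightarrow> bool" where
  "pm_linear h \<longleftrightarrow> (\<forall>f g. h (f + g) = h f + h g) \<and> (\<forall>c f. h (pm_scale c f) = pm_scale c (h f))"

lemma pm_linearI:
  assumes "\<And>f g. h (f + g) = h f + h g" "\<And>c f. h (pm_scale c f) = pm_scale c (h f)"
  shows "pm_linear h"
  using assms by (simp add: pm_linear_def)

lemma pm_linear_add: "pm_linear h \<Longrightarrow> h (f + g) = h f + h g"
  and pm_linear_scale: "pm_linear h \<Longrightarrow> h (pm_scale c f) = pm_scale c (h f)"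
  by (simp_all add: pm_linear_def)

lemma pm_linear_zero: "pm_linear h \<Longrightarrow> h 0 = 0"
  using pm_linear_add[of h 0 0] by simp

lemma pm_linear_minus: "pm_linear h \<Longrightarrow> h (- f) = - h f"
  using pm_linear_scale[of h "-1" f] by simp

lemma pm_linear_diff: "pm_linear h \<Longrightarrow> h (f - g) = h f - h g"
  using pm_linear_add[of h f "- g"] by (simp add: pm_linear_minus)

lemma pm_linear_sum: "pm_linear h \<Longrightarrow> h (sum g A) = (\<Sum>x\<in>A. h (g x))"
  by (induction A rule: infinite_finite_induct) (auto simp: pm_linear_zero pm_linear_add)

text \<open>
  The main tool for equations between bilinear expressions: it reduces them to basis elements, one
  argument at a time.
\<close>

lemma pm_linear_eqI:
  assumes "pm_linear h" "pm_linear h'"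
    and "\<And>k. k \<in> Poly_Mapping.keys f \<Longrightarrow> h (Poly_Mapping.single k 1) = h' (Poly_Mapping.single k 1)"
  shows "h f = h' f"
proof -
  have f: "f = (\<Sum>k\<in>Poly_Mapping.keys f. pm_scale (Poly_Mapping.lookup f k) (Poly_Mapping.single k 1))"
    using poly_mapping_sum_singles[of f] by simp
  show ?thesis
    by (subst (1 2) f) (simp add: assms pm_linear_sum pm_linear_scale del: pm_scale_single)
qed

lemma lin_ext_superset:
  assumes "finite S" "Poly_Mapping.keys f \<subseteq> S"
  shows "lin_ext g f = (\<Sum>k\<in>S. pm_scale (Poly_Mapping.lookup f k) (g k))"
  unfolding lin_ext_def
  by (rule sum.mono_neutral_left) (use assms in \<open>auto simp: in_keys_iff\<close>)

lemma pm_linear_lin_ext [intro!, simp]: "pm_linear (lin_ext g)"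
proof (rule pm_linearI)
  fix f h :: "'a \<Rightarrow>\<^sub>0 'b" and c
  let ?S = "Poly_Mapping.keys f \<union> Poly_Mapping.keys h"
  have "Poly_Mapping.keys (f + h) \<subseteq> ?S" by (rule keys_add)
  then show "lin_ext g (f + h) = lin_ext g f + lin_ext g h"
    by (subst (1 2 3) lin_ext_superset[where S = ?S])
      (auto simp: lookup_add pm.scale_left_distrib sum.distrib)
  show "lin_ext g (pm_scale c f) = pm_scale c (lin_ext g f)"
    by (subst (1 2) lin_ext_superset[where S = "Poly_Mapping.keys f"])
      (use keys_pm_scale[of c f] in \<open>auto simp: pm.scale_sum_right\<close>)
qed

lemmas lin_ext_add = pm_linear_add[OF pm_linear_lin_ext]
  and lin_ext_scale = pm_linear_scale[OF pm_linear_lin_ext]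
  and lin_ext_zero [simp] = pm_linear_zero[OF pm_linear_lin_ext]
  and lin_ext_minus = pm_linear_minus[OF pm_linear_lin_ext]
  and lin_ext_diff = pm_linear_diff[OF pm_linear_lin_ext]

lemma lin_ext_single [simp]: "lin_ext g (Poly_Mapping.single k c) = pm_scale c (g k)"
  by (subst lin_ext_superset[where S = "{k}"]) auto

lemma lin_ext_cong [fundef_cong]:
  "f = f' \<Longrightarrow> (\<And>k. k \<in> Poly_Mapping.keys f' \<Longrightarrow> g k = g' k) \<Longrightarrow> lin_ext g f = lin_ext g' f'"
  by (simp add: lin_ext_def)

lemma lin_ext_fun_diff: "lin_ext (\<lambda>k. g k - g' k) f = lin_ext g f - lin_ext g' f"
  by (simp add: lin_ext_def pm.scale_right_diff_distrib sum_subtractf)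

lemma lin_ext_fun_minus: "lin_ext (\<lambda>k. - g k) f = - lin_ext g f"
  by (simp add: lin_ext_def sum_negf)

text \<open>
  As a rewrite rule this needs an instantiated \<open>h\<close>, since the pattern \<open>h (lin_ext g f)\<close> matches
  almost anything.
\<close>

lemma pm_linear_comp_lin_ext: "pm_linear h \<Longrightarrow> h (lin_ext g f) = lin_ext (\<lambda>k. h (g k)) f"
  by (simp add: lin_ext_def pm_linear_sum pm_linear_scale)

lemma lin_ext_eq_0: "(\<And>k. k \<in> Poly_Mapping.keys f \<Longrightarrow> g k = 0) \<Longrightarrow> lin_ext g f = 0"
  by (simp add: lin_ext_def)

lemma pm_linear_param: "(\<And>k. pm_linear (g k)) \<Longrightarrow> pm_linear (\<lambda>s. lin_ext (\<lambda>k. g k s) f)"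
  by (rule pm_linearI)
    (simp_all add: lin_ext_def pm_linear_add pm_linear_scale pm.scale_right_distrib sum.distrib mult.commute
      pm.scale_sum_right)

lemma keys_lin_ext_subset:
  "Poly_Mapping.keys (lin_ext g f) \<subseteq> (\<Union>k\<in>Poly_Mapping.keys f. Poly_Mapping.keys (g k))"
proof
  fix x assume "x \<in> Poly_Mapping.keys (lin_ext g f)"
  then have "(\<Sum>k\<in>Poly_Mapping.keys f. Poly_Mapping.lookup f k * Poly_Mapping.lookup (g k) x) \<noteq> 0"
    by (simp add: in_keys_iff lin_ext_def lookup_sum)
  then obtain k where "k \<in> Poly_Mapping.keys f" "Poly_Mapping.lookup f k * Poly_Mapping.lookup (g k) x \<noteq> 0"
    by (meson sum.neutral)
  then show "x \<in> (\<Union>k\<in>Poly_Mapping.keys f. Poly_Mapping.keys (g k))"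
    by (auto simp: in_keys_iff)
qed

lemma lin_ext_swap:
  "lin_ext (\<lambda>a. lin_ext (\<lambda>b. F a b) v) u = lin_ext (\<lambda>b. lin_ext (\<lambda>a. F a b) u) v"
  unfolding lin_ext_def by (simp add: pm.scale_sum_right mult.commute, rule sum.swap)

lemma pm_linear_mult_left: "pm_linear (\<lambda>f. f * g)"
  by (rule pm_linearI) (simp_all add: distrib_right pm_scale_mult_left)

lemma pm_linear_mult_right: "pm_linear (\<lambda>g. f * g)"
  by (rule pm_linearI) (simp_all add: distrib_left pm_scale_mult_right)

lemma pm_linear_comp: "pm_linear h \<Longrightarrow> pm_linear h' \<Longrightarrow> pm_linear (\<lambda>f. h (h' f))"
  by (rule pm_linearI) (simp_all add: pm_linear_add pm_linear_scale)

section \<open>A Lie bracket on a free vector space acts on polynomials\<close>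

text \<open>
  The bound is strict, so that the terms lower than degree \<open>n\<close> form \<open>low_degree n\<close> also for
  \<open>n = 0\<close>.
\<close>

definition low_degree :: "nat \<Rightarrow> ('i multiset \<Rightarrow>\<^sub>0 'k::field) set" where
  "low_degree n = {f. \<forall>q\<in>Poly_Mapping.keys f. size q < n}"

lemma low_degree_zero [simp]: "0 \<in> low_degree n"
  and low_degree_add: "f \<in> low_degree n \<Longrightarrow> g \<in> low_degree n \<Longrightarrow> f + g \<in> low_degree n"
  and low_degree_single: "size q < n \<Longrightarrow> Poly_Mapping.single q c \<in> low_degree n"
  and low_degree_mono: "f \<in> low_degree n \<Longrightarrow> n \<le> n' \<Longrightarrow> f \<in> low_degree n'"
  using keys_add[of f g] by (auto simp: low_degree_def split: if_splits)

lemma low_degree_lin_ext: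
  assumes "\<And>k. k \<in> Poly_Mapping.keys f \<Longrightarrow> g k \<in> low_degree n"
  shows "lin_ext g f \<in> low_degree n"
  using keys_lin_ext_subset[of g f] assms by (fastforce simp: low_degree_def)

lemma low_degree_scale: "s \<in> low_degree n \<Longrightarrow> pm_scale c s \<in> low_degree n"
  using keys_pm_scale[of c s] by (auto simp: low_degree_def)

lemma low_degree_diff: "s \<in> low_degree n \<Longrightarrow> t \<in> low_degree n \<Longrightarrow> s - t \<in> low_degree n"
  using low_degree_add[of s n "- t"] low_degree_scale[of t n "- 1"] by simp

text \<open>
  A Lie bracket on the vector space with basis \<open>'i\<close>, given by its values on basis elements. The
  alternating law has to be demanded on the basis together with antisymmetry, because the bracket
  of a combination with itself contains both kinds of terms.
\<close>

locale lie_structure_constants =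
  fixes br :: "'i \<Rightarrow> 'i \<Rightarrow> ('i \<Rightarrow>\<^sub>0 'k::field)"
    and le :: "'i \<Rightarrow> 'i \<Rightarrow> bool"
  assumes br_self: "br a a = 0"
    and br_antisym: "br b a = - br a b"
    and br_jacobi: "lin_ext (br a) (br b c) + lin_ext (br b) (br c a) + lin_ext (br c) (br a b) = 0"
    and le_refl: "le a a"
    and le_trans: "le a b \<Longrightarrow> le b c \<Longrightarrow> le a c"
    and le_total: "le a b \<or> le b a"
    and le_antisym: "le a b \<Longrightarrow> le b a \<Longrightarrow> a = b"
begin

definition below_all :: "'i \<Rightarrow> 'i multiset \<Rightarrow> bool" where
  "below_all a m \<longleftrightarrow> (\<forall>z\<in>#m. le a z)"

definition min_letter :: "'i multiset \<Rightarrow> 'i" where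
  "min_letter m = (SOME y. y \<in># m \<and> below_all y m)"

lemma ex_min_letter: "m \<noteq> {#} \<Longrightarrow> \<exists>y. y \<in># m \<and> below_all y m"
proof (induction m)
  case (add x m)
  show ?case
  proof (cases "m = {#}")
    case False
    then obtain y where "y \<in># m" "below_all y m" using add by blast
    have "below_all x m" if "le x y" using \<open>below_all y m\<close> that le_trans by (auto simp: below_all_def)
    with \<open>y \<in># m\<close> \<open>below_all y m\<close> show ?thesis
      using le_total[of x y] le_refl[of x] by (auto simp: below_all_def)
  qed (auto simp: below_all_def le_refl)
qed simp

lemma min_letter:
  assumes "m \<noteq> {#}"
  shows "min_letter m \<in># m" "below_all (min_letter m) m"
  using someI_ex[OF ex_min_letter[OF assms]] by (auto simp: min_letter_def)

lemma min_letter_add: "below_all y m \<Longrightarrow> min_letter (add_mset y m) = y"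
  using min_letter[of "add_mset y m"] by (fastforce simp: below_all_def intro: le_antisym)

lemma below_all_min_letter: "m \<noteq> {#} \<Longrightarrow> below_all a m \<longleftrightarrow> le a (min_letter m)"
  using min_letter[of m] le_trans by (auto simp: below_all_def)

lemma size_remove_min_letter: "\<not> below_all a m \<Longrightarrow> size (m - {#min_letter m#}) < size m"
  by (rule size_Diff1_less, rule min_letter(1)) (auto simp: below_all_def)

text \<open>
  The letter \<open>a\<close> is to act on a monomial \<open>m\<close>. If no letter of \<open>m\<close> is smaller than \<open>a\<close>, the product is
  already in order and the action is multiplication. Otherwise write \<open>m = y m'\<close> with \<open>y\<close> the least
  letter. As \<open>y\<close> acts on \<open>m'\<close> by multiplication, an action has to satisfy
  \<open>a (y m') = y (a m') + [a, y] m'\<close>, where \<open>a m'\<close> is the monomial \<open>a m'\<close> plus lower terms \<open>t\<close>, and \<open>y\<close>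
  acts on the monomial \<open>a m'\<close> again by multiplication. This determines the value. The guard
  \<open>size q < size m\<close> makes the nested recursion terminate; by \<open>monomial_act_lower\<close> it holds
  for every monomial \<open>q\<close> of \<open>t\<close>.
\<close>

function monomial_act :: "'i \<Rightarrow> 'i multiset \<Rightarrow> ('i multiset \<Rightarrow>\<^sub>0 'k)" where
  "monomial_act a m =
     (if below_all a m then Poly_Mapping.single (add_mset a m) 1
      else let y = min_letter m; m' = m - {#y#};
               t = monomial_act a m' - Poly_Mapping.single (add_mset a m') 1
           in Poly_Mapping.single (add_mset a m) 1
              + lin_ext (\<lambda>q. if size q < size m then monomial_act y q else 0) t
              + lin_ext (\<lambda>c. monomial_act c m') (br a y))"
  by pat_completeness auto
termination
  by (relation "measure (\<lambda>(a, m). size m)") (auto intro: size_remove_min_letter)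

declare monomial_act.simps [simp del]

definition act :: "'i \<Rightarrow> ('i multiset \<Rightarrow>\<^sub>0 'k) \<Rightarrow> ('i multiset \<Rightarrow>\<^sub>0 'k)" where
  "act a = lin_ext (monomial_act a)"

definition act_vec :: "('i \<Rightarrow>\<^sub>0 'k) \<Rightarrow> ('i multiset \<Rightarrow>\<^sub>0 'k) \<Rightarrow> ('i multiset \<Rightarrow>\<^sub>0 'k)" where
  "act_vec u s = lin_ext (\<lambda>c. act c s) u"

lemma act_linear [simp]: "pm_linear (act a)"
  by (simp add: act_def)

lemma act_vec_linear [simp]: "pm_linear (act_vec u)"
  unfolding act_vec_def by (rule pm_linear_param) simp

lemma act_vec_linear_left: "pm_linear (\<lambda>u. act_vec u s)"
  unfolding act_vec_def by (rule pm_linear_lin_ext)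

lemma act_single: "act a (Poly_Mapping.single m 1) = monomial_act a m"
  by (simp add: act_def)

lemma monomial_act_lower:
  "monomial_act a m - Poly_Mapping.single (add_mset a m) 1 \<in> low_degree (Suc (size m))"
proof (induction "size m" arbitrary: a m rule: less_induct)
  case less
  have up: "monomial_act a q \<in> low_degree (Suc (Suc (size q)))" if "size q < size m" for a q
    using low_degree_add[OF low_degree_mono[OF less[OF that, of a], of "Suc (Suc (size q))"]
        low_degree_single[of "add_mset a q" _ 1]] by simp
  show ?case
  proof (cases "below_all a m")
    case True
    then show ?thesis by (subst monomial_act.simps) simp
  next
    case False
    then have ne: "m \<noteq> {#}" by (auto simp: below_all_def)
    define y where "y = min_letter m"
    define m' where "m' = m - {#y#}"
    define t where "t = monomial_act a m' - Poly_Mapping.single (add_mset a m') 1"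
    have m: "m = add_mset y m'" using min_letter(1)[OF ne] by (simp add: y_def m'_def)
    have 1: "lin_ext (\<lambda>q. if size q < size m then monomial_act y q else 0) t \<in> low_degree (Suc (size m))"
      by (rule low_degree_lin_ext) (auto intro: low_degree_mono[OF up])
    have 2: "lin_ext (\<lambda>c. monomial_act c m') (br a y) \<in> low_degree (Suc (size m))"
      by (rule low_degree_lin_ext) (use up[of m'] m in auto)
    from False show ?thesis
      using low_degree_add[OF 1 2] unfolding t_def m'_def y_def
      by (subst monomial_act.simps) (simp add: Let_def add.assoc)
  qed
qed

lemma act_lower:
  assumes "s \<in> low_degree n"
  shows "act a s - Poly_Mapping.single {#a#} 1 * s \<in> low_degree n"
proof -
  have "act a s - Poly_Mapping.single {#a#} 1 * s
      = lin_ext (\<lambda>q. monomial_act a q - Poly_Mapping.single (add_mset a q) 1) s"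
    by (rule pm_linear_eqI[where h = "\<lambda>s. act a s - Poly_Mapping.single {#a#} 1 * s"])
      (auto intro!: pm_linearI
        simp: pm_linear_add pm_linear_scale pm.scale_right_diff_distrib act_single mult_single
          distrib_left pm_scale_mult_right)
  also have "\<dots> \<in> low_degree n"
    using assms
    by (intro low_degree_lin_ext low_degree_mono[OF monomial_act_lower]) (auto simp: low_degree_def)
  finally show ?thesis .
qed

lemma act_below: "below_all y m \<Longrightarrow>
  act y (Poly_Mapping.single m 1) = Poly_Mapping.single (add_mset y m) 1"
  by (simp add: act_single monomial_act.simps)

definition commutes_on :: "'i \<Rightarrow> 'i \<Rightarrow> ('i multiset \<Rightarrow>\<^sub>0 'k) \<Rightarrow> bool" where
  "commutes_on a b s \<longleftrightarrow> act a (act b s) - act b (act a s) = act_vec (br a b) s"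

lemma commutes_on_sym: "commutes_on a b s \<Longrightarrow> commutes_on b a s"
  unfolding commutes_on_def
  by (metis br_antisym act_vec_linear_left pm_linear_minus minus_diff_eq)

lemma commutes_on_self: "commutes_on a a s"
  by (simp add: commutes_on_def br_self act_vec_def)

lemma commutes_on_linear:
  assumes "\<And>q. q \<in> Poly_Mapping.keys s \<Longrightarrow> commutes_on a b (Poly_Mapping.single q 1)"
  shows "commutes_on a b s"
  unfolding commutes_on_def
proof (rule pm_linear_eqI[where h = "\<lambda>s. act a (act b s) - act b (act a s)"])
  show "pm_linear (\<lambda>s. act a (act b s) - act b (act a s))"
    by (rule pm_linearI)
      (simp_all add: pm_linear_add pm_linear_scale pm.scale_right_diff_distrib)
qed (use assms in \<open>auto simp: commutes_on_def\<close>)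

text \<open>
  The case in which the commutation rule holds by construction: \<open>b m\<close> is the ordered monomial with
  least letter \<open>b\<close>, and the recursion equation for \<open>a\<close> on \<open>b m\<close> is the rule itself.
\<close>

lemma commutes_on_below_less:
  assumes "below_all b m" "le b a" "a \<noteq> b"
  shows "commutes_on a b (Poly_Mapping.single m 1)"
proof -
  have not: "\<not> below_all a (add_mset b m)"
    using assms le_antisym by (auto simp: below_all_def)
  define t where "t = monomial_act a m - Poly_Mapping.single (add_mset a m) 1"
  have t: "size q < Suc (size m)" if "q \<in> Poly_Mapping.keys t" for q
    using monomial_act_lower[of a m] that by (auto simp: low_degree_def t_def)
  have "monomial_act a (add_mset b m) = Poly_Mapping.single (add_mset a (add_mset b m)) 1
      + act b t + act_vec (br a b) (Poly_Mapping.single m 1)"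
    using not t
    by (subst monomial_act.simps)
      (auto simp: min_letter_add[OF assms(1)] Let_def t_def[symmetric] act_def act_vec_def
        intro!: arg_cong2[where f = plus] lin_ext_cong)
  moreover have "act b t = act b (act a (Poly_Mapping.single m 1))
      - act b (Poly_Mapping.single (add_mset a m) 1)"
    by (simp add: t_def pm_linear_diff act_single)
  moreover have "act b (Poly_Mapping.single (add_mset a m) 1)
      = Poly_Mapping.single (add_mset a (add_mset b m)) 1"
    using assms by (subst act_below) (auto simp: below_all_def add_mset_commute)
  ultimately show ?thesis
    using act_below[OF assms(1)] by (simp add: commutes_on_def act_single)
qed

lemma commutes_on_below:
  assumes "below_all b m"
  shows "commutes_on a b (Poly_Mapping.single m 1)"
proof (cases "le b a")
  case True
  then show ?thesis using commutes_on_below_less[OF assms] commutes_on_self by metis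
next
  case False
  then have ab: "le a b" "a \<noteq> b" using le_total le_refl by blast+
  then have "below_all a m" using assms le_trans by (auto simp: below_all_def)
  then show ?thesis using commutes_on_below_less[of a m b] ab commutes_on_sym by blast
qed

text \<open>
  The commutation rule between a letter and a vector, with the bracket moved to the side on which
  it is linear.
\<close>

lemma act_vec_commute:
  assumes "\<And>c. commutes_on c b s"
  shows "act_vec u (act b s) - act b (act_vec u s) = - act_vec (lin_ext (br b) u) s"
proof -
  have "act_vec u (act b s) - act b (act_vec u s) = lin_ext (\<lambda>c. act_vec (br c b) s) u"
    using assms
    by (simp add: act_vec_def pm_linear_comp_lin_ext lin_ext_fun_diff[symmetric] commutes_on_def)
  also have "\<dots> = lin_ext (\<lambda>c. - act_vec (br b c) s) u"
    by (rule lin_ext_cong[OF refl]) (metis br_antisym act_vec_linear_left pm_linear_minus)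
  also have "\<dots> = - act_vec (lin_ext (br b) u) s"
    using pm_linear_comp_lin_ext[OF act_vec_linear_left, of "br b" u s]
    by (simp add: lin_ext_fun_minus)
  finally show ?thesis .
qed

text \<open>
  Induction on the degree. If neither \<open>a\<close> nor \<open>b\<close> is below all letters of \<open>m = y m'\<close>, both are
  larger than the least letter \<open>y\<close>. Moving \<open>a\<close> and \<open>b\<close> past \<open>y\<close> expresses \<open>a b (y m')\<close> and
  \<open>b a (y m')\<close> through \<open>y a b m'\<close>, \<open>y b a m'\<close> and brackets with \<open>y\<close>; the induction hypothesis
  applies on \<open>m'\<close>, and the double brackets that are left over cancel by the Jacobi identity.
\<close>

lemma commutes_on_single: "commutes_on a b (Poly_Mapping.single m 1)"
proof (induction "size m" arbitrary: a b m rule: less_induct)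
  case less
  show ?case
  proof (cases "below_all a m \<or> below_all b m")
    case True
    then show ?thesis using commutes_on_below commutes_on_sym by blast
  next
    case False
    then have ne: "m \<noteq> {#}" by (auto simp: below_all_def)
    define y where "y = min_letter m"
    define m' where "m' = m - {#y#}"
    have m: "m = add_mset y m'" using min_letter(1)[OF ne] by (simp add: y_def m'_def)
    define s where "s = (Poly_Mapping.single m' 1 :: 'i multiset \<Rightarrow>\<^sub>0 'k)"
    have ym': "below_all y m'" using min_letter(2)[OF ne, folded y_def] by (simp add: below_all_def m)
    have Ys: "act y s = Poly_Mapping.single m 1" by (simp add: s_def act_below[OF ym'] m)
    have IH: "commutes_on a b t" if "t \<in> low_degree (Suc (size m'))" for a b t
    proof (rule commutes_on_linear)
      fix q assume "q \<in> Poly_Mapping.keys t"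
      then have "size q < size m" using that by (simp add: low_degree_def m)
      then show "commutes_on a b (Poly_Mapping.single q 1)" by (rule less.hyps)
    qed
    have s_low: "s \<in> low_degree (Suc (size m'))" by (simp add: s_def low_degree_single)
    \<comment> \<open>Although \<open>b m'\<close> has the degree of \<open>m\<close>, no letter of its leading monomial is below \<open>y\<close>,
      and there the rule is known; the induction hypothesis is needed for the lower terms only.\<close>
    have key: "act a (act y (act b s)) - act y (act a (act b s)) = act_vec (br a y) (act b s)"
      if "\<not> below_all b m" for a b
    proof -
      define t where "t = act b s - Poly_Mapping.single (add_mset b m') 1"
      have "le y b" using that below_all_min_letter[OF ne, of b] le_total by (auto simp: y_def)
      then have "below_all y (add_mset b m')" using ym' by (auto simp: below_all_def)
      then have 1: "commutes_on a y (Poly_Mapping.single (add_mset b m') 1)"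
        by (rule commutes_on_below)
      have 2: "commutes_on a y t"
        by (rule IH) (simp add: t_def s_def act_single monomial_act_lower)
      have "act b s = Poly_Mapping.single (add_mset b m') 1 + t" by (simp add: t_def)
      with 1 2 show ?thesis by (simp add: commutes_on_def pm_linear_add algebra_simps)
    qed
    have ab: "act a (act b (act y s)) = act y (act a (act b s)) + act_vec (br a y) (act b s)
        + act a (act_vec (br b y) s)" if "\<not> below_all b m" for a b
    proof -
      have "act b (act y s) = act y (act b s) + act_vec (br b y) s"
        using IH[OF s_low, of b y] by (simp add: commutes_on_def algebra_simps)
      then show ?thesis
        using key[OF that, of a] by (simp add: pm_linear_add algebra_simps)
    qed
    have comm: "act_vec u (act c s) = act c (act_vec u s) - act_vec (lin_ext (br c) u) s" for u c
      using act_vec_commute[OF IH[OF s_low], of u c] by (simp add: algebra_simps)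
    have "act a (act b (act y s)) - act b (act a (act y s))
        = act y (act_vec (br a b) s) - act_vec (lin_ext (br b) (br a y)) s
          + act_vec (lin_ext (br a) (br b y)) s"
      using False IH[OF s_low, of a b]
      by (simp add: ab comm commutes_on_def pm_linear_diff[OF act_linear, symmetric] algebra_simps)
    also have "\<dots> = act_vec (br a b) (act y s) + (act_vec (lin_ext (br y) (br a b)) s
          + act_vec (lin_ext (br a) (br b y)) s + act_vec (lin_ext (br b) (br y a)) s)"
      by (subst br_antisym[of y a])
        (simp add: comm lin_ext_minus pm_linear_minus[OF act_vec_linear_left])
    also have "act_vec (lin_ext (br y) (br a b)) s + act_vec (lin_ext (br a) (br b y)) s
        + act_vec (lin_ext (br b) (br y a)) s = 0"
      by (simp add: pm_linear_add[OF act_vec_linear_left, symmetric] br_jacobi)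
        (simp add: act_vec_def)
    finally show ?thesis by (simp add: commutes_on_def Ys)
  qed
qed

lemma act_commutator: "act a (act b s) - act b (act a s) = act_vec (br a b) s"
  using commutes_on_linear[OF commutes_on_single] by (simp add: commutes_on_def)

end

section \<open>The free algebra on a set\<close>

text \<open>
  The algebra morphism that sends each letter \<open>x\<close> to \<open>\<theta> x\<close>. Its target is a monoid algebra, so that
  it covers both the substitutions into free algebras and the maps to polynomials
  \<open>'a multiset \<Rightarrow>\<^sub>0 'k\<close>.
\<close>

definition subst :: "('a \<Rightarrow> ('m::monoid_add \<Rightarrow>\<^sub>0 'k)) \<Rightarrow> ('a list \<Rightarrow>\<^sub>0 'k::field) \<Rightarrow> ('m \<Rightarrow>\<^sub>0 'k)" where
  "subst \<theta> = lin_ext (\<lambda>w. prod_list (map \<theta> w))"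

lemma pm_linear_subst [simp]: "pm_linear (subst \<theta>)"
  by (simp add: subst_def)

lemma subst_single: "subst \<theta> (Poly_Mapping.single w c) = pm_scale c (prod_list (map \<theta> w))"
  by (simp add: subst_def)

lemma subst_free_gen [simp]: "subst \<theta> (free_gen x) = \<theta> x"
  by (simp add: free_gen_def subst_single)

lemma subst_mult: "subst \<theta> (f * g) = subst \<theta> f * subst \<theta> g"
proof (rule pm_linear_eqI[where h = "\<lambda>f. subst \<theta> (f * g)"])
  fix u
  show "subst \<theta> (Poly_Mapping.single u 1 * g) = subst \<theta> (Poly_Mapping.single u 1) * subst \<theta> g"
    by (rule pm_linear_eqI[where f = g])
      (auto intro: pm_linear_comp[OF pm_linear_subst pm_linear_mult_right]
         pm_linear_comp[OF pm_linear_mult_right pm_linear_subst]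
        simp: mult_single plus_list_def subst_single)
qed (auto intro: pm_linear_comp[OF pm_linear_subst pm_linear_mult_left]
         pm_linear_comp[OF pm_linear_mult_left pm_linear_subst])

lemma one_list_algebra: "(1 :: 'a list \<Rightarrow>\<^sub>0 'k::field) = Poly_Mapping.single [] 1"
  by (simp add: zero_list_def flip: single_one)

lemma subst_one [simp]: "subst \<theta> 1 = 1"
  by (simp add: one_list_algebra subst_single)

lemma carrier_free_alg: "f \<in> carrier (free_alg S) \<longleftrightarrow> (\<forall>w\<in>Poly_Mapping.keys f. set w \<subseteq> S)"
  by (simp add: free_alg_def)

lemma free_alg_simps [simp]:
  "f \<otimes>\<^bsub>free_alg S\<^esub> g = f * g" "\<one>\<^bsub>free_alg S\<^esub> = 1"
  "f \<oplus>\<^bsub>free_alg S\<^esub> g = f + g" "\<zero>\<^bsub>free_alg S\<^esub> = 0"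
  by (simp_all add: free_alg_def)

lemma single_Nil_mult [simp]: "Poly_Mapping.single [] c * f = pm_scale c f"
  using single_zero_mult[of c f] by (simp add: zero_list_def)

lemma free_alg_smult [simp]: "c \<odot>\<^bsub>free_alg S\<^esub> f = pm_scale c f"
  by (simp add: free_alg_def)

lemma free_alg_add_closed: "f \<in> carrier (free_alg S) \<Longrightarrow> g \<in> carrier (free_alg S) \<Longrightarrow>
    f + g \<in> carrier (free_alg S)"
  using keys_add[of f g] by (auto simp: carrier_free_alg)

lemma free_alg_scale_closed: "f \<in> carrier (free_alg S) \<Longrightarrow> pm_scale c f \<in> carrier (free_alg S)"
  using keys_pm_scale[of c f] by (auto simp: carrier_free_alg)

lemma free_alg_uminus_closed: "f \<in> carrier (free_alg S) \<Longrightarrow> - f \<in> carrier (free_alg S)"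
  using free_alg_scale_closed[of f S "-1"] by simp

lemma free_alg_diff_closed: "f \<in> carrier (free_alg S) \<Longrightarrow> g \<in> carrier (free_alg S) \<Longrightarrow>
    f - g \<in> carrier (free_alg S)"
  using free_alg_add_closed[of f S "- g"] by (simp add: free_alg_uminus_closed)

lemma free_alg_mult_closed: "f \<in> carrier (free_alg S) \<Longrightarrow> g \<in> carrier (free_alg S) \<Longrightarrow>
    f * g \<in> carrier (free_alg S)"
  using keys_mult[of f g] by (fastforce simp: carrier_free_alg plus_list_def)

lemma free_alg_single_closed: "set w \<subseteq> S \<Longrightarrow> Poly_Mapping.single w c \<in> carrier (free_alg S)"
  by (simp add: carrier_free_alg)

lemma free_alg_single_iff [simp]:
  "Poly_Mapping.single w c \<in> carrier (free_alg S) \<longleftrightarrow> c = 0 \<or> set w \<subseteq> S"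
  by (simp add: carrier_free_alg)

lemma free_alg_one_closed: "1 \<in> carrier (free_alg S)"
  by (simp add: one_list_algebra free_alg_single_closed)

lemma free_alg_zero_closed: "0 \<in> carrier (free_alg S)"
  by (simp add: carrier_free_alg)

lemma free_alg_gen_closed: "x \<in> S \<Longrightarrow> free_gen x \<in> carrier (free_alg S)"
  by (simp add: free_gen_def free_alg_single_closed)

lemma free_alg_lin_ext_closed:
  "(\<And>k. k \<in> Poly_Mapping.keys f \<Longrightarrow> g k \<in> carrier (free_alg S)) \<Longrightarrow>
    lin_ext g f \<in> carrier (free_alg S)"
  using keys_lin_ext_subset[of g f] by (fastforce simp: carrier_free_alg)

lemmas free_alg_closed = free_alg_add_closed free_alg_scale_closed free_alg_uminus_closed
  free_alg_diff_closed free_alg_mult_closed free_alg_single_closed free_alg_one_closed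
  free_alg_zero_closed free_alg_gen_closed

lemma ring_free_alg: "ring (free_alg S :: ('k::field, 'a list \<Rightarrow>\<^sub>0 'k) module)"
proof (rule ringI)
  show "abelian_group (free_alg S :: ('k, 'a list \<Rightarrow>\<^sub>0 'k) module)"
    by (rule abelian_groupI)
      (auto simp: add.assoc add.commute intro: free_alg_closed bexI[of _ "- _"])
  show "Group.monoid (free_alg S :: ('k, 'a list \<Rightarrow>\<^sub>0 'k) module)"
    by (rule Group.monoidI) (auto simp: mult.assoc intro: free_alg_closed)
qed (auto simp: algebra_simps)

lemma free_alg_a_inv: "f \<in> carrier (free_alg S) \<Longrightarrow> \<ominus>\<^bsub>free_alg S\<^esub> f = - f"
proof -
  interpret ring "free_alg S :: ('b, 'a list \<Rightarrow>\<^sub>0 'b) module" by (rule ring_free_alg)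
  assume f: "f \<in> carrier (free_alg S)"
  show ?thesis by (rule minus_equality) (use f in \<open>auto intro: free_alg_closed\<close>)
qed

lemma free_alg_a_minus: "f \<in> carrier (free_alg S) \<Longrightarrow> g \<in> carrier (free_alg S) \<Longrightarrow>
    f \<ominus>\<^bsub>free_alg S\<^esub> g = f - g"
  by (simp add: a_minus_def free_alg_a_inv)

text \<open>
  From here on cosets are compared through differences in the ring type, where the simplifier knows
  the algebra.
\<close>

lemma free_alg_coset_eq_iff:
  assumes "ideal I (free_alg S)" "f \<in> carrier (free_alg S)" "g \<in> carrier (free_alg S)"
  shows "I +>\<^bsub>free_alg S\<^esub> f = I +>\<^bsub>free_alg S\<^esub> g \<longleftrightarrow> f - g \<in> I"
proof -
  interpret ideal I "free_alg S :: ('b, 'a list \<Rightarrow>\<^sub>0 'b) module" by fact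
  show ?thesis
    using quotient_eq_iff_same_a_r_cos[OF assms] assms free_alg_a_minus[OF assms(2,3)] by simp
qed

section \<open>The ideal of an enveloping algebra\<close>

context lie_algebra
begin

lemma carrier_scalars [simp]: "c \<in> carrier (ring_of_type_algebra :: 'k ring)"
  by (simp add: ring_of_type_algebra_def)

lemma scalars_simps [simp]:
  "a \<oplus>\<^bsub>ring_of_type_algebra\<^esub> b = (a + b :: 'k)" "a \<otimes>\<^bsub>ring_of_type_algebra\<^esub> b = (a * b :: 'k)"
  "\<one>\<^bsub>ring_of_type_algebra\<^esub> = (1 :: 'k)" "\<zero>\<^bsub>ring_of_type_algebra\<^esub> = (0 :: 'k)"
  by (simp_all add: ring_of_type_algebra_def)

lemma scale_closed [simp, intro]: "x \<in> carrier L \<Longrightarrow> c \<odot> x \<in> carrier L"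
  by (rule smult_closed) simp_all

lemma lie_antisym:
  assumes "x \<in> carrier L" "y \<in> carrier L"
  shows "lie L x y \<oplus> lie L y x = \<zero>"
proof -
  have "\<zero> = lie L (x \<oplus> y) (x \<oplus> y)" using assms by (intro lie_self[symmetric]) simp
  also have "\<dots> = lie L x (x \<oplus> y) \<oplus> lie L y (x \<oplus> y)" using assms by (intro lie_add_left) auto
  also have "\<dots> = lie L x y \<oplus> lie L y x"
    using assms by (simp add: lie_add_right lie_self lie_closed)
  finally show ?thesis ..
qed

lemma lie_algebra_Ab: "lie_algebra (Ab L)"
proof (intro lie_algebra.intro lie_algebra_axioms.intro)
  have "abelian_group (Ab L)"
    by (rule abelian_groupI) (auto simp: Ab_def a_ac intro: bexI[of _ "\<ominus> _"])
  then show "Module.module (ring_of_type_algebra :: 'k ring) (Ab L)"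
    by (intro moduleI) (auto simp: Ab_def smult_l_distr[simplified] smult_r_distr smult_assoc1[simplified]
        smult_one[simplified] R.cring_axioms)
qed (auto simp: Ab_def)

end

lemma carrier_Ab [simp]: "carrier (Ab L) = carrier L"
  and Ab_simps [simp]: "x \<oplus>\<^bsub>Ab L\<^esub> y = x \<oplus>\<^bsub>L\<^esub> y" "c \<odot>\<^bsub>Ab L\<^esub> x = c \<odot>\<^bsub>L\<^esub> x" "\<zero>\<^bsub>Ab L\<^esub> = \<zero>\<^bsub>L\<^esub>"
    "lie (Ab L) x y = \<zero>\<^bsub>L\<^esub>"
  by (simp_all add: Ab_def)

context lie_algebra
begin

lemma env_rels_closed: "env_rels L \<subseteq> carrier (free_alg (carrier L))"
  by (auto simp: env_rels_def lie_closed intro!: free_alg_closed)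

lemma ideal_env_ideal: "ideal (env_ideal L) (free_alg (carrier L))"
  unfolding env_ideal_def
  by (rule ring.genideal_ideal[OF ring_free_alg env_rels_closed])

lemma env_ideal_add: "f \<in> env_ideal L \<Longrightarrow> g \<in> env_ideal L \<Longrightarrow> f + g \<in> env_ideal L"
  using additive_subgroup.a_closed[OF ideal.axioms(1)[OF ideal_env_ideal]] by force

lemma env_ideal_zero: "0 \<in> env_ideal L"
  using additive_subgroup.zero_closed[OF ideal.axioms(1)[OF ideal_env_ideal]] by force

lemma env_ideal_carrier: "f \<in> env_ideal L \<Longrightarrow> f \<in> carrier (free_alg (carrier L))"
  using additive_subgroup.a_Hcarr[OF ideal.axioms(1)[OF ideal_env_ideal]] by force

lemma env_ideal_mult_left: "f \<in> env_ideal L \<Longrightarrow> g \<in> carrier (free_alg (carrier L)) \<Longrightarrow> g * f \<in> env_ideal L"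
  using ideal.I_l_closed[OF ideal_env_ideal] by force

lemma env_ideal_mult_right: "f \<in> env_ideal L \<Longrightarrow> g \<in> carrier (free_alg (carrier L)) \<Longrightarrow> f * g \<in> env_ideal L"
  using ideal.I_r_closed[OF ideal_env_ideal] by force

lemma env_ideal_scale: "f \<in> env_ideal L \<Longrightarrow> pm_scale c f \<in> env_ideal L"
  using env_ideal_mult_left[of f "Poly_Mapping.single [] c"] by (simp add: free_alg_single_closed)

lemma env_ideal_uminus: "f \<in> env_ideal L \<Longrightarrow> - f \<in> env_ideal L"
  using env_ideal_scale[of f "-1"] by simp

lemma env_ideal_diff: "f \<in> env_ideal L \<Longrightarrow> g \<in> env_ideal L \<Longrightarrow> f - g \<in> env_ideal L"
  using env_ideal_add[of f "- g"] by (simp add: env_ideal_uminus)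

lemma env_ideal_trans: "f - g \<in> env_ideal L \<Longrightarrow> g - h \<in> env_ideal L \<Longrightarrow> f - h \<in> env_ideal L"
  using env_ideal_add[of "f - g" "g - h"] by simp

lemma subspace_env_ideal: "pm.subspace (env_ideal L)"
  by (auto simp: pm.subspace_def env_ideal_zero env_ideal_add env_ideal_scale)

lemma env_ideal_lin_ext:
  "(\<And>k. k \<in> Poly_Mapping.keys u \<Longrightarrow> g k \<in> env_ideal L) \<Longrightarrow> lin_ext g u \<in> env_ideal L"
  unfolding lin_ext_def by (auto intro: pm.subspace_sum[OF subspace_env_ideal] env_ideal_scale)

lemma env_rels_in_ideal: "env_rels L \<subseteq> env_ideal L"
  unfolding env_ideal_def by (rule ring.genideal_self[OF ring_free_alg env_rels_closed])

lemma env_ideal_gen_add: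
  "x \<in> carrier L \<Longrightarrow> y \<in> carrier L \<Longrightarrow> free_gen (x \<oplus> y) - (free_gen x + free_gen y) \<in> env_ideal L"
  by (rule subsetD[OF env_rels_in_ideal]) (auto simp: env_rels_def)

lemma env_ideal_gen_scale:
  "x \<in> carrier L \<Longrightarrow> free_gen (c \<odot> x) - pm_scale c (free_gen x) \<in> env_ideal L"
  by (rule subsetD[OF env_rels_in_ideal]) (auto simp: env_rels_def)

lemma env_ideal_gen_lie:
  "x \<in> carrier L \<Longrightarrow> y \<in> carrier L \<Longrightarrow>
    free_gen x * free_gen y - free_gen y * free_gen x - free_gen (lie L x y) \<in> env_ideal L"
  by (rule subsetD[OF env_rels_in_ideal]) (auto simp: env_rels_def)

text \<open>
  Used whenever a map on the free algebra has to vanish on the ideal, or to send it into another one.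
\<close>

lemma env_ideal_induct [consumes 1, case_names gen_add gen_scale gen_lie zero add mult_left mult_right]:
  assumes f: "f \<in> env_ideal L"
    and gen_add: "\<And>x y. x \<in> carrier L \<Longrightarrow> y \<in> carrier L \<Longrightarrow> P (free_gen (x \<oplus> y) - (free_gen x + free_gen y))"
    and gen_scale: "\<And>c x. x \<in> carrier L \<Longrightarrow> P (free_gen (c \<odot> x) - pm_scale c (free_gen x))"
    and gen_lie: "\<And>x y. x \<in> carrier L \<Longrightarrow> y \<in> carrier L \<Longrightarrow>
      P (free_gen x * free_gen y - free_gen y * free_gen x - free_gen (lie L x y))"
    and zero: "P 0" and add: "\<And>f g. P f \<Longrightarrow> P g \<Longrightarrow> P (f + g)"
    and mult: "\<And>f g. P f \<Longrightarrow> g \<in> carrier (free_alg (carrier L)) \<Longrightarrow> P (g * f)"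
      "\<And>f g. P f \<Longrightarrow> g \<in> carrier (free_alg (carrier L)) \<Longrightarrow> P (f * g)"
  shows "P f"
proof -
  let ?A = "free_alg (carrier L) :: ('k, 'a list \<Rightarrow>\<^sub>0 'k) module"
  let ?K = "{f \<in> carrier ?A. P f}"
  have neg: "P (- f)" if "P f" for f
    using mult(1)[OF that, of "Poly_Mapping.single [] (- 1)"] by (simp add: free_alg_single_closed)
  have "subgroup ?K (add_monoid ?A)"
  proof (rule subgroup.intro)
    show "inv\<^bsub>add_monoid ?A\<^esub> f \<in> ?K" if "f \<in> ?K" for f
      using that neg free_alg_a_inv[of f "carrier L"] by (simp add: free_alg_uminus_closed a_inv_def)
  qed (auto intro: add free_alg_closed simp: zero)
  then have "ideal ?K ?A"
    by (intro idealI ring_free_alg) (auto intro: mult free_alg_closed)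
  moreover have "env_rels L \<subseteq> ?K"
  proof
    fix r assume r: "r \<in> env_rels L"
    then have "P r" by (auto simp: env_rels_def gen_add gen_scale gen_lie)
    then show "r \<in> ?K" using r env_rels_closed by auto
  qed
  ultimately have "env_ideal L \<subseteq> ?K"
    unfolding env_ideal_def by (rule ring.genideal_minimal[OF ring_free_alg])
  then show ?thesis using f by auto
qed

section \<open>Coordinates\<close>

text \<open>
  These vectors span the kernel of the evaluation map from the vector space with basis \<open>carrier L\<close>
  onto \<open>L\<close>.
\<close>

definition lin_rels :: "('a \<Rightarrow>\<^sub>0 'k) set" where
  "lin_rels =
     {Poly_Mapping.single (x \<oplus> y) 1 - (Poly_Mapping.single x 1 + Poly_Mapping.single y 1) | x y.
        x \<in> carrier L \<and> y \<in> carrier L} \<union>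
     {Poly_Mapping.single (c \<odot> x) 1 - Poly_Mapping.single x c | c x. x \<in> carrier L}"

lemma keys_span_lin_rels: "u \<in> pm.span lin_rels \<Longrightarrow> Poly_Mapping.keys u \<subseteq> carrier L"
proof (induction rule: pm.span_induct_alt)
  case (step c u v)
  then have "Poly_Mapping.keys u \<subseteq> carrier L"
    by (auto simp: lin_rels_def in_keys_iff lookup_minus lookup_add lookup_single when_def split: if_splits)
  then show ?case
    using step(2) keys_add[of "pm_scale c u" v] keys_pm_scale[of c u] by blast
qed simp

end

text \<open>
  A linear section \<open>coord\<close> of the evaluation map onto \<open>L\<close>. That it is a section is stated as
  \<open>x - coord x\<close> lying in the kernel, which avoids forming linear combinations in \<open>L\<close>.
\<close>

locale lie_section = lie_algebra L for L :: "('k::field, 'a) lie_ring" (structure) +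
  fixes coord :: "'a \<Rightarrow> ('a \<Rightarrow>\<^sub>0 'k)"
  assumes coord_add: "x \<in> carrier L \<Longrightarrow> y \<in> carrier L \<Longrightarrow> coord (x \<oplus> y) = coord x + coord y"
    and coord_scale: "x \<in> carrier L \<Longrightarrow> coord (c \<odot> x) = pm_scale c (coord x)"
    and coord_repr: "x \<in> carrier L \<Longrightarrow> Poly_Mapping.single x 1 - coord x \<in> pm.span lin_rels"

text \<open>
  A linear projection \<open>g\<close> onto the kernel of the evaluation map exists because the scalars form a
  field, and \<open>u - g u\<close> depends only on the value of \<open>u\<close> in \<open>L\<close>.
\<close>

lemma (in lie_algebra) ex_lie_section: "\<exists>coord. lie_section L coord"
proof -
  interpret vector_space_pair "pm_scale :: 'k \<Rightarrow> ('a \<Rightarrow>\<^sub>0 'k) \<Rightarrow> _" "pm_scale :: 'k \<Rightarrow> ('a \<Rightarrow>\<^sub>0 'k) \<Rightarrow> _" ..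
  have "\<exists>g. range g \<subseteq> pm.span lin_rels \<and> Vector_Spaces.linear pm_scale pm_scale g
      \<and> (\<forall>x\<in>pm.span lin_rels. g (id x) = x)"
    by (rule linear_inj_on_left_inverse) (simp_all add: pm.linear_ident)
  then obtain g where g: "range g \<subseteq> pm.span lin_rels" "Vector_Spaces.linear pm_scale pm_scale g"
    and g_id: "\<And>x. x \<in> pm.span lin_rels \<Longrightarrow> g x = x" by auto
  interpret g: Vector_Spaces.linear pm_scale pm_scale g by fact
  define coord where "coord x = Poly_Mapping.single x 1 - g (Poly_Mapping.single x 1)" for x
  have "lie_section L coord"
  proof (intro lie_section.intro lie_section_axioms.intro)
    show "lie_algebra L" ..
    fix x y c assume x: "x \<in> carrier L"
    have "Poly_Mapping.single (c \<odot> x) 1 - Poly_Mapping.single x c \<in> pm.span lin_rels"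
      using x by (intro pm.span_base) (auto simp: lin_rels_def)
    from g_id[OF this]
    have "g (Poly_Mapping.single (c \<odot> x) 1) - pm_scale c (g (Poly_Mapping.single x 1))
        = Poly_Mapping.single (c \<odot> x) 1 - Poly_Mapping.single x c"
      using g.scale[of c "Poly_Mapping.single x 1"] by (simp add: g.diff)
    then show "coord (c \<odot> x) = pm_scale c (coord x)"
      by (simp add: coord_def pm.scale_right_diff_distrib algebra_simps)
    show "Poly_Mapping.single x 1 - coord x \<in> pm.span lin_rels"
      using g(1) by (auto simp: coord_def)
    assume y: "y \<in> carrier L"
    have "Poly_Mapping.single (x \<oplus> y) 1 - (Poly_Mapping.single x 1 + Poly_Mapping.single y 1)
        \<in> pm.span lin_rels"
      using x y by (intro pm.span_base) (auto simp: lin_rels_def)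
    from g_id[OF this] show "coord (x \<oplus> y) = coord x + coord y"
      by (simp add: coord_def g.diff g.add algebra_simps)
  qed
  then show ?thesis by blast
qed

context lie_section
begin

lemma keys_coord: "x \<in> carrier L \<Longrightarrow> Poly_Mapping.keys (coord x) \<subseteq> carrier L"
proof -
  assume x: "x \<in> carrier L"
  have "Poly_Mapping.keys (coord x) \<subseteq>
      Poly_Mapping.keys (Poly_Mapping.single x (1::'k)) \<union> Poly_Mapping.keys (Poly_Mapping.single x 1 - coord x)"
    by (auto simp: in_keys_iff lookup_minus lookup_single when_def split: if_splits)
  then show ?thesis
    using keys_span_lin_rels[OF coord_repr[OF x]] x by auto
qed

lemma coord_zero: "coord \<zero> = 0"
  using coord_add[of \<zero> \<zero>] by simp

text \<open>
  A map on \<open>L\<close> that is linear modulo \<open>V\<close> can be computed, modulo \<open>V\<close>, from its values on the letters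
  that occur in the coordinates.
\<close>

lemma coord_ext_mod:
  assumes V: "pm.subspace V"
    and add: "\<And>x y. x \<in> carrier L \<Longrightarrow> y \<in> carrier L \<Longrightarrow> \<theta> (x \<oplus> y) - (\<theta> x + \<theta> y) \<in> V"
    and scale: "\<And>c x. x \<in> carrier L \<Longrightarrow> \<theta> (c \<odot> x) - pm_scale c (\<theta> x) \<in> V"
    and x: "x \<in> carrier L"
  shows "\<theta> x - lin_ext \<theta> (coord x) \<in> V"
proof -
  have "pm.span lin_rels \<subseteq> {u. lin_ext \<theta> u \<in> V}"
  proof (rule pm.span_minimal)
    show "lin_rels \<subseteq> {u. lin_ext \<theta> u \<in> V}"
      using add scale by (auto simp: lin_rels_def lin_ext_diff lin_ext_add)
    show "pm.subspace {u. lin_ext \<theta> u \<in> V}"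
      using V by (auto simp: pm.subspace_def lin_ext_add lin_ext_scale)
  qed
  with coord_repr[OF x] have "lin_ext \<theta> (Poly_Mapping.single x 1 - coord x) \<in> V" by auto
  then show ?thesis by (simp add: lin_ext_diff)
qed

lemma coord_ext:
  assumes "\<And>x y. x \<in> carrier L \<Longrightarrow> y \<in> carrier L \<Longrightarrow> \<theta> (x \<oplus> y) = \<theta> x + \<theta> y"
    and "\<And>c x. x \<in> carrier L \<Longrightarrow> \<theta> (c \<odot> x) = pm_scale c (\<theta> x)"
    and "x \<in> carrier L"
  shows "lin_ext \<theta> (coord x) = \<theta> x"
  using coord_ext_mod[of "{0}" \<theta> x] assms by simp

text \<open>
  The bracket lifted to the free vector space. Letters outside the carrier are made central, so that
  the Lie algebra laws hold for the whole type.
\<close>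

definition coord_br :: "'a \<Rightarrow> 'a \<Rightarrow> ('a \<Rightarrow>\<^sub>0 'k)" where
  "coord_br a b = (if a \<in> carrier L \<and> b \<in> carrier L then coord (lie L a b) else 0)"

lemma lin_ext_coord_br:
  "a \<in> carrier L \<Longrightarrow> x \<in> carrier L \<Longrightarrow> lin_ext (coord_br a) (coord x) = coord (lie L a x)"
  by (subst coord_ext)
    (auto simp: coord_br_def lie_add_right lie_smult_right coord_add coord_scale lie_closed)

lemma coord_br_eq_0: "a \<notin> carrier L \<or> b \<notin> carrier L \<Longrightarrow> coord_br a b = 0"
  by (auto simp: coord_br_def)

lemma coord_br_jacobi:
  "lin_ext (coord_br a) (coord_br b c) + lin_ext (coord_br b) (coord_br c a)
    + lin_ext (coord_br c) (coord_br a b) = 0"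
proof (cases "a \<in> carrier L \<and> b \<in> carrier L \<and> c \<in> carrier L")
  case True
  then have "coord (lie L a (lie L b c) \<oplus> lie L b (lie L c a) \<oplus> lie L c (lie L a b)) = 0"
    using jacobi[of a b c] by (simp add: coord_zero)
  with True show ?thesis
    by (simp add: coord_add lie_closed lin_ext_coord_br coord_br_def[of b c] coord_br_def[of c a]
        coord_br_def[of a b])
next
  case False
  then show ?thesis by (auto simp: coord_br_eq_0 lin_ext_eq_0)
qed

lemma coord_br_antisym: "coord_br b a = - coord_br a b"
proof (cases "a \<in> carrier L \<and> b \<in> carrier L")
  case True
  then have "coord (lie L b a \<oplus> lie L a b) = 0" by (simp add: lie_antisym coord_zero)
  with True show ?thesis
    by (simp add: coord_add lie_closed coord_br_def eq_neg_iff_add_eq_0)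
qed (auto simp: coord_br_eq_0)

text \<open>
  Any linear order on the letters will do; one is provided by the well-ordering theorem.
\<close>

lemma ex_lie_structure_constants: "\<exists>le. lie_structure_constants coord_br le"
proof -
  obtain r :: "('a \<times> 'a) set" where "well_order_on UNIV r" using well_order_on[of UNIV] ..
  then have order: "refl_on UNIV r" "trans r" "antisym r" "total_on UNIV r"
    by (simp_all add: well_order_on_def linear_order_on_def partial_order_on_def preorder_on_def)
  have "lie_structure_constants coord_br (\<lambda>a b. (a, b) \<in> r)"
  proof
    show "coord_br a a = 0" for a
      by (simp add: coord_br_def lie_self coord_zero)
    show "coord_br b a = - coord_br a b" for a b by (rule coord_br_antisym)
    show "lin_ext (coord_br a) (coord_br b c) + lin_ext (coord_br b) (coord_br c a)
      + lin_ext (coord_br c) (coord_br a b) = 0" for a b c by (rule coord_br_jacobi)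
    show "(a, a) \<in> r" for a using order(1) by (simp add: refl_on_def)
    show "(a, b) \<in> r \<Longrightarrow> (b, c) \<in> r \<Longrightarrow> (a, c) \<in> r" for a b c using order(2) by (rule transD)
    show "(a, b) \<in> r \<Longrightarrow> (b, a) \<in> r \<Longrightarrow> a = b" for a b using order(3) by (rule antisymD)
    show "(a, b) \<in> r \<or> (b, a) \<in> r" for a b
      using order(1,4) by (cases "a = b") (simp_all add: refl_on_def total_on_def)
  qed
  then show ?thesis by blast
qed

section \<open>The symmetric algebra as a polynomial algebra\<close>

text \<open>
  The value of \<open>f\<close> when the letters are replaced by their coordinates and made to commute.
\<close>

definition symbol :: "('a list \<Rightarrow>\<^sub>0 'k) \<Rightarrow> ('a multiset \<Rightarrow>\<^sub>0 'k)" where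
  "symbol = subst (\<lambda>x. lin_ext (\<lambda>b. Poly_Mapping.single {#b#} 1) (coord x))"

lemma symbol_linear [simp]: "pm_linear symbol"
  by (simp add: symbol_def)

lemma symbol_mult: "symbol (f * g) = symbol f * symbol g"
  by (simp add: symbol_def subst_mult)

lemma symbol_gen: "symbol (free_gen x) = lin_ext (\<lambda>b. Poly_Mapping.single {#b#} 1) (coord x)"
  by (simp add: symbol_def)

lemma symbol_single_Cons:
  "symbol (Poly_Mapping.single (x # w) 1) = symbol (free_gen x) * symbol (Poly_Mapping.single w 1)"
  by (simp add: free_gen_def mult_single plus_list_def flip: symbol_mult)

lemma symbol_env_ideal_Ab: "f \<in> env_ideal (Ab L) \<Longrightarrow> symbol f = 0"
proof (induction rule: lie_algebra.env_ideal_induct[OF lie_algebra_Ab,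
    consumes 1, case_names gen_add gen_scale gen_lie zero add mult_left mult_right])
  case (gen_add x y)
  then show ?case
    by (simp add: pm_linear_diff pm_linear_add symbol_gen coord_add lin_ext_add)
next
  case (gen_scale c x)
  then show ?case
    by (simp add: pm_linear_diff pm_linear_scale symbol_gen coord_scale lin_ext_scale)
next
  case (gen_lie x y)
  then show ?case
    by (simp add: pm_linear_diff symbol_mult mult.commute symbol_gen[of \<zero>] coord_zero)
qed (auto simp: pm_linear_zero pm_linear_add symbol_mult)

lemma word_swap_Ab:
  assumes "set (a # v @ w) \<subseteq> carrier L"
  shows "Poly_Mapping.single (a # v @ w) 1 - Poly_Mapping.single (v @ a # w) 1 \<in> env_ideal (Ab L)"
  using assms
proof (induction v)
  case Nil
  then show ?case using lie_algebra.env_ideal_zero[OF lie_algebra_Ab] by simp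
next
  case (Cons b v)
  interpret Ab: lie_algebra "Ab L" by (rule lie_algebra_Ab)
  have swap: "free_gen a * free_gen b - free_gen b * free_gen a \<in> env_ideal (Ab L)"
  proof -
    have "free_gen \<zero> \<in> env_ideal (Ab L)"
      using Ab.env_ideal_gen_add[of \<zero> \<zero>] Ab.env_ideal_uminus by force
    then show ?thesis
      using Ab.env_ideal_add[OF Ab.env_ideal_gen_lie[of a b]] Cons.prems by force
  qed
  have "(free_gen a * free_gen b - free_gen b * free_gen a) * Poly_Mapping.single (v @ w) 1
      \<in> env_ideal (Ab L)"
    by (rule Ab.env_ideal_mult_right[OF swap]) (use Cons.prems in \<open>auto intro: free_alg_closed\<close>)
  moreover have "free_gen b * (Poly_Mapping.single (a # v @ w) 1 - Poly_Mapping.single (v @ a # w) 1)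
      \<in> env_ideal (Ab L)"
    by (rule Ab.env_ideal_mult_left) (use Cons in \<open>auto intro: free_alg_closed\<close>)
  ultimately show ?case
    using Ab.env_ideal_add
    by (fastforce simp: free_gen_def mult_single plus_list_def left_diff_distrib right_diff_distrib)
qed

text \<open>
  Letters commute modulo the ideal of the abelian Lie algebra, so a word matters only as a multiset.
\<close>

lemma word_permute_Ab:
  assumes "mset u = mset v" "set u \<subseteq> carrier L"
  shows "Poly_Mapping.single u 1 - Poly_Mapping.single v 1 \<in> env_ideal (Ab L)"
  using assms
proof (induction u arbitrary: v)
  case Nil
  then show ?case using lie_algebra.env_ideal_zero[OF lie_algebra_Ab] by simp
next
  case (Cons a u)
  interpret Ab: lie_algebra "Ab L" by (rule lie_algebra_Ab)
  have "a \<in> set v" using Cons.prems(1) by (metis list.set_intros(1) mset_eq_setD)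
  then obtain v1 v2 where v: "v = v1 @ a # v2" by (auto simp: in_set_conv_decomp)
  have set_v: "set (a # v1 @ v2) \<subseteq> carrier L"
    using Cons.prems mset_eq_setD[OF Cons.prems(1)] by (auto simp: v)
  have "Poly_Mapping.single u 1 - Poly_Mapping.single (v1 @ v2) 1 \<in> env_ideal (Ab L)"
    using Cons.prems by (intro Cons.IH) (auto simp: v)
  then have "free_gen a * (Poly_Mapping.single u 1 - Poly_Mapping.single (v1 @ v2) 1) \<in> env_ideal (Ab L)"
    by (rule Ab.env_ideal_mult_left) (use Cons.prems in \<open>auto intro: free_alg_closed\<close>)
  then have "Poly_Mapping.single (a # u) 1 - Poly_Mapping.single (a # v1 @ v2) 1 \<in> env_ideal (Ab L)"
    by (simp add: free_gen_def mult_single plus_list_def right_diff_distrib)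
  from Ab.env_ideal_trans[OF this word_swap_Ab[OF set_v]] show ?case by (simp add: v)
qed

definition monomial_word :: "'a multiset \<Rightarrow> 'a list" where
  "monomial_word m = (SOME w. mset w = m)"

lemma mset_monomial_word [simp]: "mset (monomial_word m) = m"
  unfolding monomial_word_def by (rule someI_ex) (rule ex_mset)

text \<open>
  A section of the symbol map, with an arbitrary arrangement of each monomial. It is not
  multiplicative, but it is so modulo the ideal of \<open>U(Ab L)\<close>.
\<close>

definition unsymbol :: "('a multiset \<Rightarrow>\<^sub>0 'k) \<Rightarrow> ('a list \<Rightarrow>\<^sub>0 'k)" where
  "unsymbol = lin_ext (\<lambda>m. Poly_Mapping.single (monomial_word m) 1)"

lemma unsymbol_linear [simp]: "pm_linear unsymbol"
  by (simp add: unsymbol_def)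

definition sym_carrier :: "('a multiset \<Rightarrow>\<^sub>0 'k) set" where
  "sym_carrier = {t. \<forall>m\<in>Poly_Mapping.keys t. set_mset m \<subseteq> carrier L}"

lemma sym_carrier_mult: "s \<in> sym_carrier \<Longrightarrow> t \<in> sym_carrier \<Longrightarrow> s * t \<in> sym_carrier"
  using keys_mult[of s t] by (fastforce simp: sym_carrier_def)

lemma symbol_gen_carrier: "x \<in> carrier L \<Longrightarrow> symbol (free_gen x) \<in> sym_carrier"
  using keys_lin_ext_subset[of "\<lambda>b. Poly_Mapping.single {#b#} 1" "coord x"] keys_coord[of x]
  by (fastforce simp: sym_carrier_def symbol_gen)

lemma symbol_word_carrier: "set w \<subseteq> carrier L \<Longrightarrow> symbol (Poly_Mapping.single w 1) \<in> sym_carrier"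
proof (induction w)
  case Nil
  then show ?case by (simp add: symbol_def subst_single sym_carrier_def)
next
  case (Cons x w)
  then show ?case by (auto simp: symbol_single_Cons intro: sym_carrier_mult symbol_gen_carrier)
qed

lemma unsymbol_mult_letter:
  assumes "b \<in> carrier L" "t \<in> sym_carrier"
  shows "free_gen b * unsymbol t - unsymbol (Poly_Mapping.single {#b#} 1 * t) \<in> env_ideal (Ab L)"
proof -
  interpret Ab: lie_algebra "Ab L" by (rule lie_algebra_Ab)
  have "free_gen b * unsymbol t - unsymbol (Poly_Mapping.single {#b#} 1 * t)
      = lin_ext (\<lambda>m. Poly_Mapping.single (b # monomial_word m) 1
          - Poly_Mapping.single (monomial_word (add_mset b m)) 1) t"
    by (rule pm_linear_eqI[where h = "\<lambda>t. free_gen b * unsymbol t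
          - unsymbol (Poly_Mapping.single {#b#} 1 * t)"])
      (auto intro!: pm_linearI simp: pm_linear_add pm_linear_scale pm.scale_right_diff_distrib
        distrib_left pm_scale_mult_right mult_single free_gen_def plus_list_def unsymbol_def)
  also have "\<dots> \<in> env_ideal (Ab L)"
  proof (rule Ab.env_ideal_lin_ext, rule word_permute_Ab)
    fix m assume "m \<in> Poly_Mapping.keys t"
    then have "set_mset m \<subseteq> carrier L" using assms by (auto simp: sym_carrier_def)
    moreover have "set (monomial_word m) = set_mset m"
      by (metis mset_monomial_word set_mset_mset)
    ultimately show "set (b # monomial_word m) \<subseteq> carrier L" using assms by simp
  qed simp
  finally show ?thesis .
qed

lemma gen_coord_Ab:
  assumes "x \<in> carrier L"
  shows "free_gen x - lin_ext free_gen (coord x) \<in> env_ideal (Ab L)"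
proof -
  interpret Ab: lie_algebra "Ab L" by (rule lie_algebra_Ab)
  show ?thesis
    using Ab.env_ideal_gen_add Ab.env_ideal_gen_scale assms
    by (intro coord_ext_mod[OF Ab.subspace_env_ideal]) auto
qed

lemma unsymbol_mult_gen:
  assumes x: "x \<in> carrier L" and t: "t \<in> sym_carrier"
  shows "free_gen x * unsymbol t - unsymbol (symbol (free_gen x) * t) \<in> env_ideal (Ab L)"
proof -
  interpret Ab: lie_algebra "Ab L" by (rule lie_algebra_Ab)
  have closed: "unsymbol t \<in> carrier (free_alg (carrier L))"
    unfolding unsymbol_def
  proof (rule free_alg_lin_ext_closed)
    fix m assume "m \<in> Poly_Mapping.keys t"
    then show "Poly_Mapping.single (monomial_word m) 1 \<in> carrier (free_alg (carrier L))"
      using t by (intro free_alg_closed) (metis (mono_tags) mset_monomial_word set_mset_mset sym_carrier_def mem_Collect_eq)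
  qed
  have 1: "free_gen x * unsymbol t - lin_ext free_gen (coord x) * unsymbol t \<in> env_ideal (Ab L)"
    using Ab.env_ideal_mult_right[OF gen_coord_Ab[OF x]] closed by (simp add: left_diff_distrib)
  have "lin_ext free_gen (coord x) * unsymbol t - unsymbol (symbol (free_gen x) * t)
      = lin_ext (\<lambda>b. free_gen b * unsymbol t - unsymbol (Poly_Mapping.single {#b#} 1 * t)) (coord x)"
    unfolding symbol_gen lin_ext_fun_diff
    by (simp add: pm_linear_comp_lin_ext[OF pm_linear_mult_left]
        pm_linear_comp_lin_ext[OF unsymbol_linear])
  moreover have "lin_ext (\<lambda>b. free_gen b * unsymbol t - unsymbol (Poly_Mapping.single {#b#} 1 * t)) (coord x)
      \<in> env_ideal (Ab L)"
    using keys_coord[OF x] t by (intro Ab.env_ideal_lin_ext unsymbol_mult_letter) auto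
  ultimately have "lin_ext free_gen (coord x) * unsymbol t - unsymbol (symbol (free_gen x) * t)
      \<in> env_ideal (Ab L)" by (simp only:)
  with 1 show ?thesis by (rule Ab.env_ideal_trans)
qed

text \<open>
  The other half of the kernel computation: an element is recovered from its symbol modulo the ideal
  of \<open>U(Ab L)\<close>.
\<close>

lemma unsymbol_symbol:
  assumes "f \<in> carrier (free_alg (carrier L))"
  shows "f - unsymbol (symbol f) \<in> env_ideal (Ab L)"
proof -
  interpret Ab: lie_algebra "Ab L" by (rule lie_algebra_Ab)
  have word: "Poly_Mapping.single w 1 - unsymbol (symbol (Poly_Mapping.single w 1)) \<in> env_ideal (Ab L)"
    if "set w \<subseteq> carrier L" for w
    using that
  proof (induction w)
    case Nil
    have "monomial_word {#} = []" by (metis mset_monomial_word mset_zero_iff)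
    then show ?case
      by (simp add: symbol_def subst_single unsymbol_def Ab.env_ideal_zero flip: single_one)
  next
    case (Cons x w)
    have "free_gen x * (Poly_Mapping.single w 1 - unsymbol (symbol (Poly_Mapping.single w 1)))
        \<in> env_ideal (Ab L)"
      using Cons by (intro Ab.env_ideal_mult_left) (auto intro: free_alg_closed)
    moreover have "free_gen x * unsymbol (symbol (Poly_Mapping.single w 1))
        - unsymbol (symbol (Poly_Mapping.single (x # w) 1)) \<in> env_ideal (Ab L)"
      unfolding symbol_single_Cons
      using Cons.prems by (intro unsymbol_mult_gen symbol_word_carrier) auto
    ultimately have "free_gen x * Poly_Mapping.single w 1
        - unsymbol (symbol (Poly_Mapping.single (x # w) 1)) \<in> env_ideal (Ab L)"
      unfolding right_diff_distrib by (rule Ab.env_ideal_trans)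
    then show ?case by (simp add: free_gen_def mult_single plus_list_def)
  qed
  have "f - unsymbol (symbol f)
      = lin_ext (\<lambda>w. Poly_Mapping.single w 1 - unsymbol (symbol (Poly_Mapping.single w 1))) f"
    by (rule pm_linear_eqI[where h = "\<lambda>f. f - unsymbol (symbol f)"])
      (auto intro!: pm_linearI simp: pm_linear_add pm_linear_scale pm.scale_right_diff_distrib)
  then show ?thesis
    using assms by (auto simp: carrier_free_alg intro!: Ab.env_ideal_lin_ext word)
qed

theorem env_ideal_Ab_iff:
  assumes "f \<in> carrier (free_alg (carrier L))"
  shows "f \<in> env_ideal (Ab L) \<longleftrightarrow> symbol f = 0"
  using symbol_env_ideal_Ab unsymbol_symbol[OF assms] by (auto simp: pm_linear_zero)

section \<open>Leading terms in the enveloping algebra\<close>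

text \<open>
  The action of \<open>L\<close> on polynomials obtained from that of the free vector space by pulling back along
  \<open>coord\<close>. It is a Lie algebra action because \<open>coord\<close> respects the brackets, and an element acts as
  multiplication by its symbol up to lower terms.
\<close>

lemma ex_lie_action:
  obtains \<rho> :: "'a \<Rightarrow> ('a multiset \<Rightarrow>\<^sub>0 'k) \<Rightarrow> ('a multiset \<Rightarrow>\<^sub>0 'k)" where
    "\<And>x. pm_linear (\<rho> x)"
    "\<And>x y s. x \<in> carrier L \<Longrightarrow> y \<in> carrier L \<Longrightarrow> \<rho> (x \<oplus> y) s = \<rho> x s + \<rho> y s"
    "\<And>c x s. x \<in> carrier L \<Longrightarrow> \<rho> (c \<odot> x) s = pm_scale c (\<rho> x s)"
    "\<And>x y s. x \<in> carrier L \<Longrightarrow> y \<in> carrier L \<Longrightarrow> \<rho> x (\<rho> y s) - \<rho> y (\<rho> x s) = \<rho> (lie L x y) s"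
    "\<And>x s n. s \<in> low_degree n \<Longrightarrow> \<rho> x s - symbol (free_gen x) * s \<in> low_degree n"
proof -
  obtain le where "lie_structure_constants coord_br le" using ex_lie_structure_constants by blast
  then interpret lie_structure_constants coord_br le .
  define \<rho> where "\<rho> x = act_vec (coord x)" for x
  show ?thesis
  proof
    show "pm_linear (\<rho> x)" for x by (simp add: \<rho>_def)
    show "\<rho> (x \<oplus> y) s = \<rho> x s + \<rho> y s" if "x \<in> carrier L" "y \<in> carrier L" for x y s
      using that by (simp add: \<rho>_def coord_add pm_linear_add[OF act_vec_linear_left])
    show "\<rho> (c \<odot> x) s = pm_scale c (\<rho> x s)" if "x \<in> carrier L" for c x s
      using that by (simp add: \<rho>_def coord_scale pm_linear_scale[OF act_vec_linear_left])
    show "\<rho> x (\<rho> y s) - \<rho> y (\<rho> x s) = \<rho> (lie L x y) s" if x: "x \<in> carrier L" and y: "y \<in> carrier L" for x y s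
    proof -
      have comp: "act_vec u (act_vec v s) = lin_ext (\<lambda>a. lin_ext (\<lambda>b. act a (act b s)) v) u" for u v
        by (simp add: act_vec_def[of u] act_vec_def[of v] pm_linear_comp_lin_ext[OF act_linear])
      have "\<rho> x (\<rho> y s) - \<rho> y (\<rho> x s)
          = lin_ext (\<lambda>a. lin_ext (\<lambda>b. act a (act b s) - act b (act a s)) (coord y)) (coord x)"
        unfolding \<rho>_def comp lin_ext_fun_diff by (subst lin_ext_swap) simp
      also have "\<dots> = lin_ext (\<lambda>a. lin_ext (\<lambda>b. \<rho> (lie L a b) s) (coord y)) (coord x)"
        using keys_coord[OF x] keys_coord[OF y]
        by (intro lin_ext_cong refl) (auto simp: act_commutator coord_br_def \<rho>_def)
      also have "\<dots> = lin_ext (\<lambda>a. \<rho> (lie L a y) s) (coord x)"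
        using keys_coord[OF x] y
        by (intro lin_ext_cong refl coord_ext)
          (auto simp: \<rho>_def lie_add_right lie_smult_right lie_closed coord_add coord_scale
            pm_linear_add[OF act_vec_linear_left] pm_linear_scale[OF act_vec_linear_left])
      also have "\<dots> = \<rho> (lie L x y) s"
        using x y
        by (intro coord_ext)
          (auto simp: \<rho>_def lie_add_left lie_smult_left lie_closed coord_add coord_scale
            pm_linear_add[OF act_vec_linear_left] pm_linear_scale[OF act_vec_linear_left])
      finally show ?thesis .
    qed
    show "\<rho> x s - symbol (free_gen x) * s \<in> low_degree n" if "s \<in> low_degree n" for x s n
    proof -
      have "\<rho> x s - symbol (free_gen x) * s
          = lin_ext (\<lambda>a. act a s - Poly_Mapping.single {#a#} 1 * s) (coord x)"
        by (simp add: \<rho>_def act_vec_def symbol_gen lin_ext_fun_diff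
            pm_linear_comp_lin_ext[OF pm_linear_mult_left])
      also have "\<dots> \<in> low_degree n" using that by (intro low_degree_lin_ext act_lower)
      finally show ?thesis .
    qed
  qed
qed

lemma symbol_gen_degree: "m \<in> Poly_Mapping.keys (symbol (free_gen x)) \<Longrightarrow> size m = 1"
  using keys_lin_ext_subset[of "\<lambda>b. Poly_Mapping.single {#b#} 1" "coord x"]
  by (fastforce simp: symbol_gen)

lemma symbol_word_degree: "m \<in> Poly_Mapping.keys (symbol (Poly_Mapping.single w 1)) \<Longrightarrow> size m = length w"
proof (induction w arbitrary: m)
  case Nil
  then show ?case by (simp add: symbol_def subst_single)
next
  case (Cons x w)
  then obtain m1 m2 where "m = m1 + m2" "m1 \<in> Poly_Mapping.keys (symbol (free_gen x))"
    "m2 \<in> Poly_Mapping.keys (symbol (Poly_Mapping.single w 1))"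
    using keys_mult[of "symbol (free_gen x)" "symbol (Poly_Mapping.single w 1)"]
    by (auto simp: symbol_single_Cons)
  then show ?case using Cons.IH symbol_gen_degree by fastforce
qed

lemma symbol_degree:
  "m \<in> Poly_Mapping.keys (symbol f) \<Longrightarrow> \<exists>w\<in>Poly_Mapping.keys f. size m = length w"
proof -
  have "symbol f = lin_ext (\<lambda>w. symbol (Poly_Mapping.single w 1)) f"
    by (rule pm_linear_eqI) auto
  then show "m \<in> Poly_Mapping.keys (symbol f) \<Longrightarrow> \<exists>w\<in>Poly_Mapping.keys f. size m = length w"
    using keys_lin_ext_subset[of "\<lambda>w. symbol (Poly_Mapping.single w 1)" f] symbol_word_degree
    by fastforce
qed

text \<open>
  The core of the Poincare-Birkhoff-Witt theorem. The action of \<open>L\<close> on polynomials extends to the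
  free algebra and is zero on the ideal of \<open>U(L)\<close>, so \<open>f\<close> and \<open>g\<close> send \<open>1\<close> to the same polynomial. For
  \<open>g\<close> it has degree below \<open>n\<close>, for \<open>f\<close> it is the symbol of \<open>f\<close> up to degree below \<open>n\<close>; and the symbol
  is homogeneous of degree \<open>n\<close>.
\<close>

theorem symbol_leading_zero:
  assumes f: "f \<in> carrier (free_alg (carrier L))" "\<And>w. w \<in> Poly_Mapping.keys f \<Longrightarrow> length w = n"
    and g: "\<And>w. w \<in> Poly_Mapping.keys g \<Longrightarrow> length w < n"
    and fg: "f - g \<in> env_ideal L"
  shows "symbol f = 0"
proof -
  obtain \<rho> :: "'a \<Rightarrow> ('a multiset \<Rightarrow>\<^sub>0 'k) \<Rightarrow> ('a multiset \<Rightarrow>\<^sub>0 'k)" where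
    lin: "\<And>x. pm_linear (\<rho> x)"
    and add: "\<And>x y s. x \<in> carrier L \<Longrightarrow> y \<in> carrier L \<Longrightarrow> \<rho> (x \<oplus> y) s = \<rho> x s + \<rho> y s"
    and scale: "\<And>c x s. x \<in> carrier L \<Longrightarrow> \<rho> (c \<odot> x) s = pm_scale c (\<rho> x s)"
    and lie: "\<And>x y s. x \<in> carrier L \<Longrightarrow> y \<in> carrier L \<Longrightarrow>
      \<rho> x (\<rho> y s) - \<rho> y (\<rho> x s) = \<rho> (lie L x y) s"
    and lead: "\<And>x s n. s \<in> low_degree n \<Longrightarrow> \<rho> x s - symbol (free_gen x) * s \<in> low_degree n"
    by (rule ex_lie_action) (rule that)
  define A where "A h s = lin_ext (\<lambda>w. foldr \<rho> w s) h" for h s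
  have lin_word: "pm_linear (foldr \<rho> w)" for w
    by (induction w) (auto intro: pm_linearI simp: pm_linear_add[OF lin] pm_linear_scale[OF lin]
        pm_linear_add pm_linear_scale)
  have A_lin: "pm_linear (\<lambda>h. A h s)" for s unfolding A_def by simp
  have A_lin': "pm_linear (A h)" for h unfolding A_def using lin_word by (rule pm_linear_param)
  have A_single: "A (Poly_Mapping.single w 1) s = foldr \<rho> w s" for w s by (simp add: A_def)
  have A_gen: "A (free_gen x) s = \<rho> x s" for x s by (simp add: A_def free_gen_def)
  have A_mult: "A (h * k) s = A h (A k s)" for h k s
  proof (rule pm_linear_eqI[where f = h and h = "\<lambda>h. A (h * k) s"])
    fix u
    show "A (Poly_Mapping.single u 1 * k) s = A (Poly_Mapping.single u 1) (A k s)"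
      by (rule pm_linear_eqI[where f = k])
        (auto intro: pm_linear_comp[OF A_lin pm_linear_mult_right] pm_linear_comp[OF lin_word A_lin]
          simp: mult_single plus_list_def A_single)
  qed (auto intro: pm_linear_comp[OF A_lin pm_linear_mult_left] A_lin)
  have A_ideal: "A j s = 0" if "j \<in> env_ideal L" for j s
    using that
  proof (induction arbitrary: s rule: env_ideal_induct)
    case (gen_add x y)
    then show ?case by (simp add: pm_linear_diff[OF A_lin] pm_linear_add[OF A_lin] A_gen add)
  next
    case (gen_scale c x)
    then show ?case by (simp add: pm_linear_diff[OF A_lin] pm_linear_scale[OF A_lin] A_gen scale)
  next
    case (gen_lie x y)
    then show ?case by (simp add: pm_linear_diff[OF A_lin] A_mult A_gen lie)
  qed (simp_all add: pm_linear_zero[OF A_lin] pm_linear_add[OF A_lin] A_mult pm_linear_zero[OF A_lin'])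
  have mult_low: "symbol (free_gen x) * s \<in> low_degree (Suc n)" if "s \<in> low_degree n" for x s n
    using keys_mult[of "symbol (free_gen x)" s] symbol_gen_degree[of _ x] that
    by (fastforce simp: low_degree_def)
  have word: "foldr \<rho> w 1 - symbol (Poly_Mapping.single w 1) \<in> low_degree (length w)
      \<and> foldr \<rho> w 1 \<in> low_degree (Suc (length w))" for w
  proof (induction w)
    case Nil
    show ?case
      by (simp add: symbol_def subst_single low_degree_single flip: single_one)
  next
    case (Cons x w)
    let ?s = "foldr \<rho> w 1"
    have "\<rho> x ?s - symbol (free_gen x) * ?s
        + symbol (free_gen x) * (?s - symbol (Poly_Mapping.single w 1)) \<in> low_degree (Suc (length w))"
      using Cons by (intro low_degree_add lead mult_low) auto
    moreover have "\<rho> x ?s - symbol (free_gen x) * ?s + symbol (free_gen x) * ?s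
        \<in> low_degree (Suc (Suc (length w)))"
      using Cons by (intro low_degree_add low_degree_mono[OF lead] mult_low) auto
    ultimately show ?case by (simp add: symbol_single_Cons right_diff_distrib)
  qed
  have A_symbol: "A f 1 - symbol f = lin_ext (\<lambda>w. foldr \<rho> w 1 - symbol (Poly_Mapping.single w 1)) f"
    by (rule pm_linear_eqI[where h = "\<lambda>f. A f 1 - symbol f"])
      (auto intro!: pm_linearI simp: A_def lin_ext_add lin_ext_scale pm_linear_add pm_linear_scale
        pm.scale_right_diff_distrib)
  have 1: "A f 1 - symbol f \<in> low_degree n"
    unfolding A_symbol using word f(2) by (intro low_degree_lin_ext) auto
  have 2: "A g 1 \<in> low_degree n"
    unfolding A_def using word g
    by (intro low_degree_lin_ext low_degree_mono[OF word[THEN conjunct2]]) (simp add: Suc_le_eq)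
  have "A f 1 = A g 1" using A_ideal[OF fg, of 1] by (simp add: pm_linear_diff[OF A_lin])
  with low_degree_diff[OF 2 1] have "symbol f \<in> low_degree n" by simp
  moreover have "size m = n" if "m \<in> Poly_Mapping.keys (symbol f)" for m
    using symbol_degree[OF that] f(2) by auto
  ultimately have "Poly_Mapping.keys (symbol f) = {}" by (fastforce simp: low_degree_def)
  then show ?thesis by simp
qed

end

section \<open>Homogeneous components\<close>

definition homog :: "nat \<Rightarrow> ('a list \<Rightarrow>\<^sub>0 'k::field) \<Rightarrow> ('a list \<Rightarrow>\<^sub>0 'k)" where
  "homog n = lin_ext (\<lambda>w. if length w = n then Poly_Mapping.single w 1 else 0)"

lemma homog_linear [simp]: "pm_linear (homog n)"
  by (simp add: homog_def)

lemma homog_single [simp]: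
  "homog n (Poly_Mapping.single w c) = (if length w = n then Poly_Mapping.single w c else 0)"
  by (simp add: homog_def)

lemma lookup_homog: "Poly_Mapping.lookup (homog n f) w = (if length w = n then Poly_Mapping.lookup f w else 0)"
proof (cases "w \<in> Poly_Mapping.keys f")
  case True
  have "Poly_Mapping.lookup (homog n f) w = (\<Sum>v\<in>Poly_Mapping.keys f. if v = w then
      (if length w = n then Poly_Mapping.lookup f w else 0) else 0)"
    unfolding homog_def lin_ext_def lookup_sum
    by (rule sum.cong) (auto simp: lookup_single when_def)
  then show ?thesis using True by simp
next
  case False
  then have "Poly_Mapping.lookup (homog n f) w = 0"
    unfolding homog_def lin_ext_def lookup_sum
    by (intro sum.neutral) (auto simp: lookup_single when_def)
  then show ?thesis using False by (simp add: in_keys_iff)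
qed

lemma keys_homog: "Poly_Mapping.keys (homog n f) = {w \<in> Poly_Mapping.keys f. length w = n}"
  by (auto simp: in_keys_iff lookup_homog split: if_splits)

lemma homog_homog: "homog m (homog n f) = (if m = n then homog n f else 0)"
  by (rule poly_mapping_eqI) (auto simp: lookup_homog)

lemma homog_mult:
  fixes f g :: "'a list \<Rightarrow>\<^sub>0 'k::field"
  shows "homog n (f * g) = (\<Sum>i\<le>n. homog i f * homog (n - i) g)"
proof (rule pm_linear_eqI[where f = f and h = "\<lambda>f. homog n (f * g)"])
  show "pm_linear (\<lambda>f. homog n (f * g))" by (rule pm_linear_comp[OF homog_linear pm_linear_mult_left])
  show "pm_linear (\<lambda>f. \<Sum>i\<le>n. homog i f * homog (n - i) g)"
    by (rule pm_linearI) (simp_all add: pm_linear_add pm_linear_scale distrib_right sum.distrib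
        pm_scale_mult_left pm.scale_sum_right)
  fix u
  show "homog n (Poly_Mapping.single u 1 * g) = (\<Sum>i\<le>n. homog i (Poly_Mapping.single u 1) * homog (n - i) g)"
  proof (rule pm_linear_eqI[where f = g])
    show "pm_linear (\<lambda>g. homog n (Poly_Mapping.single u 1 * g))"
      by (rule pm_linear_comp[OF homog_linear pm_linear_mult_right])
    show "pm_linear (\<lambda>g. \<Sum>i\<le>n. homog i (Poly_Mapping.single u 1) * homog (n - i) g)"
      by (rule pm_linearI) (simp_all add: pm_linear_add pm_linear_scale distrib_left sum.distrib
          pm_scale_mult_right pm.scale_sum_right del: homog_single)
    fix v
    have "(\<Sum>i\<le>n. homog i (Poly_Mapping.single u 1) * homog (n - i) (Poly_Mapping.single v 1))
        = (\<Sum>i\<le>n. if i = length u then (if length u + length v = n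
             then Poly_Mapping.single (u @ v) 1 else 0) else (0 :: 'a list \<Rightarrow>\<^sub>0 'k))"
      by (rule sum.cong) (auto simp: mult_single plus_list_def)
    also have "\<dots> = homog n (Poly_Mapping.single u 1 * Poly_Mapping.single v 1)"
      by (simp add: mult_single plus_list_def)
    finally show "homog n (Poly_Mapping.single u (1 :: 'k) * Poly_Mapping.single v 1)
        = (\<Sum>i\<le>n. homog i (Poly_Mapping.single u 1) * homog (n - i) (Poly_Mapping.single v 1))" ..
  qed
qed

lemma sum_homog:
  assumes "\<And>w. w \<in> Poly_Mapping.keys f \<Longrightarrow> length w < n"
  shows "f = (\<Sum>i<n. homog i f)"
proof (rule poly_mapping_eqI)
  fix w
  show "Poly_Mapping.lookup f w = Poly_Mapping.lookup (\<Sum>i<n. homog i f) w"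
    using assms[of w] by (auto simp: lookup_sum lookup_homog in_keys_iff)
qed

lemma ex_length_bound: "\<exists>n. \<forall>w\<in>Poly_Mapping.keys (f :: 'a list \<Rightarrow>\<^sub>0 'k::zero). length w < n"
  using finite_nat_set_iff_bounded[of "length ` Poly_Mapping.keys f"] by auto

section \<open>The enveloping algebra and its canonical filtration\<close>

lemma quot_alg_simps:
  "carrier (quot_alg A I) = A_RCOSETS A I"
  "C \<otimes>\<^bsub>quot_alg A I\<^esub> D = rcoset_mult A I C D"
  "\<one>\<^bsub>quot_alg A I\<^esub> = I +>\<^bsub>A\<^esub> \<one>\<^bsub>A\<^esub>"
  "\<zero>\<^bsub>quot_alg A I\<^esub> = I"
  "C \<oplus>\<^bsub>quot_alg A I\<^esub> D = set_add A C D"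
  "c \<odot>\<^bsub>quot_alg A I\<^esub> C = (\<Union>x\<in>C. I +>\<^bsub>A\<^esub> (c \<odot>\<^bsub>A\<^esub> x))"
  by (simp_all add: quot_alg_def ring.defs module.defs FactRing_def)

text \<open>
  Evaluation out of a free algebra is the only morphism with given values on letters. The
  target is only an additive monoid, so that the lemma applies to the associated graded algebra before
  any ring law is known there; the map \<open>h\<close> carries the multiplicative information.
\<close>

lemma free_lift_eq_hom:
  fixes S :: "'a set" and h :: "('a list \<Rightarrow>\<^sub>0 'k::field) \<Rightarrow> 'b" and B :: "('k, 'b) module"
  assumes B: "abelian_monoid B"
    and closed: "\<And>f. f \<in> carrier (free_alg S) \<Longrightarrow> h f \<in> carrier B"
    and add: "\<And>f g. f \<in> carrier (free_alg S) \<Longrightarrow> g \<in> carrier (free_alg S) \<Longrightarrow> h (f + g) = h f \<oplus>\<^bsub>B\<^esub> h g"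
    and zero: "h 0 = \<zero>\<^bsub>B\<^esub>"
    and mult: "\<And>f g. f \<in> carrier (free_alg S) \<Longrightarrow> g \<in> carrier (free_alg S) \<Longrightarrow> h (f * g) = h f \<otimes>\<^bsub>B\<^esub> h g"
    and one: "h 1 = \<one>\<^bsub>B\<^esub>"
    and scale: "\<And>c f. f \<in> carrier (free_alg S) \<Longrightarrow> h (pm_scale c f) = c \<odot>\<^bsub>B\<^esub> h f"
    and \<theta>: "\<And>x. x \<in> S \<Longrightarrow> \<theta> x = h (free_gen x)"
    and f: "f \<in> carrier (free_alg S)"
  shows "free_lift B \<theta> f = h f"
proof -
  interpret abelian_monoid B by fact
  have word: "word_prod B \<theta> w = h (Poly_Mapping.single w 1)" if "set w \<subseteq> S" for w
    using that
  proof (induction w)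
    case Nil
    then show ?case by (simp add: word_prod_def one flip: one_list_algebra)
  next
    case (Cons x w)
    then have "h (free_gen x * Poly_Mapping.single w 1) = h (free_gen x) \<otimes>\<^bsub>B\<^esub> h (Poly_Mapping.single w 1)"
      by (intro mult) (auto intro: free_alg_closed)
    with Cons show ?case by (simp add: word_prod_def \<theta> free_gen_def mult_single plus_list_def)
  qed
  have sum: "(\<Oplus>\<^bsub>B\<^esub>w\<in>K. h (g w)) = h (\<Sum>w\<in>K. g w)"
    and sum_closed: "(\<Sum>w\<in>K. g w) \<in> carrier (free_alg S)"
    if "finite K" "\<And>w. w \<in> K \<Longrightarrow> g w \<in> carrier (free_alg S)" for K and g :: "'a list \<Rightarrow> ('a list \<Rightarrow>\<^sub>0 'k)"
    using that
  proof (induction K)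
    case (insert w K)
    {
      case 1
      then show ?case using insert by (subst finsum_insert) (auto simp: closed add)
    next
      case 2
      then show ?case using insert by (auto intro: free_alg_closed)
    }
  qed (auto simp: zero free_alg_closed)
  have "free_lift B \<theta> f = (\<Oplus>\<^bsub>B\<^esub>w\<in>Poly_Mapping.keys f. h (Poly_Mapping.single w (Poly_Mapping.lookup f w)))"
    unfolding free_lift_def
  proof (rule finsum_cong')
    fix w assume "w \<in> Poly_Mapping.keys f"
    then have w: "set w \<subseteq> S" using f by (auto simp: carrier_free_alg)
    then show "Poly_Mapping.lookup f w \<odot>\<^bsub>B\<^esub> word_prod B \<theta> w = h (Poly_Mapping.single w (Poly_Mapping.lookup f w))"
      using scale[of "Poly_Mapping.single w 1" "Poly_Mapping.lookup f w"] by (simp add: word)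
  qed (use f in \<open>auto simp: carrier_free_alg intro!: closed\<close>)
  also have "\<dots> = h f"
    using f by (subst sum) (auto simp: carrier_free_alg simp flip: poly_mapping_sum_singles)
  finally show ?thesis .
qed

definition env_class :: "('k::field, 'a) lie_ring \<Rightarrow> ('a list \<Rightarrow>\<^sub>0 'k) \<Rightarrow> ('a list \<Rightarrow>\<^sub>0 'k) set" where
  "env_class L f = env_ideal L +>\<^bsub>free_alg (carrier L)\<^esub> f"

lemma env_gen_eq: "env_gen L x = env_class L (free_gen x)"
  by (simp add: env_gen_def env_class_def)

context lie_algebra
begin

abbreviation free_carrier :: "('a list \<Rightarrow>\<^sub>0 'k) set" where
  "free_carrier \<equiv> carrier (free_alg (carrier L))"

lemma env_class_eq_iff:
  "f \<in> free_carrier \<Longrightarrow> g \<in> free_carrier \<Longrightarrow> env_class L f = env_class L g \<longleftrightarrow> f - g \<in> env_ideal L"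
  unfolding env_class_def by (rule free_alg_coset_eq_iff[OF ideal_env_ideal])

lemma env_class_eqI: "f - g \<in> env_ideal L \<Longrightarrow> g \<in> free_carrier \<Longrightarrow> env_class L f = env_class L g"
  using env_class_eq_iff[of f g] env_ideal_carrier[of "f - g"] free_alg_add_closed[of "f - g" "carrier L" g]
  by simp

lemma mem_env_class: "g \<in> env_class L f \<longleftrightarrow> g - f \<in> env_ideal L"
proof
  show "g \<in> env_class L f \<Longrightarrow> g - f \<in> env_ideal L"
    by (auto simp: env_class_def a_r_coset_def')
  show "g - f \<in> env_ideal L \<Longrightarrow> g \<in> env_class L f"
    by (force simp: env_class_def a_r_coset_def' intro: bexI[of _ "g - f"])
qed

lemma carrier_Env: "carrier (Env L) = env_class L ` free_carrier"
  by (auto simp: Env_def quot_alg_simps A_RCOSETS_def' env_class_def)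

lemma Env_mult: "f \<in> free_carrier \<Longrightarrow> g \<in> free_carrier \<Longrightarrow>
    env_class L f \<otimes>\<^bsub>Env L\<^esub> env_class L g = env_class L (f * g)"
  using ideal.rcoset_mult_add[OF ideal_env_ideal, of f g]
  by (simp add: Env_def quot_alg_simps env_class_def)

lemma Env_add: "f \<in> free_carrier \<Longrightarrow> g \<in> free_carrier \<Longrightarrow>
    env_class L f \<oplus>\<^bsub>Env L\<^esub> env_class L g = env_class L (f + g)"
  using abelian_subgroup.a_rcos_sum[OF abelian_subgroupI3[OF ideal.axioms(1)[OF ideal_env_ideal]
      ring.is_abelian_group[OF ring_free_alg]], of f g]
  by (simp add: Env_def quot_alg_simps env_class_def)

lemma Env_one: "\<one>\<^bsub>Env L\<^esub> = env_class L 1"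
  by (simp add: Env_def quot_alg_simps env_class_def)

lemma Env_zero: "\<zero>\<^bsub>Env L\<^esub> = env_class L 0"
  using mem_env_class[of _ 0] by (auto simp: Env_def quot_alg_simps)

lemma Env_smult:
  assumes f: "f \<in> free_carrier"
  shows "c \<odot>\<^bsub>Env L\<^esub> env_class L f = env_class L (pm_scale c f)"
proof -
  have const: "env_class L (pm_scale c g) = env_class L (pm_scale c f)" if "g \<in> env_class L f" for g
  proof (rule env_class_eqI)
    show "pm_scale c g - pm_scale c f \<in> env_ideal L"
      using env_ideal_scale[of "g - f" c] that by (simp add: mem_env_class pm.scale_right_diff_distrib)
    show "pm_scale c f \<in> free_carrier" using f by (rule free_alg_scale_closed)
  qed
  have "env_class L f \<noteq> {}" using mem_env_class[of f f] env_ideal_zero by auto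
  then have "(\<Union>g\<in>env_class L f. env_class L (pm_scale c g)) = env_class L (pm_scale c f)"
    by (rule SUP_eq_const) (rule const)
  then show ?thesis by (simp add: Env_def quot_alg_simps env_class_def)
qed

lemmas Env_simps = Env_mult Env_add Env_one Env_zero Env_smult

lemma abelian_group_Env: "abelian_group (Env L)"
proof (rule abelian_groupI)
  fix C assume "C \<in> carrier (Env L)"
  then obtain f where f: "f \<in> free_carrier" "C = env_class L f" by (auto simp: carrier_Env)
  then have "env_class L (- f) \<in> carrier (Env L)" "env_class L (- f) \<oplus>\<^bsub>Env L\<^esub> C = \<zero>\<^bsub>Env L\<^esub>"
    by (auto simp: carrier_Env Env_simps free_alg_closed)
  then show "\<exists>D\<in>carrier (Env L). D \<oplus>\<^bsub>Env L\<^esub> C = \<zero>\<^bsub>Env L\<^esub>" by blast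
next
  fix C D assume "C \<in> carrier (Env L)" "D \<in> carrier (Env L)"
  then show "C \<oplus>\<^bsub>Env L\<^esub> D = D \<oplus>\<^bsub>Env L\<^esub> C" by (auto simp: carrier_Env Env_add add.commute)
qed (auto simp: carrier_Env Env_simps free_alg_closed add.assoc)

lemma word_prod_Env: "set w \<subseteq> carrier L \<Longrightarrow> word_prod (Env L) (env_gen L) w = env_class L (Poly_Mapping.single w 1)"
proof (induction w)
  case Nil
  then show ?case by (simp add: word_prod_def Env_one flip: one_list_algebra)
next
  case (Cons x w)
  then show ?case
    by (simp add: word_prod_def env_gen_eq Env_mult free_alg_closed)
      (simp add: free_gen_def mult_single plus_list_def)
qed

text \<open>
  The free algebra in degrees below \<open>n\<close>. With a strict bound the term \<open>F (n - 1)\<close> of the filtration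
  is the image of \<open>free_filt n\<close> also for \<open>n = 0\<close>.
\<close>

definition free_filt :: "nat \<Rightarrow> ('a list \<Rightarrow>\<^sub>0 'k) set" where
  "free_filt n = {f \<in> free_carrier. \<forall>w\<in>Poly_Mapping.keys f. length w < n}"

lemma free_filt_carrier: "f \<in> free_filt n \<Longrightarrow> f \<in> free_carrier"
  by (simp add: free_filt_def)

lemma free_filt_add: "f \<in> free_filt n \<Longrightarrow> g \<in> free_filt n \<Longrightarrow> f + g \<in> free_filt n"
  using keys_add[of f g] by (auto simp: free_filt_def free_alg_closed)

lemma free_filt_scale: "f \<in> free_filt n \<Longrightarrow> pm_scale c f \<in> free_filt n"
  using keys_pm_scale[of c f] by (auto simp: free_filt_def free_alg_closed)

lemma free_filt_zero: "0 \<in> free_filt n"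
  by (simp add: free_filt_def free_alg_closed)

lemma free_filt_uminus: "f \<in> free_filt n \<Longrightarrow> - f \<in> free_filt n"
  using free_filt_scale[of f n "- 1"] by simp

lemma free_filt_mono: "f \<in> free_filt n \<Longrightarrow> n \<le> m \<Longrightarrow> f \<in> free_filt m"
  by (fastforce simp: free_filt_def)

lemma free_filt_single: "set w \<subseteq> carrier L \<Longrightarrow> length w < n \<Longrightarrow> Poly_Mapping.single w c \<in> free_filt n"
  by (simp add: free_filt_def)

lemma free_filt_sum: "(\<And>i. i \<in> A \<Longrightarrow> f i \<in> free_filt n) \<Longrightarrow> sum f A \<in> free_filt n"
  by (induction A rule: infinite_finite_induct) (auto intro: free_filt_add free_filt_zero)

lemma free_filt_mult:
  assumes "f \<in> free_filt (Suc m)" "g \<in> free_filt n"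
  shows "f * g \<in> free_filt (m + n)" "g * f \<in> free_filt (m + n)"
  using assms keys_mult[of f g] keys_mult[of g f]
  by (fastforce simp: free_filt_def free_alg_closed plus_list_def)+

lemma Env_submodule_lin_ext:
  assumes H: "submodule H (ring_of_type_algebra :: 'k ring) (Env L)"
    and gens: "\<And>w. w \<in> Poly_Mapping.keys f \<Longrightarrow> set w \<subseteq> carrier L \<and> env_class L (Poly_Mapping.single w 1) \<in> H"
  shows "env_class L f \<in> H"
proof -
  interpret submodule H "ring_of_type_algebra :: 'k ring" "Env L" by fact
  have "env_class L (\<Sum>w\<in>K. Poly_Mapping.single w (Poly_Mapping.lookup f w)) \<in> H
      \<and> (\<Sum>w\<in>K. Poly_Mapping.single w (Poly_Mapping.lookup f w)) \<in> free_carrier"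
    if "finite K" "K \<subseteq> Poly_Mapping.keys f" for K
    using that
  proof (induction K)
    case empty
    then show ?case using one_closed by (simp add: Env_zero free_alg_closed)
  next
    case (insert w K)
    then have w: "set w \<subseteq> carrier L" "env_class L (Poly_Mapping.single w 1) \<in> H" using gens by auto
    from smult_closed[OF _ w(2), of "Poly_Mapping.lookup f w"]
    have "env_class L (Poly_Mapping.single w (Poly_Mapping.lookup f w)) \<in> H"
      using w(1) by (simp add: Env_smult)
    then have "env_class L (Poly_Mapping.single w (Poly_Mapping.lookup f w)) \<oplus>\<^bsub>Env L\<^esub>
        env_class L (\<Sum>w\<in>K. Poly_Mapping.single w (Poly_Mapping.lookup f w)) \<in> H"
      using insert m_closed by simp
    then show ?case using insert w(1) by (simp add: Env_add free_alg_closed)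
  qed
  from this[of "Poly_Mapping.keys f"] show ?thesis by (simp flip: poly_mapping_sum_singles)
qed

lemma env_filt_eq: "env_filt L n = env_class L ` free_filt (Suc n)"
proof
  let ?G = "{word_prod (Env L) (env_gen L) w | w. set w \<subseteq> carrier L \<and> length w \<le> n}"
  let ?H = "env_class L ` free_filt (Suc n)"
  have "submodule ?H (ring_of_type_algebra :: 'k ring) (Env L)"
  proof (intro submodule.intro submodule_axioms.intro subgroup.intro)
    show "?H \<subseteq> carrier (add_monoid (Env L))" by (auto simp: carrier_Env free_filt_carrier)
    show "inv\<^bsub>add_monoid (Env L)\<^esub> C \<in> ?H" if C: "C \<in> ?H" for C
    proof -
      obtain f where f: "f \<in> free_filt (Suc n)" "C = env_class L f" using C by auto
      have "\<ominus>\<^bsub>Env L\<^esub> C = env_class L (- f)"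
        using f by (intro abelian_group.minus_equality[OF abelian_group_Env])
          (auto simp: carrier_Env Env_simps free_filt_carrier free_alg_closed)
      then show ?thesis using f by (auto simp: a_inv_def free_filt_uminus)
    qed
  qed (auto simp: Env_simps free_filt_carrier free_filt_add free_filt_zero free_filt_scale)
  moreover have "?G \<subseteq> ?H"
    by (auto simp: word_prod_Env less_Suc_eq_le intro!: imageI free_filt_single)
  ultimately show "env_filt L n \<subseteq> ?H" unfolding env_filt_def lin_span_def by blast
  show "?H \<subseteq> env_filt L n"
    unfolding env_filt_def lin_span_def
  proof clarify
    fix f H assume f: "f \<in> free_filt (Suc n)"
      and H: "submodule H (ring_of_type_algebra :: 'k ring) (Env L)" "?G \<subseteq> H"
    show "env_class L f \<in> H"
    proof (rule Env_submodule_lin_ext[OF H(1)])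
      fix w assume "w \<in> Poly_Mapping.keys f"
      then have w: "set w \<subseteq> carrier L" "length w \<le> n"
        using f by (auto simp: free_filt_def carrier_free_alg)
      then show "set w \<subseteq> carrier L \<and> env_class L (Poly_Mapping.single w 1) \<in> H"
        using H(2) word_prod_Env[OF w(1)] by force
    qed
  qed
qed

lemma env_filt_below_eq: "env_filt_below L n = env_class L ` free_filt n"
proof (cases n)
  case 0
  have "free_filt 0 = {0}"
    by (auto simp: free_filt_def free_alg_closed)
  with 0 show ?thesis by (simp add: env_filt_below_def Env_zero)
qed (simp add: env_filt_below_def env_filt_eq)

section \<open>The associated graded algebra\<close>

text \<open>
  The class modulo \<open>F (n - 1)\<close> of the image of \<open>f\<close> in the enveloping algebra. All operations of the
  associated graded algebra are computed on such representatives.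
\<close>

definition gr_class :: "nat \<Rightarrow> ('a list \<Rightarrow>\<^sub>0 'k) \<Rightarrow> ('a list \<Rightarrow>\<^sub>0 'k) set set" where
  "gr_class n f = env_filt_below L n +>\<^bsub>Env L\<^esub> env_class L f"

lemma gr_class_eq:
  assumes "f \<in> free_carrier"
  shows "gr_class n f = (\<lambda>g. env_class L (g + f)) ` free_filt n"
proof -
  have "gr_class n f = (\<lambda>g. env_class L g \<oplus>\<^bsub>Env L\<^esub> env_class L f) ` free_filt n"
    by (auto simp: gr_class_def env_filt_below_eq a_r_coset_def')
  also have "\<dots> = (\<lambda>g. env_class L (g + f)) ` free_filt n"
    by (rule image_cong) (auto simp: Env_add free_filt_carrier assms)
  finally show ?thesis .
qed

lemma gr_class_eqI:
  assumes f: "f \<in> free_carrier" and g: "g \<in> free_carrier"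
    and h: "h \<in> free_filt n" "f - g - h \<in> env_ideal L"
  shows "gr_class n f = gr_class n g"
proof -
  have sub: "(\<lambda>k. env_class L (k + f)) ` free_filt n \<subseteq> (\<lambda>k. env_class L (k + g)) ` free_filt n"
    if fgh: "f \<in> free_carrier" "g \<in> free_carrier" "h \<in> free_filt n" "f - g - h \<in> env_ideal L" for f g h
  proof
    fix C assume "C \<in> (\<lambda>k. env_class L (k + f)) ` free_filt n"
    then obtain k where k: "k \<in> free_filt n" "C = env_class L (k + f)" by auto
    have "env_class L (k + f) = env_class L ((k + h) + g)"
      using fgh k by (intro env_class_eqI) (auto simp: algebra_simps free_alg_closed free_filt_carrier)
    then show "C \<in> (\<lambda>k. env_class L (k + g)) ` free_filt n" using k fgh free_filt_add by blast
  qed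
  have "g - f - - h \<in> env_ideal L" using env_ideal_uminus[OF h(2)] by (simp add: algebra_simps)
  then show ?thesis
    unfolding gr_class_eq[OF f] gr_class_eq[OF g]
    using sub[OF f g h] sub[OF g f free_filt_uminus[OF h(1)]] by blast
qed

lemma gr_class_eqD:
  assumes "f \<in> free_carrier" "g \<in> free_carrier" "gr_class n f = gr_class n g"
  shows "\<exists>h\<in>free_filt n. f - g - h \<in> env_ideal L"
proof -
  have "env_class L (0 + f) \<in> gr_class n f" unfolding gr_class_eq[OF assms(1)] using free_filt_zero by blast
  then obtain h where "h \<in> free_filt n" "env_class L f = env_class L (h + g)"
    using assms by (auto simp: gr_class_eq)
  then show ?thesis
    using assms env_class_eq_iff[of f "h + g"]
    by (auto simp: free_filt_carrier free_alg_closed algebra_simps intro!: bexI[of _ h])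
qed

lemma carrier_gr_comp: "carrier (gr_comp L n) = gr_class n ` free_filt (Suc n)"
  by (force simp: gr_comp_def A_FactGroup_def FactGroup_def RCOSETS_def gr_class_def env_filt_eq
      a_r_coset_def r_coset_def)

lemma gr_comp_one: "\<one>\<^bsub>gr_comp L n\<^esub> = gr_class n 0"
  by (simp add: gr_comp_def A_FactGroup_def FactGroup_def gr_class_eq[OF free_alg_zero_closed] env_filt_below_eq)

lemma gr_comp_mult:
  assumes "f \<in> free_carrier" "g \<in> free_carrier"
  shows "gr_class n f \<otimes>\<^bsub>gr_comp L n\<^esub> gr_class n g = gr_class n (f + g)"
proof -
  have "gr_class n f \<otimes>\<^bsub>gr_comp L n\<^esub> gr_class n g
      = (\<Union>h\<in>free_filt n. \<Union>k\<in>free_filt n. {env_class L (h + f) \<oplus>\<^bsub>Env L\<^esub> env_class L (k + g)})"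
    using assms by (simp add: gr_comp_def A_FactGroup_def FactGroup_def set_mult_def gr_class_eq)
  also have "\<dots> = (\<Union>h\<in>free_filt n. \<Union>k\<in>free_filt n. {env_class L ((h + k) + (f + g))})"
    using assms by (intro SUP_cong refl) (simp add: Env_add free_filt_carrier free_alg_closed ac_simps)
  also have "\<dots> = (\<lambda>h. env_class L (h + (f + g))) ` free_filt n"
  proof (intro equalityI subsetI)
    fix C assume "C \<in> (\<lambda>h. env_class L (h + (f + g))) ` free_filt n"
    then obtain h where "h \<in> free_filt n" "C = env_class L ((h + 0) + (f + g))" by auto
    then show "C \<in> (\<Union>h\<in>free_filt n. \<Union>k\<in>free_filt n. {env_class L ((h + k) + (f + g))})"
      using free_filt_zero by blast
  next
    fix C assume "C \<in> (\<Union>h\<in>free_filt n. \<Union>k\<in>free_filt n. {env_class L ((h + k) + (f + g))})"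
    then show "C \<in> (\<lambda>h. env_class L (h + (f + g))) ` free_filt n"
      using free_filt_add by blast
  qed
  finally show ?thesis using assms by (simp add: gr_class_eq free_alg_closed)
qed

lemma gr_class_smult:
  assumes "f \<in> free_carrier"
  shows "(\<Union>C\<in>gr_class n f. env_filt_below L n +>\<^bsub>Env L\<^esub> (c \<odot>\<^bsub>Env L\<^esub> C)) = gr_class n (pm_scale c f)"
proof (rule SUP_eq_const)
  show "gr_class n f \<noteq> {}" using assms free_filt_zero by (auto simp: gr_class_eq)
  fix C assume "C \<in> gr_class n f"
  then obtain h where h: "h \<in> free_filt n" "C = env_class L (h + f)" using assms by (auto simp: gr_class_eq)
  then have "env_filt_below L n +>\<^bsub>Env L\<^esub> (c \<odot>\<^bsub>Env L\<^esub> C) = gr_class n (pm_scale c (h + f))"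
    using assms by (simp add: gr_class_def Env_smult free_filt_carrier free_alg_closed)
  also have "\<dots> = gr_class n (pm_scale c f)"
    using h assms
    by (intro gr_class_eqI[of _ _ "pm_scale c h"])
      (auto simp: free_filt_carrier free_alg_closed free_filt_scale pm.scale_right_distrib env_ideal_zero)
  finally show "env_filt_below L n +>\<^bsub>Env L\<^esub> (c \<odot>\<^bsub>Env L\<^esub> C) = gr_class n (pm_scale c f)" .
qed

lemma gr_class_rcoset_mult:
  assumes f: "f \<in> free_filt (Suc i)" and g: "g \<in> free_filt (Suc j)"
  shows "rcoset_mult (Env L) (env_filt_below L (i + j)) (gr_class i f) (gr_class j g)
    = gr_class (i + j) (f * g)"
proof -
  have fg: "f \<in> free_carrier" "g \<in> free_carrier" using f g by (auto simp: free_filt_carrier)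
  have *: "env_filt_below L (i + j) +>\<^bsub>Env L\<^esub> (C \<otimes>\<^bsub>Env L\<^esub> D) = gr_class (i + j) (f * g)"
    if CD: "C \<in> gr_class i f" "D \<in> gr_class j g" for C D
  proof -
    obtain h k where h: "h \<in> free_filt i" "C = env_class L (h + f)"
      and k: "k \<in> free_filt j" "D = env_class L (k + g)"
      using CD fg by (auto simp: gr_class_eq)
    have "env_filt_below L (i + j) +>\<^bsub>Env L\<^esub> (C \<otimes>\<^bsub>Env L\<^esub> D) = gr_class (i + j) ((h + f) * (k + g))"
      using h k fg by (simp add: gr_class_def Env_mult free_filt_carrier free_alg_closed)
    also have "\<dots> = gr_class (i + j) (f * g)"
    proof (rule gr_class_eqI)
      have "h * k \<in> free_filt (i + j)"
        using free_filt_mult(1)[of h i k j] h k by (meson free_filt_mono le_SucI order_refl)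
      moreover have "h * g \<in> free_filt (i + j)"
        using free_filt_mult(2)[of g j h i] h g by (simp add: add.commute)
      moreover have "f * k \<in> free_filt (i + j)" using free_filt_mult(1) f k by blast
      ultimately show "h * k + h * g + f * k \<in> free_filt (i + j)" by (intro free_filt_add)
      show "(h + f) * (k + g) - f * g - (h * k + h * g + f * k) \<in> env_ideal L"
        by (simp add: algebra_simps env_ideal_zero)
    qed (use h k fg in \<open>auto simp: free_filt_carrier free_alg_closed\<close>)
    finally show ?thesis .
  qed
  have ne: "gr_class i f \<noteq> {}" "gr_class j g \<noteq> {}"
    using fg free_filt_zero by (auto simp: gr_class_eq)
  have "(\<Union>D\<in>gr_class j g. env_filt_below L (i + j) +>\<^bsub>Env L\<^esub> (C \<otimes>\<^bsub>Env L\<^esub> D)) = gr_class (i + j) (f * g)"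
    if "C \<in> gr_class i f" for C
    using ne(2) *[OF that] by (rule SUP_eq_const)
  with ne(1) show ?thesis unfolding rcoset_mult_def by (rule SUP_eq_const)
qed

lemma comm_monoid_gr_comp: "comm_monoid (gr_comp L n)"
  by (rule comm_monoidI)
    (auto simp: carrier_gr_comp gr_comp_one gr_comp_mult free_filt_carrier free_alg_closed free_filt_add
      free_filt_zero ac_simps)

lemma gr_comp_finprod:
  assumes "finite I" "\<And>i. i \<in> I \<Longrightarrow> f i \<in> free_filt (Suc n)"
  shows "(\<Otimes>\<^bsub>gr_comp L n\<^esub>i\<in>I. gr_class n (f i)) = gr_class n (\<Sum>i\<in>I. f i)"
proof -
  interpret comm_monoid "gr_comp L n" by (rule comm_monoid_gr_comp)
  show ?thesis
    using assms
  proof (induction I)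
    case (insert i I)
    have "sum f I \<in> free_filt (Suc n)" using insert by (intro free_filt_sum) auto
    then have "gr_class n (f i) \<otimes>\<^bsub>gr_comp L n\<^esub> gr_class n (sum f I) = gr_class n (f i + sum f I)"
      using insert.prems free_filt_carrier by (intro gr_comp_mult) blast+
    with insert show ?case
      by (subst finprod_insert) (auto simp: carrier_gr_comp)
  qed (simp add: gr_comp_one)
qed

lemma homog_carrier: "f \<in> free_carrier \<Longrightarrow> homog n f \<in> free_carrier"
  by (simp add: carrier_free_alg keys_homog)

lemma homog_filt: "f \<in> free_carrier \<Longrightarrow> homog n f \<in> free_filt (Suc n)"
  by (simp add: free_filt_def homog_carrier keys_homog)

text \<open>
  The map from the free algebra onto the associated graded algebra that underlies \<open>\<pi>\<close>.
\<close>

definition gr_symbol :: "('a list \<Rightarrow>\<^sub>0 'k) \<Rightarrow> nat \<Rightarrow> ('a list \<Rightarrow>\<^sub>0 'k) set set" where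
  "gr_symbol f = (\<lambda>n. gr_class n (homog n f))"

lemma Gr_add: "f \<in> free_carrier \<Longrightarrow> g \<in> free_carrier \<Longrightarrow>
    gr_symbol f \<oplus>\<^bsub>Gr L\<^esub> gr_symbol g = gr_symbol (f + g)"
  by (simp add: Gr_def gr_symbol_def gr_comp_mult homog_carrier pm_linear_add)

lemma Gr_zero: "\<zero>\<^bsub>Gr L\<^esub> = gr_symbol 0"
  by (simp add: Gr_def gr_symbol_def gr_comp_one pm_linear_zero)

lemma Gr_one: "\<one>\<^bsub>Gr L\<^esub> = gr_symbol 1"
  by (rule ext) (simp add: Gr_def gr_symbol_def gr_comp_one Env_one one_list_algebra gr_class_def[of 0])

lemma Gr_smult: "f \<in> free_carrier \<Longrightarrow> c \<odot>\<^bsub>Gr L\<^esub> gr_symbol f = gr_symbol (pm_scale c f)"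
  by (simp add: Gr_def gr_symbol_def gr_class_smult homog_carrier pm_linear_scale)

lemma Gr_mult:
  assumes "f \<in> free_carrier" "g \<in> free_carrier"
  shows "gr_symbol f \<otimes>\<^bsub>Gr L\<^esub> gr_symbol g = gr_symbol (f * g)"
proof
  fix n
  have filt: "homog i f * homog (n - i) g \<in> free_filt (Suc n)" if "i \<le> n" for i
    using free_filt_mult(1)[of "homog i f" i "homog (n - i) g" "Suc (n - i)"] assms that
    by (simp add: homog_filt)
  interpret comm_monoid "gr_comp L n" by (rule comm_monoid_gr_comp)
  have "(gr_symbol f \<otimes>\<^bsub>Gr L\<^esub> gr_symbol g) n
      = (\<Otimes>\<^bsub>gr_comp L n\<^esub>i\<in>{..n}. rcoset_mult (Env L) (env_filt_below L n)
          (gr_class i (homog i f)) (gr_class (n - i) (homog (n - i) g)))"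
    by (simp add: Gr_def gr_symbol_def)
  also have "\<dots> = (\<Otimes>\<^bsub>gr_comp L n\<^esub>i\<in>{..n}. gr_class n (homog i f * homog (n - i) g))"
  proof (rule finprod_cong')
    fix i assume i: "i \<in> {..n}"
    then show "rcoset_mult (Env L) (env_filt_below L n) (gr_class i (homog i f))
        (gr_class (n - i) (homog (n - i) g)) = gr_class n (homog i f * homog (n - i) g)"
      using gr_class_rcoset_mult[OF homog_filt homog_filt, OF assms, of i "n - i"] by simp
  qed (use filt in \<open>auto simp: carrier_gr_comp\<close>)
  also have "\<dots> = gr_class n (homog n (f * g))"
    unfolding homog_mult using filt by (intro gr_comp_finprod) auto
  finally show "(gr_symbol f \<otimes>\<^bsub>Gr L\<^esub> gr_symbol g) n = gr_symbol (f * g) n"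
    by (simp add: gr_symbol_def)
qed

lemma gr_symbol_carrier:
  assumes f: "f \<in> free_carrier"
  shows "gr_symbol f \<in> carrier (Gr L)"
proof -
  obtain N where N: "\<forall>w\<in>Poly_Mapping.keys f. length w < N" using ex_length_bound by blast
  have "homog n f = 0" if "n \<ge> N" for n
    using N that by (intro poly_mapping_eqI) (force simp: lookup_homog in_keys_iff)
  then have "{n. gr_symbol f n \<noteq> \<one>\<^bsub>gr_comp L n\<^esub>} \<subseteq> {..<N}"
    by (auto simp: gr_symbol_def gr_comp_one not_le[symmetric])
  then have "finite {n. gr_symbol f n \<noteq> \<one>\<^bsub>gr_comp L n\<^esub>}" by (rule finite_subset) simp
  then show ?thesis
    using f by (auto simp: Gr_def carrier_gr_comp homog_filt gr_symbol_def)
qed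

text \<open>
  Surjectivity of \<open>\<pi>\<close>: in each of the finitely many relevant degrees a class has a representative in
  the free algebra, whose top homogeneous component represents it as well.
\<close>

lemma carrier_Gr: "carrier (Gr L) = gr_symbol ` free_carrier"
proof
  show "gr_symbol ` free_carrier \<subseteq> carrier (Gr L)" using gr_symbol_carrier by auto
  show "carrier (Gr L) \<subseteq> gr_symbol ` free_carrier"
  proof
    fix g assume g: "g \<in> carrier (Gr L)"
    define N where "N = {n. g n \<noteq> \<one>\<^bsub>gr_comp L n\<^esub>}"
    have fin: "finite N" using g by (simp add: Gr_def N_def)
    have "\<forall>n. \<exists>f. f \<in> free_filt (Suc n) \<and> g n = gr_class n f"
      using g by (auto simp: Gr_def carrier_gr_comp)
    then obtain f where f: "\<And>n. f n \<in> free_filt (Suc n)" "\<And>n. g n = gr_class n (f n)" by metis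
    define F where "F = (\<Sum>n\<in>N. homog n (f n))"
    have f_carrier: "f n \<in> free_carrier" for n using f(1) by (rule free_filt_carrier)
    have "(\<Sum>n\<in>M. homog n (f n)) \<in> free_carrier" if "finite M" for M
      using that by (induction M) (simp_all add: free_alg_closed homog_carrier f_carrier)
    then have F: "F \<in> free_carrier" using fin by (simp add: F_def)
    have "g n = gr_symbol F n" for n
    proof (cases "n \<in> N")
      case True
      then have "homog n F = homog n (f n)"
        using fin by (simp add: F_def pm_linear_sum homog_homog)
      moreover have "gr_class n (f n) = gr_class n (homog n (f n))"
      proof (rule gr_class_eqI)
        have "length w < n" if "w \<in> Poly_Mapping.keys (f n - homog n (f n))" for w
        proof -
          have "w \<in> Poly_Mapping.keys (f n)" "length w \<noteq> n"
            using that by (auto simp: in_keys_iff lookup_minus lookup_homog split: if_splits)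
          then show ?thesis using f(1)[of n] by (force simp: free_filt_def)
        qed
        then show "f n - homog n (f n) \<in> free_filt n"
          using f(1)[of n] by (simp add: free_filt_def homog_carrier free_alg_closed)
      qed (simp_all add: f_carrier homog_carrier env_ideal_zero)
      ultimately show ?thesis by (simp add: f gr_symbol_def)
    next
      case False
      then have "homog n F = 0"
        by (auto simp: F_def pm_linear_sum homog_homog intro!: sum.neutral)
      with False show ?thesis by (simp add: N_def gr_symbol_def gr_comp_one)
    qed
    then show "g \<in> gr_symbol ` free_carrier" using F by blast
  qed
qed

lemma abelian_monoid_Gr: "abelian_monoid (Gr L)"
proof (rule abelian_monoidI)
  fix C D assume "C \<in> carrier (Gr L)" "D \<in> carrier (Gr L)"
  then show "C \<oplus>\<^bsub>Gr L\<^esub> D = D \<oplus>\<^bsub>Gr L\<^esub> C" by (auto simp: carrier_Gr Gr_add add.commute)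
qed (auto simp: carrier_Gr Gr_add Gr_zero free_alg_closed add.assoc)

lemma gr_gen_eq: "gr_gen L x = gr_symbol (free_gen x)"
  by (rule ext) (simp add: gr_gen_def gr_symbol_def free_gen_def gr_comp_one env_gen_eq gr_class_def[of "Suc 0"])

lemma gr_symbol_eq_zero_iff:
  assumes "f \<in> free_carrier"
  shows "gr_symbol f = gr_symbol 0 \<longleftrightarrow> (\<forall>n. \<exists>h\<in>free_filt n. homog n f - h \<in> env_ideal L)"
proof
  assume "gr_symbol f = gr_symbol 0"
  then have "gr_class n (homog n f) = gr_class n 0" for n
    by (metis gr_symbol_def pm_linear_zero homog_linear)
  then show "\<forall>n. \<exists>h\<in>free_filt n. homog n f - h \<in> env_ideal L"
    using gr_class_eqD[of "homog n f" 0 n for n] assms by (auto simp: homog_carrier free_alg_closed)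
next
  assume *: "\<forall>n. \<exists>h\<in>free_filt n. homog n f - h \<in> env_ideal L"
  show "gr_symbol f = gr_symbol 0"
  proof
    fix n
    obtain h where "h \<in> free_filt n" "homog n f - h \<in> env_ideal L" using * by blast
    then show "gr_symbol f n = gr_symbol 0 n"
      using assms gr_class_eqI[of "homog n f" 0 h n]
      by (simp add: gr_symbol_def pm_linear_zero homog_carrier free_alg_closed)
  qed
qed

lemma gr_symbol_linear_relation:
  assumes r: "r \<in> env_ideal L" and deg: "\<And>n. homog n r = (if n = 1 then r else 0)"
  shows "r \<in> free_carrier \<and> gr_symbol r = gr_symbol 0"
proof -
  have "homog n r - 0 \<in> env_ideal L" for n unfolding deg using r env_ideal_zero by simp
  then have "\<exists>h\<in>free_filt n. homog n r - h \<in> env_ideal L" for n using free_filt_zero by blast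
  then show ?thesis using gr_symbol_eq_zero_iff[of r] env_ideal_carrier[OF r] by blast
qed

text \<open>
  The relations of \<open>U(Ab L)\<close> hold in the associated graded algebra: a commutator of two letters is
  the letter of their bracket modulo the ideal of \<open>U(L)\<close>, hence of lower degree.
\<close>

lemma gr_symbol_env_ideal_Ab:
  assumes "f \<in> env_ideal (Ab L)"
  shows "f \<in> free_carrier \<and> gr_symbol f = gr_symbol 0"
  using assms
proof (induction rule: lie_algebra.env_ideal_induct[OF lie_algebra_Ab,
    consumes 1, case_names gen_add gen_scale gen_lie zero add mult_left mult_right])
  case (gen_add x y)
  let ?r = "free_gen (x \<oplus> y) - (free_gen x + free_gen y)"
  have r: "?r \<in> env_ideal L" using gen_add by (intro env_ideal_gen_add) auto
  have "homog n ?r = (if n = 1 then ?r else 0)" for n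
    by (simp add: free_gen_def pm_linear_diff pm_linear_add)
  from gr_symbol_linear_relation[OF r this] show ?case by simp
next
  case (gen_scale c x)
  let ?r = "free_gen (c \<odot> x) - pm_scale c (free_gen x)"
  have r: "?r \<in> env_ideal L" using gen_scale by (intro env_ideal_gen_scale) auto
  have "homog n ?r = (if n = 1 then ?r else 0)" for n
    by (simp add: free_gen_def pm_linear_diff)
  from gr_symbol_linear_relation[OF r this] show ?case by simp
next
  case (gen_lie x y)
  let ?c = "free_gen x * free_gen y - free_gen y * free_gen x"
  have xy: "x \<in> carrier L" "y \<in> carrier L" using gen_lie by auto
  have zero: "- free_gen \<zero> \<in> env_ideal L"
    using env_ideal_gen_add[of \<zero> \<zero>] by simp
  have carr: "?c - free_gen \<zero> \<in> free_carrier" using xy by (auto intro!: free_alg_closed)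
  have "homog n (?c - free_gen \<zero>) = (if n = 2 then ?c else if n = 1 then - free_gen \<zero> else 0)" for n
    by (auto simp: free_gen_def mult_single plus_list_def pm_linear_diff)
  note deg = this
  have "\<exists>h\<in>free_filt n. homog n (?c - free_gen \<zero>) - h \<in> env_ideal L" for n
  proof (cases "n = 2")
    case True
    show ?thesis
    proof
      show "homog n (?c - free_gen \<zero>) - free_gen (lie L x y) \<in> env_ideal L"
        unfolding deg using True env_ideal_gen_lie[OF xy] by simp
      show "free_gen (lie L x y) \<in> free_filt n"
        using xy True by (auto simp: free_gen_def lie_closed intro!: free_filt_single)
    qed
  next
    case False
    then have "homog n (?c - free_gen \<zero>) - 0 \<in> env_ideal L"
      unfolding deg using zero env_ideal_zero by simp
    then show ?thesis using free_filt_zero by blast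
  qed
  with carr show ?case by (simp add: gr_symbol_eq_zero_iff)
next
  case zero
  then show ?case by (simp add: free_alg_closed)
next
  case (add f g)
  then show ?case
    using Gr_add[of f g] Gr_add[of 0 0] by (simp add: free_alg_closed)
next
  case (mult_left f g)
  then show ?case
    using Gr_mult[of g f] Gr_mult[of g 0] by (simp add: free_alg_closed)
next
  case (mult_right f g)
  then show ?case
    using Gr_mult[of f g] Gr_mult[of 0 g] by (simp add: free_alg_closed)
qed

lemma gr_symbol_cong:
  assumes "f - g \<in> env_ideal (Ab L)" "g \<in> free_carrier"
  shows "gr_symbol f = gr_symbol g"
proof -
  have "f - g \<in> free_carrier" "gr_symbol (f - g) = gr_symbol 0"
    using gr_symbol_env_ideal_Ab[OF assms(1)] by auto
  then show ?thesis
    using Gr_add[of "f - g" g] Gr_add[of 0 g] assms(2) by (simp add: free_alg_closed)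
qed

lemma free_lift_Gr: "f \<in> free_carrier \<Longrightarrow> free_lift (Gr L) (gr_gen L) f = gr_symbol f"
  by (rule free_lift_eq_hom[OF abelian_monoid_Gr])
    (auto simp: Gr_add Gr_zero Gr_mult Gr_one Gr_smult gr_symbol_carrier gr_gen_eq)

lemma pbw_map_class:
  assumes f: "f \<in> free_carrier"
  shows "pbw_map L (env_class (Ab L) f) = gr_symbol f"
proof -
  interpret Ab: lie_algebra "Ab L" by (rule lie_algebra_Ab)
  have "free_lift (Gr L) (gr_gen L) g = gr_symbol f" if "g \<in> env_class (Ab L) f" for g
  proof -
    have gf: "g - f \<in> env_ideal (Ab L)" using that by (simp add: Ab.mem_env_class)
    then have "(g - f) + f \<in> free_carrier"
      using Ab.env_ideal_carrier[OF gf] f by (intro free_alg_add_closed) auto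
    then show ?thesis using gr_symbol_cong[OF gf f] by (simp add: free_lift_Gr)
  qed
  moreover have "f \<in> env_class (Ab L) f" by (simp add: Ab.mem_env_class Ab.env_ideal_zero)
  ultimately have "free_lift (Gr L) (gr_gen L) ` env_class (Ab L) f = {gr_symbol f}" by auto
  then show ?thesis by (simp add: pbw_map_def env_lift_def)
qed

text \<open>
  Injectivity of \<open>\<pi>\<close>: each homogeneous component of \<open>f - g\<close> is a leading term that vanishes in
  \<open>U(L)\<close>.
\<close>

lemma gr_symbol_inj:
  assumes f: "f \<in> free_carrier" and g: "g \<in> free_carrier" and eq: "gr_symbol f = gr_symbol g"
  shows "f - g \<in> env_ideal (Ab L)"
proof -
  have fg: "f - g \<in> free_carrier" using f g by (rule free_alg_diff_closed)
  have "gr_symbol (f - g) = gr_symbol (g - g)"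
    using Gr_add[OF f free_alg_uminus_closed[OF g]] Gr_add[OF g free_alg_uminus_closed[OF g]] eq
    by simp
  then have *: "\<exists>h\<in>free_filt n. homog n (f - g) - h \<in> env_ideal L" for n
    using gr_symbol_eq_zero_iff[OF fg] by simp
  obtain coord where "lie_section L coord" using ex_lie_section by blast
  then interpret lie_section L coord .
  have 0: "symbol (homog n (f - g)) = 0" for n
  proof -
    obtain h where "h \<in> free_filt n" "homog n (f - g) - h \<in> env_ideal L" using * by blast
    then show ?thesis
      by (intro symbol_leading_zero[of _ n h])
        (auto simp: keys_homog free_filt_def intro!: homog_carrier fg)
  qed
  obtain N where "\<forall>w\<in>Poly_Mapping.keys (f - g). length w < N" using ex_length_bound by blast
  then have "f - g = (\<Sum>n<N. homog n (f - g))" by (intro sum_homog) auto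
  then have "symbol (f - g) = (\<Sum>n<N. symbol (homog n (f - g)))"
    using pm_linear_sum[OF symbol_linear] by metis
  then show ?thesis using env_ideal_Ab_iff[OF fg] by (simp add: 0)
qed

theorem pbw_map_iso: "pbw_map L \<in> alg_iso (Env (Ab L)) (Gr L)"
proof -
  interpret Ab: lie_algebra "Ab L" by (rule lie_algebra_Ab)
  have carr: "carrier (Env (Ab L)) = env_class (Ab L) ` free_carrier"
    by (simp add: Ab.carrier_Env)
  have "pbw_map L \<in> ring_hom (Env (Ab L)) (Gr L)"
    by (rule ring_hom_memI)
      (auto simp: carr Ab.Env_simps pbw_map_class gr_symbol_carrier Gr_mult Gr_add Gr_one free_alg_closed)
  moreover have "inj_on (pbw_map L) (carrier (Env (Ab L)))"
  proof (rule inj_onI)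
    fix C D assume "C \<in> carrier (Env (Ab L))" "D \<in> carrier (Env (Ab L))" and eq: "pbw_map L C = pbw_map L D"
    then obtain f g where f: "f \<in> free_carrier" "C = env_class (Ab L) f"
      and g: "g \<in> free_carrier" "D = env_class (Ab L) g" by (auto simp: carr)
    then have "f - g \<in> env_ideal (Ab L)" using eq by (intro gr_symbol_inj) (simp_all add: pbw_map_class)
    then show "C = D" using f g by (simp add: Ab.env_class_eqI)
  qed
  moreover have "pbw_map L ` carrier (Env (Ab L)) = carrier (Gr L)"
    by (auto simp: carr carrier_Gr pbw_map_class image_image cong: image_cong)
  ultimately show ?thesis
    by (auto simp: alg_iso_def alg_hom_def bij_betw_def carr Ab.Env_smult pbw_map_class Gr_smult free_alg_closed)
qed

end

section \<open>Functoriality of the enveloping algebra\<close>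

lemma prod_list_free_alg_closed:
  "(\<And>g. g \<in> set gs \<Longrightarrow> g \<in> carrier (free_alg T)) \<Longrightarrow> prod_list gs \<in> carrier (free_alg T)"
  by (induction gs) (auto intro: free_alg_closed)

lemma subst_closed:
  assumes "f \<in> carrier (free_alg S)" "\<And>x. x \<in> S \<Longrightarrow> \<theta> x \<in> carrier (free_alg T)"
  shows "subst \<theta> f \<in> carrier (free_alg T)"
  unfolding subst_def
proof (rule free_alg_lin_ext_closed, rule prod_list_free_alg_closed)
  fix w g assume "w \<in> Poly_Mapping.keys f" "g \<in> set (map \<theta> w)"
  then show "g \<in> carrier (free_alg T)" using assms by (force simp: carrier_free_alg)
qed

lemma subst_prod_list: "subst \<theta> (prod_list gs) = prod_list (map (subst \<theta>) gs)"
  by (induction gs) (simp_all add: subst_mult)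

lemma subst_subst: "subst \<theta> (subst \<theta>' f) = subst (\<lambda>x. subst \<theta> (\<theta>' x)) f"
  by (rule pm_linear_eqI[where h = "\<lambda>f. subst \<theta> (subst \<theta>' f)"])
    (auto intro!: pm_linear_comp[OF pm_linear_subst pm_linear_subst] simp: subst_single subst_prod_list o_def)

lemma subst_power: "subst \<theta> (f ^ n) = subst \<theta> f ^ n"
  by (induction n) (simp_all add: subst_mult)

lemma free_alg_power_closed: "f \<in> carrier (free_alg S) \<Longrightarrow> f ^ n \<in> carrier (free_alg S)"
  by (induction n) (auto intro: free_alg_closed)

lemma (in lie_algebra) subst_env_ideal:
  fixes \<theta> :: "'a \<Rightarrow> ('m::monoid_add \<Rightarrow>\<^sub>0 'k)"
  assumes "\<And>x y. x \<in> carrier L \<Longrightarrow> y \<in> carrier L \<Longrightarrow> \<theta> (x \<oplus> y) = \<theta> x + \<theta> y"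
    and "\<And>c x. x \<in> carrier L \<Longrightarrow> \<theta> (c \<odot> x) = pm_scale c (\<theta> x)"
    and "\<And>x y. x \<in> carrier L \<Longrightarrow> y \<in> carrier L \<Longrightarrow> \<theta> x * \<theta> y - \<theta> y * \<theta> x = \<theta> (lie L x y)"
    and "f \<in> env_ideal L"
  shows "subst \<theta> f = 0"
  using assms(4)
  by (induction rule: env_ideal_induct)
    (simp_all add: assms(1-3) pm_linear_diff pm_linear_add pm_linear_scale pm_linear_zero subst_mult)

lemma lie_hom_zero:
  assumes L: "lie_algebra L" and M: "lie_algebra M" and f: "f \<in> lie_hom L M"
  shows "f \<zero>\<^bsub>L\<^esub> = \<zero>\<^bsub>M\<^esub>"
proof -
  interpret L: lie_algebra L by fact
  interpret M: lie_algebra M by fact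
  have "f (\<zero>\<^bsub>L\<^esub> \<oplus>\<^bsub>L\<^esub> \<zero>\<^bsub>L\<^esub>) = f \<zero>\<^bsub>L\<^esub> \<oplus>\<^bsub>M\<^esub> f \<zero>\<^bsub>L\<^esub>" "f \<zero>\<^bsub>L\<^esub> \<in> carrier M"
    using f by (auto simp: lie_hom_def simp del: L.M.l_zero L.M.r_zero)
  then show ?thesis by simp
qed

lemma lie_hom_Ab: "lie_algebra L \<Longrightarrow> lie_algebra M \<Longrightarrow> f \<in> lie_hom L M \<Longrightarrow> f \<in> lie_hom (Ab L) (Ab M)"
  using lie_hom_zero[of L M f] by (auto simp: lie_hom_def)

lemma Env_map_class:
  assumes L: "lie_algebra L" and M: "lie_algebra M" and f: "f \<in> lie_hom L M"
    and g: "g \<in> carrier (free_alg (carrier L))"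
  shows "Env_map M f (env_class L g) = env_class M (subst (\<lambda>x. free_gen (f x)) g)"
proof -
  interpret L: lie_algebra L by fact
  interpret M: lie_algebra M by fact
  let ?s = "subst (\<lambda>x. free_gen (f x))"
  have f_carrier: "f x \<in> carrier M" if "x \<in> carrier L" for x using f that by (auto simp: lie_hom_def)
  have closed: "?s h \<in> M.free_carrier" if "h \<in> L.free_carrier" for h
    using that by (rule subst_closed) (simp add: f_carrier free_alg_closed)
  have ideal: "h \<in> L.free_carrier \<and> ?s h \<in> env_ideal M" if "h \<in> env_ideal L" for h
    using that
  proof (induction rule: L.env_ideal_induct)
    case (gen_add x y)
    then show ?case
      using M.env_ideal_gen_add[of "f x" "f y"] f
      by (auto simp: pm_linear_diff pm_linear_add f_carrier lie_hom_def intro!: free_alg_closed)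
  next
    case (gen_scale c x)
    then show ?case
      using M.env_ideal_gen_scale[of "f x" c] f
      by (auto simp: pm_linear_diff pm_linear_scale f_carrier lie_hom_def intro!: free_alg_closed)
  next
    case (gen_lie x y)
    then show ?case
      using M.env_ideal_gen_lie[of "f x" "f y"] f
      by (auto simp: pm_linear_diff subst_mult f_carrier lie_hom_def L.lie_closed intro!: free_alg_closed)
  qed (auto simp: pm_linear_zero pm_linear_add subst_mult M.env_ideal_zero M.env_ideal_add closed
      free_alg_closed intro: M.env_ideal_mult_left M.env_ideal_mult_right)
  have lift: "free_lift (Env M) (\<lambda>x. env_gen M (f x)) h = env_class M (?s h)" if "h \<in> L.free_carrier" for h
    using abelian_group.axioms(1)[OF M.abelian_group_Env] _ _ _ _ _ _ _ that
    by (rule free_lift_eq_hom)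
      (auto simp: M.carrier_Env M.Env_simps closed pm_linear_add pm_linear_zero pm_linear_scale
        subst_mult env_gen_eq)
  have "free_lift (Env M) (\<lambda>x. env_gen M (f x)) h = env_class M (?s g)" if "h \<in> env_class L g" for h
  proof -
    have hg: "h - g \<in> env_ideal L" using that by (simp add: L.mem_env_class)
    then have "(h - g) + g \<in> L.free_carrier" using ideal g by (intro free_alg_add_closed) auto
    moreover have "?s h - ?s g \<in> env_ideal M" using ideal[OF hg] by (simp add: pm_linear_diff)
    ultimately show ?thesis using lift[of h] M.env_class_eqI closed[OF g] by simp
  qed
  moreover have "g \<in> env_class L g" by (simp add: L.mem_env_class L.env_ideal_zero)
  ultimately have "free_lift (Env M) (\<lambda>x. env_gen M (f x)) ` env_class L g = {env_class M (?s g)}" by auto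
  then show ?thesis by (simp add: Env_map_def env_lift_def)
qed

section \<open>Commutator Lie algebras\<close>

text \<open>
  The commutator Lie algebra of a subspace \<open>V\<close> of a monoid algebra, transported along an injection
  \<open>e\<close> into the type of the carrier.
\<close>

definition comm_lie :: "(('w::monoid_add \<Rightarrow>\<^sub>0 'k::field) \<Rightarrow> 'b) \<Rightarrow> ('w \<Rightarrow>\<^sub>0 'k) set \<Rightarrow> ('k, 'b) lie_ring" where
  "comm_lie e V = \<lparr>carrier = e ` V, monoid.mult = undefined, one = undefined, ring.zero = e 0,
     ring.add = (\<lambda>x y. e (inv_into UNIV e x + inv_into UNIV e y)), module.smult = (\<lambda>c x. e (pm_scale c (inv_into UNIV e x))),
     lie = (\<lambda>x y. e (inv_into UNIV e x * inv_into UNIV e y - inv_into UNIV e y * inv_into UNIV e x))\<rparr>"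

lemma comm_lie_simps [simp]:
  "carrier (comm_lie e V) = e ` V"
  "\<zero>\<^bsub>comm_lie e V\<^esub> = e 0"
  "inj e \<Longrightarrow> e u \<oplus>\<^bsub>comm_lie e V\<^esub> e v = e (u + v)"
  "inj e \<Longrightarrow> c \<odot>\<^bsub>comm_lie e V\<^esub> e u = e (pm_scale c u)"
  "inj e \<Longrightarrow> lie (comm_lie e V) (e u) (e v) = e (u * v - v * u)"
  by (simp_all add: comm_lie_def)

lemma lie_algebra_comm_lie:
  fixes e :: "('w::monoid_add \<Rightarrow>\<^sub>0 'k::field) \<Rightarrow> 'b"
  assumes e: "inj e" and V: "pm.subspace V" "\<And>u v. u \<in> V \<Longrightarrow> v \<in> V \<Longrightarrow> u * v - v * u \<in> V"
  shows "lie_algebra (comm_lie e V)"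
proof (intro lie_algebra.intro lie_algebra_axioms.intro)
  have V': "0 \<in> V" "u \<in> V \<Longrightarrow> v \<in> V \<Longrightarrow> u + v \<in> V" "u \<in> V \<Longrightarrow> pm_scale c u \<in> V" for u v c
    using V(1) by (auto simp: pm.subspace_def)
  have neg: "- u \<in> V" if "u \<in> V" for u using V'(3)[OF that, of "- 1"] by simp
  have "abelian_group (comm_lie e V)"
  proof (rule abelian_groupI)
    fix x assume "x \<in> carrier (comm_lie e V)"
    then obtain u where u: "u \<in> V" "x = e u" by auto
    then have "e (- u) \<in> carrier (comm_lie e V)" "e (- u) \<oplus>\<^bsub>comm_lie e V\<^esub> x = \<zero>\<^bsub>comm_lie e V\<^esub>"
      using neg e by simp_all
    then show "\<exists>y\<in>carrier (comm_lie e V). y \<oplus>\<^bsub>comm_lie e V\<^esub> x = \<zero>\<^bsub>comm_lie e V\<^esub>" by blast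
  next
    fix x y assume "x \<in> carrier (comm_lie e V)" "y \<in> carrier (comm_lie e V)"
    then show "x \<oplus>\<^bsub>comm_lie e V\<^esub> y = y \<oplus>\<^bsub>comm_lie e V\<^esub> x" using e by (auto simp: add.commute)
  qed (use e V' in \<open>auto simp: add.assoc\<close>)
  then show "Module.module (ring_of_type_algebra :: 'k ring) (comm_lie e V)"
    using e V'
    by (intro moduleI cring_from_type_algebra)
      (auto simp: ring_of_type_algebra_def pm.scale_left_distrib pm.scale_right_distrib)
  fix x y z c assume x: "x \<in> carrier (comm_lie e V)" and y: "y \<in> carrier (comm_lie e V)"
  then show "lie (comm_lie e V) x y \<in> carrier (comm_lie e V)"
    using e V(2) by auto
  show "lie (comm_lie e V) x x = \<zero>\<^bsub>comm_lie e V\<^esub>" using x e by auto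
  show "lie (comm_lie e V) (c \<odot>\<^bsub>comm_lie e V\<^esub> x) y = c \<odot>\<^bsub>comm_lie e V\<^esub> lie (comm_lie e V) x y"
    "lie (comm_lie e V) x (c \<odot>\<^bsub>comm_lie e V\<^esub> y) = c \<odot>\<^bsub>comm_lie e V\<^esub> lie (comm_lie e V) x y"
    using x y e by (auto simp: pm_scale_mult_left pm_scale_mult_right pm.scale_right_diff_distrib)
  assume z: "z \<in> carrier (comm_lie e V)"
  obtain u v w where uvw: "x = e u" "y = e v" "z = e w" using x y z by auto
  show "lie (comm_lie e V) (x \<oplus>\<^bsub>comm_lie e V\<^esub> y) z
      = lie (comm_lie e V) x z \<oplus>\<^bsub>comm_lie e V\<^esub> lie (comm_lie e V) y z"
    "lie (comm_lie e V) x (y \<oplus>\<^bsub>comm_lie e V\<^esub> z)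
      = lie (comm_lie e V) x y \<oplus>\<^bsub>comm_lie e V\<^esub> lie (comm_lie e V) x z"
    "lie (comm_lie e V) x (lie (comm_lie e V) y z) \<oplus>\<^bsub>comm_lie e V\<^esub>
      lie (comm_lie e V) y (lie (comm_lie e V) z x) \<oplus>\<^bsub>comm_lie e V\<^esub>
      lie (comm_lie e V) z (lie (comm_lie e V) x y) = \<zero>\<^bsub>comm_lie e V\<^esub>"
    using e by (simp_all add: uvw algebra_simps)
qed

text \<open>
  An infinite type absorbs pairs, so lists can be coded by iterated pairing.
\<close>

lemma ex_inj_list:
  assumes "infinite (UNIV :: 'b set)"
  shows "\<exists>h :: 'b list \<Rightarrow> 'b. inj h"
proof -
  have "|UNIV \<times> UNIV :: ('b \<times> 'b) set| =o |UNIV :: 'b set|"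
    using card_of_Times_same_infinite[OF assms] by simp
  then obtain pr :: "'b \<times> 'b \<Rightarrow> 'b" where pr: "inj pr"
    by (auto simp: card_of_ordIso[symmetric] bij_betw_def)
  obtain s :: "nat \<Rightarrow> 'b" where s: "inj s" using infinite_countable_subset[OF assms] by auto
  \<comment> \<open>an injective self-map missing a point, so that this point can code the empty list\<close>
  define sh where "sh x = (if x \<in> range s then s (Suc (inv_into UNIV s x)) else x)" for x
  have sh: "inj sh" "s 0 \<notin> range sh"
    using s by (auto intro!: injI simp: sh_def inj_eq[OF s] split: if_splits)
  define h where "h = rec_list (s 0) (\<lambda>x xs r. sh (pr (x, r)))"
  have h: "h [] = s 0" "h (x # xs) = sh (pr (x, h xs))" for x xs by (simp_all add: h_def)
  have "xs = ys" if "h xs = h ys" for xs ys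
    using that
  proof (induction xs arbitrary: ys)
    case Nil
    then show ?case using sh(2) by (cases ys) (auto simp: h)
  next
    case (Cons x xs)
    show ?case
    proof (cases ys)
      case Nil
      then show ?thesis using Cons.prems sh(2) by (metis h rangeI)
    next
      case (Cons y ys')
      then have "(x, h xs) = (y, h ys')"
        using Cons.prems by (simp add: h(2) inj_eq[OF sh(1)] inj_eq[OF pr])
      then show ?thesis using Cons Cons.IH by simp
    qed
  qed
  then show ?thesis by (auto simp: inj_def)
qed

text \<open>
  An element of the free algebra is coded by a list of the pairs of a word and its coefficient.
\<close>

lemma ex_inj_free_algebra:
  assumes inf: "infinite (UNIV :: 'b set)" and e: "inj (e :: 'k::field \<Rightarrow> 'b)"
  shows "\<exists>h :: (bool list \<Rightarrow>\<^sub>0 'k) \<Rightarrow> 'b. inj h"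
proof -
  obtain hl :: "'b list \<Rightarrow> 'b" where hl: "inj hl" using ex_inj_list[OF inf] by blast
  have e01: "e 0 \<noteq> e 1" using e by (auto dest: injD)
  define code where "code w c = hl [hl (map (\<lambda>b. if b then e 0 else e 1) w), e c]" for w c
  have code: "w = w' \<and> c = c'" if "code w c = code w' c'" for w w' c c'
  proof -
    have "inj (\<lambda>b. if b then e 0 else e 1)" using e01 by (auto simp: inj_def split: if_splits)
    then have "inj (map (\<lambda>b. if b then e 0 else e 1))" by (rule inj_mapI)
    then show ?thesis using that by (simp add: code_def inj_eq[OF hl] inj_eq[OF e] inj_eq)
  qed
  define ks where "ks f = (SOME ws. set ws = Poly_Mapping.keys f)" for f :: "bool list \<Rightarrow>\<^sub>0 'k"
  have ks: "set (ks f) = Poly_Mapping.keys f" for f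
    unfolding ks_def by (rule someI_ex) (simp add: finite_list)
  define h where "h f = hl (map (\<lambda>w. code w (Poly_Mapping.lookup f w)) (ks f))" for f
  have le: "Poly_Mapping.lookup g w = Poly_Mapping.lookup f w" if eq: "h f = h g" and w: "w \<in> Poly_Mapping.keys f" for f g w
  proof -
    have "(\<lambda>w. code w (Poly_Mapping.lookup f w)) ` Poly_Mapping.keys f
        = (\<lambda>w. code w (Poly_Mapping.lookup g w)) ` Poly_Mapping.keys g"
      using injD[OF hl eq[unfolded h_def]] by (metis ks list.set_map)
    then obtain w' where w': "code w (Poly_Mapping.lookup f w) = code w' (Poly_Mapping.lookup g w')"
      using w by blast
    from code[OF w'] show ?thesis by (elim conjE) simp
  qed
  have "f = g" if "h f = h g" for f g
  proof (rule poly_mapping_eqI)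
    fix w
    consider "w \<in> Poly_Mapping.keys f" | "w \<in> Poly_Mapping.keys g"
      | "w \<notin> Poly_Mapping.keys f" "w \<notin> Poly_Mapping.keys g" by blast
    then show "Poly_Mapping.lookup f w = Poly_Mapping.lookup g w"
    proof cases
      case 1
      then show ?thesis by (rule le[OF that, symmetric])
    next
      case 2
      then show ?thesis by (rule le[OF that[symmetric]])
    qed (simp add: in_keys_iff)
  qed
  then show ?thesis by (auto simp: inj_def)
qed

section \<open>Additive polynomials on the free algebra\<close>

text \<open>
  Here \<open>nat \<Rightarrow>\<^sub>0 'k\<close> stands for the polynomials in one variable.
\<close>

definition eval_poly :: "(nat \<Rightarrow>\<^sub>0 'k::field) \<Rightarrow> ('w::monoid_add \<Rightarrow>\<^sub>0 'k) \<Rightarrow> ('w \<Rightarrow>\<^sub>0 'k)" where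
  "eval_poly u l = lin_ext (\<lambda>n. l ^ n) u"

lemma lookup_gen_mult_Nil [simp]: "Poly_Mapping.lookup (free_gen b * g) [] = 0"
  by (subst poly_mapping_sum_singles[of g])
    (simp add: free_gen_def sum_distrib_left mult_single plus_list_def lookup_sum lookup_single)

lemma lookup_gen_mult_Cons [simp]:
  "Poly_Mapping.lookup (free_gen b * g) (c # v) = (if b = c then Poly_Mapping.lookup g v else 0)"
proof -
  have "Poly_Mapping.lookup (free_gen b * g) (c # v)
      = (\<Sum>w\<in>Poly_Mapping.keys g. if w = v then (if b = c then Poly_Mapping.lookup g v else 0) else 0)"
    by (subst poly_mapping_sum_singles[of g])
      (auto simp: free_gen_def sum_distrib_left mult_single plus_list_def lookup_sum lookup_single when_def
        intro!: sum.cong)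
  then show ?thesis by (simp add: in_keys_iff)
qed

lemma lookup_gen_power:
  "Poly_Mapping.lookup (free_gen b ^ n :: 'a list \<Rightarrow>\<^sub>0 'k::field) v = (if v = replicate n b then 1 else 0)"
proof (induction n arbitrary: v)
  case 0
  then show ?case by (simp add: one_list_algebra lookup_single when_def)
next
  case (Suc n)
  then show ?case by (cases v) auto
qed

lemma lookup_two_gens_power:
  "Poly_Mapping.lookup ((free_gen True + free_gen False) ^ n :: bool list \<Rightarrow>\<^sub>0 'k::field) v
    = (if length v = n then 1 else 0)"
proof (induction n arbitrary: v)
  case 0
  then show ?case by (simp add: one_list_algebra lookup_single when_def)
next
  case (Suc n)
  then show ?case by (cases v) (auto simp: distrib_right lookup_add)
qed

lemma lookup_eval_poly:
  "Poly_Mapping.lookup (eval_poly u l) v = (\<Sum>n\<in>Poly_Mapping.keys u. Poly_Mapping.lookup u n * Poly_Mapping.lookup (l ^ n) v)"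
  by (simp add: eval_poly_def lin_ext_def lookup_sum)

text \<open>
  In degree \<open>n \<ge> 2\<close> the word \<open>x y \<dots> y\<close> occurs in \<open>(x + y)^n\<close> but neither in \<open>x^n\<close> nor in \<open>y^n\<close>; in
  degree \<open>0\<close> additivity gives \<open>c = c + c\<close>. So only the linear term is left.
\<close>

lemma additive_poly_linear:
  fixes u :: "nat \<Rightarrow>\<^sub>0 'k::field"
  assumes add: "eval_poly u (free_gen True + free_gen False)
      = eval_poly u (free_gen True) + eval_poly u (free_gen False :: bool list \<Rightarrow>\<^sub>0 'k)"
  shows "u = Poly_Mapping.single 1 (Poly_Mapping.lookup u 1)"
proof (rule poly_mapping_eqI)
  fix n
  have sum: "(\<Sum>k\<in>Poly_Mapping.keys u. Poly_Mapping.lookup u k * (if m = k then 1 else 0)) = Poly_Mapping.lookup u m" for m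
  proof -
    have "(\<Sum>k\<in>Poly_Mapping.keys u. Poly_Mapping.lookup u k * (if m = k then 1 else 0))
      = (\<Sum>k\<in>Poly_Mapping.keys u. if k = m then Poly_Mapping.lookup u m else 0)"
      by (rule sum.cong) auto
    then show ?thesis by (simp add: in_keys_iff)
  qed
  have lhs: "Poly_Mapping.lookup (eval_poly u (free_gen True + free_gen False)) v = Poly_Mapping.lookup u (length v)"
    for v :: "bool list"
    by (simp add: lookup_eval_poly lookup_two_gens_power sum)
  have *: "Poly_Mapping.lookup u (length v) = Poly_Mapping.lookup (eval_poly u (free_gen True)) v
     + Poly_Mapping.lookup (eval_poly u (free_gen False)) v" for v :: "bool list"
    unfolding lhs[symmetric] add lookup_add ..
  have "Poly_Mapping.lookup u n = 0" if "n \<noteq> 1"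
  proof (cases n)
    case 0
    have "Poly_Mapping.lookup (eval_poly u (free_gen b)) [] = Poly_Mapping.lookup u 0" for b :: bool
      using sum[of 0] by (simp add: lookup_eval_poly lookup_gen_power)
    then have "Poly_Mapping.lookup u 0 = Poly_Mapping.lookup u 0 + Poly_Mapping.lookup u 0"
      using *[of "[]"] by (simp only: list.size)
    then show ?thesis using 0 by (simp only: add_cancel_right_right)
  next
    case (Suc m)
    with that obtain m' where n: "n = Suc (Suc m')" by (cases m) auto
    have "Poly_Mapping.lookup (eval_poly u (free_gen b)) (True # False # replicate m' False) = 0" for b
    proof -
      have "True # False # replicate m' False \<noteq> replicate k b" for k
        by (cases k; cases "k - 1") (auto simp: gr0_conv_Suc)
      then show ?thesis by (simp add: lookup_eval_poly lookup_gen_power)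
    qed
    then show ?thesis using *[of "True # False # replicate m' False"] n by simp
  qed
  then show "Poly_Mapping.lookup u n = Poly_Mapping.lookup (Poly_Mapping.single 1 (Poly_Mapping.lookup u 1)) n"
    by (auto simp: lookup_single when_def)
qed

section \<open>There is no natural isomorphism in positive characteristic\<close>

text \<open>
  When all letters are sent to multiples of one element \<open>l\<close>, substitution becomes the evaluation at \<open>l\<close>
  of a polynomial in one variable that does not depend on \<open>l\<close>.
\<close>

lemma subst_scaled:
  "subst (\<lambda>b. pm_scale (\<xi> b) l) f
    = eval_poly (lin_ext (\<lambda>w. Poly_Mapping.single (length w) (prod_list (map \<xi> w))) f) l"
proof (rule pm_linear_eqI[where f = f])
  show "pm_linear (\<lambda>f. eval_poly (lin_ext (\<lambda>w. Poly_Mapping.single (length w) (prod_list (map \<xi> w))) f) l)"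
    unfolding eval_poly_def by (rule pm_linear_comp) auto
  fix w
  have "prod_list (map (\<lambda>b. pm_scale (\<xi> b) l) w) = pm_scale (prod_list (map \<xi> w)) (l ^ length w)"
    by (induction w) (simp_all add: pm_scale_mult_left pm_scale_mult_right)
  then show "subst (\<lambda>b. pm_scale (\<xi> b) l) (Poly_Mapping.single w 1)
    = eval_poly (lin_ext (\<lambda>w. Poly_Mapping.single (length w) (prod_list (map \<xi> w))) (Poly_Mapping.single w 1)) l"
    by (simp add: subst_single eval_poly_def)
qed simp

lemma (in lie_algebra) subst_mod_env_ideal:
  assumes \<theta>: "\<And>x. x \<in> carrier L \<Longrightarrow> free_gen x - \<theta> x \<in> env_ideal L"
    "\<And>x. x \<in> carrier L \<Longrightarrow> \<theta> x \<in> free_carrier"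
    and f: "f \<in> free_carrier"
  shows "f - subst \<theta> f \<in> env_ideal L"
proof -
  have word: "Poly_Mapping.single w 1 - prod_list (map \<theta> w) \<in> env_ideal L" if "set w \<subseteq> carrier L" for w
    using that
  proof (induction w)
    case Nil
    then show ?case by (simp add: env_ideal_zero flip: one_list_algebra)
  next
    case (Cons x w)
    have "(free_gen x - \<theta> x) * Poly_Mapping.single w 1
        + \<theta> x * (Poly_Mapping.single w 1 - prod_list (map \<theta> w)) \<in> env_ideal L"
      using Cons \<theta> by (intro env_ideal_add env_ideal_mult_left env_ideal_mult_right) auto
    then show ?case by (simp add: left_diff_distrib right_diff_distrib free_gen_def mult_single plus_list_def)
  qed
  have "f - subst \<theta> f = lin_ext (\<lambda>w. Poly_Mapping.single w 1 - prod_list (map \<theta> w)) f"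
    by (rule pm_linear_eqI[where h = "\<lambda>f. f - subst \<theta> f"])
      (auto intro!: pm_linearI simp: pm_linear_add pm_linear_scale pm.scale_right_diff_distrib subst_single)
  then show ?thesis using f word by (auto simp: carrier_free_alg intro!: env_ideal_lin_ext)
qed

lemma CHAR_poly_mapping: "CHAR('m::comm_monoid_add \<Rightarrow>\<^sub>0 'k::field) = CHAR('k)"
proof (rule CHAR_eqI)
  have of_nat: "(of_nat n :: 'm \<Rightarrow>\<^sub>0 'k) = Poly_Mapping.single 0 (of_nat n)" for n
    by (induction n) (simp_all add: single_add)
  show "(of_nat CHAR('k) :: 'm \<Rightarrow>\<^sub>0 'k) = 0" by (simp only: of_nat of_nat_CHAR single_zero)
  fix n assume "(of_nat n :: 'm \<Rightarrow>\<^sub>0 'k) = 0"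
  then have "Poly_Mapping.single (0 :: 'm) (of_nat n :: 'k) = 0" by (simp only: of_nat)
  then have "(of_nat n :: 'k) = 0" by (metis lookup_single_eq lookup_zero)
  then show "CHAR('k) dvd n" by (simp add: of_nat_eq_0_iff_char_dvd)
qed

text \<open>
  In the symmetric algebra the \<open>p\<close>-th power is additive. The computation takes place in the polynomial
  ring, to which the symbol map reduces it.
\<close>

lemma (in lie_algebra) gen_add_power_CHAR:
  assumes p: "p = 1 \<or> p = CHAR('k) \<and> p > 0" and x: "x \<in> carrier L" and y: "y \<in> carrier L"
  shows "free_gen (x \<oplus> y) ^ p - (free_gen x ^ p + free_gen y ^ p) \<in> env_ideal (Ab L)"
proof -
  obtain coord where "lie_section L coord" using ex_lie_section by blast
  then interpret lie_section L coord .
  have power: "symbol (f ^ n) = symbol f ^ n" for f n by (simp add: symbol_def subst_power)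
  have "(symbol (free_gen x) + symbol (free_gen y)) ^ p = symbol (free_gen x) ^ p + symbol (free_gen y) ^ p"
  proof (cases "p = 1")
    case False
    then have "normalization_semidom_class.prime p" "p = CHAR('k)" using p prime_CHAR_semidom[where ?'a = 'k] by auto
    then show ?thesis by (intro freshmans_dream) (simp_all add: CHAR_poly_mapping)
  qed simp
  then have "symbol (free_gen (x \<oplus> y) ^ p - (free_gen x ^ p + free_gen y ^ p)) = 0"
    using x y by (simp add: pm_linear_diff pm_linear_add power symbol_gen coord_add lin_ext_add)
  then show ?thesis
    using x y by (subst env_ideal_Ab_iff) (auto intro!: free_alg_power_closed free_alg_closed)
qed

text \<open>
  The two Lie algebras to compare are the line \<open>K\<close> spanned by the letter \<open>t\<close> and the full free algebra
  \<open>M\<close> on two letters, both with the commutator bracket. The morphism \<open>m l\<close> sends \<open>t\<close> to \<open>l\<close>.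
\<close>

theorem no_natural_linear_isos:
  fixes e :: "(bool list \<Rightarrow>\<^sub>0 'k::field) \<Rightarrow> 'b"
  assumes e: "inj e" and char: "CHAR('k) > 0"
  shows "\<not> natural_linear_isos (\<eta> :: ('k, 'b) lie_ring \<Rightarrow> ('b list \<Rightarrow>\<^sub>0 'k) set \<Rightarrow> ('b list \<Rightarrow>\<^sub>0 'k) set)"
proof
  assume nat: "natural_linear_isos \<eta>"
  define t where "t = (free_gen True :: bool list \<Rightarrow>\<^sub>0 'k)"
  define V where "V = range (\<lambda>c. pm_scale c t)"
  define K where "K = comm_lie e V"
  define M where "M = comm_lie e UNIV"
  \<comment> \<open>Decoding, the coordinate along \<open>t\<close>, and the one-variable polynomial that an element of the free
    algebra on the line \<open>K\<close> defines.\<close>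
  define d where "d = inv_into UNIV e"
  define \<xi> where "\<xi> b = Poly_Mapping.lookup (d b) [True]" for b
  define m where "m l b = e (pm_scale (\<xi> b) l)" for l :: "bool list \<Rightarrow>\<^sub>0 'k" and b
  define P where "P f = lin_ext (\<lambda>w. Poly_Mapping.single (length w) (prod_list (map \<xi> w))) f"
    for f :: "'b list \<Rightarrow>\<^sub>0 'k"
  have d_e [simp]: "d (e u) = u" for u using e by (simp add: d_def)
  have \<xi>_e [simp]: "\<xi> (e (pm_scale c t)) = c" for c
    by (simp add: \<xi>_def t_def free_gen_def)
  have \<xi>_0 [simp]: "\<xi> (e 0) = 0" by (simp add: \<xi>_def)
  have \<xi>_t [simp]: "\<xi> (e t) = 1" using \<xi>_e[of 1] by simp
  have V: "pm.subspace V"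
    by (simp add: V_def flip: pm.span_singleton)
  have commV: "u * v - v * u = 0" if "u \<in> V" "v \<in> V" for u v
    using that by (auto simp: V_def pm_scale_mult_left pm_scale_mult_right mult.commute)
  have K: "lie_algebra K"
    unfolding K_def using commV V by (intro lie_algebra_comm_lie e) (auto simp: pm.subspace_def)
  have M: "lie_algebra M"
    unfolding M_def by (intro lie_algebra_comm_lie e) auto
  interpret K: lie_algebra K by (rule K)
  interpret M: lie_algebra M by (rule M)
  interpret AbK: lie_algebra "Ab K" by (rule K.lie_algebra_Ab)
  interpret AbM: lie_algebra "Ab M" by (rule M.lie_algebra_Ab)
  have carrier_K: "carrier K = e ` V" and carrier_M [simp]: "carrier M = range e"
    by (simp_all add: K_def M_def)
  have t_K [simp]: "e t \<in> carrier K"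
    unfolding carrier_K V_def by (metis imageI pm.scale_one rangeI)
  have m_hom: "m l \<in> lie_hom K M" for l
    using e commV
    by (auto simp: lie_hom_def carrier_K m_def K_def M_def V_def pm.scale_left_distrib
        pm_scale_mult_left pm_scale_mult_right mult.commute simp flip: pm.scale_left_distrib)
  have m_t: "m l (e t) = e l" for l by (simp add: m_def)

  have \<eta>_iso: "\<eta> L \<in> linear_iso (Env (Ab L)) (Env L)" if "lie_algebra L" for L
    using nat that by (auto simp: natural_linear_isos_def Sym_def)
  have \<eta>_nat: "\<eta> L' (Env_map (Ab L') f s) = Env_map L' f (\<eta> L s)"
    if "lie_algebra L" "lie_algebra L'" "f \<in> lie_hom L L'" "s \<in> carrier (Env (Ab L))" for L L' f s
    using nat that by (auto simp: natural_linear_isos_def Sym_def Sym_map_def)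

  \<comment> \<open>The values of \<open>\<eta>\<close> at \<open>t\<close> and at \<open>t^p\<close> are multiples of \<open>t\<close>: both powers are additive.\<close>
  have linear_rep: "\<exists>f a. f \<in> K.free_carrier \<and> \<eta> K (env_class (Ab K) (free_gen (e t) ^ n)) = env_class K f
      \<and> f - pm_scale a (free_gen (e t)) \<in> env_ideal K"
    if n: "n = 1 \<or> n = CHAR('k) \<and> n > 0" for n
  proof -
    let ?s = "env_class (Ab K) (free_gen (e t) ^ n)"
    have s: "?s \<in> carrier (Env (Ab K))"
      by (auto simp: AbK.carrier_Env intro!: imageI free_alg_power_closed free_alg_closed)
    then have "\<eta> K ?s \<in> carrier (Env K)"
      using \<eta>_iso[OF K] by (auto simp: linear_iso_def bij_betw_def)
    then obtain f where f: "f \<in> K.free_carrier" "\<eta> K ?s = env_class K f" by (auto simp: K.carrier_Env)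
    have image: "\<eta> M (env_class (Ab M) (free_gen (e l) ^ n)) = env_class M (subst (\<lambda>x. free_gen (m l x)) f)" for l
    proof -
      have "Env_map (Ab M) (m l) ?s = env_class (Ab M) (subst (\<lambda>x. free_gen (m l x)) (free_gen (e t) ^ n))"
        by (rule Env_map_class[OF AbK.lie_algebra_axioms AbM.lie_algebra_axioms lie_hom_Ab[OF K M m_hom]])
          (auto intro!: free_alg_power_closed free_alg_closed)
      also have "\<dots> = env_class (Ab M) (free_gen (e l) ^ n)" by (simp add: subst_power m_t)
      finally show ?thesis
        using \<eta>_nat[OF K M m_hom[of l] s] Env_map_class[OF K M m_hom[of l] f(1)] f(2) by metis
    qed
    have image_closed: "subst (\<lambda>x. free_gen (m l x)) f \<in> M.free_carrier" for l
      using f(1) by (rule subst_closed) (auto simp: m_def intro!: free_alg_closed)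
    have eval_ideal: "subst d g = 0" if "g \<in> env_ideal M" for g
      using that by (intro M.subst_env_ideal[of d g]) (auto simp: M_def e)
    have eval: "subst d (subst (\<lambda>x. free_gen (m l x)) f) = eval_poly (P f) l" for l :: "bool list \<Rightarrow>\<^sub>0 'k"
      by (simp add: subst_subst m_def P_def subst_scaled)
    have "eval_poly (P f) (l + l') = eval_poly (P f) l + eval_poly (P f) l'"
      for l l' :: "bool list \<Rightarrow>\<^sub>0 'k"
    proof -
      let ?g = "\<lambda>l. free_gen (e l) ^ n :: 'b list \<Rightarrow>\<^sub>0 'k"
      let ?f = "\<lambda>l. subst (\<lambda>x. free_gen (m l x)) f"
      have g: "?g l \<in> M.free_carrier" for l by (auto intro!: free_alg_power_closed free_alg_closed)
      have "env_class M (?f (l + l')) = \<eta> M (env_class (Ab M) (?g (l + l')))" by (simp add: image)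
      also have "env_class (Ab M) (?g (l + l')) = env_class (Ab M) (?g l + ?g l')"
        using M.gen_add_power_CHAR[OF n, of "e l" "e l'"] g
        by (intro AbM.env_class_eqI) (auto simp: M_def e intro!: free_alg_closed)
      also have "\<dots> = env_class (Ab M) (?g l) \<oplus>\<^bsub>Env (Ab M)\<^esub> env_class (Ab M) (?g l')"
        using g by (simp add: AbM.Env_add)
      also have "\<eta> M \<dots> = \<eta> M (env_class (Ab M) (?g l)) \<oplus>\<^bsub>Env M\<^esub> \<eta> M (env_class (Ab M) (?g l'))"
        using \<eta>_iso[OF M] g by (auto simp: linear_iso_def AbM.carrier_Env)
      also have "\<dots> = env_class M (?f l + ?f l')"
        using image_closed by (simp add: image M.Env_add)
      finally have "?f (l + l') - (?f l + ?f l') \<in> env_ideal M"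
        using image_closed by (subst (asm) M.env_class_eq_iff) (auto intro!: free_alg_closed)
      from eval_ideal[OF this] show ?thesis by (simp add: pm_linear_diff pm_linear_add eval)
    qed
    then have P: "P f = Poly_Mapping.single 1 (Poly_Mapping.lookup (P f) 1)"
      by (intro additive_poly_linear)
    have "f - subst (\<lambda>x. pm_scale (\<xi> x) (free_gen (e t))) f \<in> env_ideal K"
    proof (rule K.subst_mod_env_ideal[OF _ _ f(1)])
      fix x assume "x \<in> carrier K"
      then obtain c where x: "x = e (pm_scale c t)" by (auto simp: carrier_K V_def)
      then show "free_gen x - pm_scale (\<xi> x) (free_gen (e t)) \<in> env_ideal K"
        using K.env_ideal_gen_scale[OF t_K, of c] comm_lie_simps(4)[OF e, where V = V]
        by (simp add: x K_def[symmetric])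
      show "pm_scale (\<xi> x) (free_gen (e t)) \<in> K.free_carrier" by (auto intro!: free_alg_closed)
    qed
    also have "subst (\<lambda>x. pm_scale (\<xi> x) (free_gen (e t))) f = eval_poly (P f) (free_gen (e t))"
      by (simp add: subst_scaled P_def)
    also have "\<dots> = pm_scale (Poly_Mapping.lookup (P f) 1) (free_gen (e t))"
      by (subst P) (simp add: eval_poly_def)
    finally show ?thesis using f by blast
  qed
  let ?x = "free_gen (e t) :: 'b list \<Rightarrow>\<^sub>0 'k"
  let ?p = "CHAR('k)"
  have x: "?x \<in> K.free_carrier" by (simp add: free_alg_closed)
  have p2: "?p \<ge> 2" using prime_CHAR_semidom[where ?'a = 'k] char prime_ge_2_nat by blast
  obtain f a where f: "f \<in> K.free_carrier" "\<eta> K (env_class (Ab K) (?x ^ 1)) = env_class K f"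
    "f - pm_scale a ?x \<in> env_ideal K" using linear_rep[of 1] by auto
  obtain g b where g: "g \<in> K.free_carrier" "\<eta> K (env_class (Ab K) (?x ^ ?p)) = env_class K g"
    "g - pm_scale b ?x \<in> env_ideal K" using linear_rep[of ?p] char by auto
  have \<eta>_scale: "\<eta> K (env_class (Ab K) (pm_scale c h)) = env_class K (pm_scale c h')"
    if "h \<in> K.free_carrier" "h' \<in> K.free_carrier" "\<eta> K (env_class (Ab K) h) = env_class K h'" for c h h'
  proof -
    have "\<eta> K (c \<odot>\<^bsub>Env (Ab K)\<^esub> env_class (Ab K) h) = c \<odot>\<^bsub>Env K\<^esub> \<eta> K (env_class (Ab K) h)"
      using \<eta>_iso[OF K] that by (auto simp: linear_iso_def AbK.carrier_Env)
    then show ?thesis using that by (simp add: AbK.Env_smult K.Env_smult)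
  qed
  have \<eta>_inj: "h - h' \<in> env_ideal (Ab K)"
    if "h \<in> K.free_carrier" "h' \<in> K.free_carrier" "\<eta> K (env_class (Ab K) h) = \<eta> K (env_class (Ab K) h')" for h h'
  proof -
    have "inj_on (\<eta> K) (carrier (Env (Ab K)))" using \<eta>_iso[OF K] by (auto simp: linear_iso_def bij_betw_def)
    then have "env_class (Ab K) h = env_class (Ab K) h'"
      by (rule inj_onD) (use that in \<open>auto simp: AbK.carrier_Env\<close>)
    then show ?thesis using that by (simp add: AbK.env_class_eq_iff)
  qed
  have eval_ideal: "subst d h = 0" if "h \<in> env_ideal (Ab K)" for h
    using that commV by (intro AbK.subst_env_ideal[of d h]) (auto simp: carrier_K K_def e)
  have xp: "?x ^ n \<in> K.free_carrier" for n using x by (rule free_alg_power_closed)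
  have "pm_scale b f - pm_scale a g
      = pm_scale b (f - pm_scale a ?x) - pm_scale a (g - pm_scale b ?x)"
    by (simp add: pm.scale_right_diff_distrib mult.commute)
  also have "\<dots> \<in> env_ideal K"
    by (rule K.env_ideal_diff[OF K.env_ideal_scale[OF f(3)] K.env_ideal_scale[OF g(3)]])
  finally have "env_class K (pm_scale b f) = env_class K (pm_scale a g)"
    using g(1) by (intro K.env_class_eqI free_alg_scale_closed)
  then have "pm_scale b (?x ^ 1) - pm_scale a (?x ^ ?p) \<in> env_ideal (Ab K)"
    using \<eta>_scale[OF xp f(1,2)] \<eta>_scale[OF xp g(1,2)] xp x
    by (intro \<eta>_inj free_alg_scale_closed) auto
  from eval_ideal[OF this]
  have "pm_scale b t = pm_scale a (t ^ ?p)"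
    by (simp add: pm_linear_diff pm_linear_scale subst_power)
  then have "b * Poly_Mapping.lookup t (replicate ?p True) = a * Poly_Mapping.lookup (t ^ ?p) (replicate ?p True)"
    by (metis lookup_pm_scale)
  moreover have "[True] \<noteq> replicate ?p True" using p2 by (auto dest: arg_cong[where f = length])
  ultimately have "a = 0" by (simp add: t_def lookup_gen_power) (simp add: free_gen_def lookup_single)
  then have "env_class K f = env_class K (pm_scale 0 f)"
    using f by (intro K.env_class_eqI) (auto simp: free_alg_closed)
  then have "?x ^ 1 - pm_scale 0 (?x ^ 1) \<in> env_ideal (Ab K)"
    using \<eta>_scale[OF xp f(1,2), of 0] f(2) xp x by (intro \<eta>_inj free_alg_scale_closed) auto
  from eval_ideal[OF this] have "t = 0" by simp
  then show False using \<xi>_t \<xi>_0 by simp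
qed

theorem proposition4p3:
  fixes p :: nat
  assumes "CHAR('k::field) = p" and "p > 0"
  shows "Ass_Lie_PBW_pair TYPE('k) TYPE('a) \<and>
    (\<forall>L :: ('k, 'a) lie_ring. lie_algebra L \<longrightarrow>
       Sym L = Env (Ab L) \<and> pbw_map L \<in> alg_iso (Sym L) (Gr L)) \<and>
    (infinite (UNIV :: 'b set) \<and> (\<exists>e :: 'k \<Rightarrow> 'b. inj e) \<longrightarrow>
       \<not> (\<exists>\<eta> :: ('k, 'b) lie_ring \<Rightarrow> ('b list \<Rightarrow>\<^sub>0 'k) set \<Rightarrow> ('b list \<Rightarrow>\<^sub>0 'k) set.
            natural_linear_isos \<eta>))"
proof (intro conjI impI allI)
  show "Ass_Lie_PBW_pair TYPE('k) TYPE('a)"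
    by (simp add: Ass_Lie_PBW_pair_def lie_algebra.pbw_map_iso)
next
  fix L :: "('k, 'a) lie_ring" assume "lie_algebra L"
  then show "Sym L = Env (Ab L)" "pbw_map L \<in> alg_iso (Sym L) (Gr L)"
    by (simp_all add: Sym_def lie_algebra.pbw_map_iso)
next
  assume *: "infinite (UNIV :: 'b set) \<and> (\<exists>e :: 'k \<Rightarrow> 'b. inj e)"
  then obtain e :: "(bool list \<Rightarrow>\<^sub>0 'k) \<Rightarrow> 'b" where "inj e" using ex_inj_free_algebra by blast
  then show "\<not> (\<exists>\<eta> :: ('k, 'b) lie_ring \<Rightarrow> ('b list \<Rightarrow>\<^sub>0 'k) set \<Rightarrow> ('b list \<Rightarrow>\<^sub>0 'k) set.
            natural_linear_isos \<eta>)"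
    using no_natural_linear_isos assms by blast
qed

end
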